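(* Let $X$ be a similarity Hopf manifold of complex dimension at least three. Then there exists no astheno-Kähler metric on $X$.
   Context: A compact complex manifold $X$ is called a similarity Hopf manifold if it is a finite undercover of a Hopf manifold $M=(\mathbb{C}^n\setminus\{0\})/\langle\phi\rangle$, i.e. there is a finite unramified holomorphic covering $M\to X$, where $\phi(\mathbf z)=a\,\mathbf z A$ with $A\in U(n)$, $\mathbf z=(z_1,\dots,z_n)$ a row vector, and $a>1$ a real number; $\langle\phi\rangle$ is the cyclic group generated by $\phi$. On a complex manifold of complex dimension $n$, a Hermitian metric with fundamental $(1,1)$-form $\omega$ is called astheno-Kähler if $\partial\bar\partial\omega^{n-2}=0$. *)

theory Defs
  imports "HOL-Analysis.Analysis" "HOL-Combinatorics.Permutations"
begin

section \<open>Holomorphic maps and smooth functions\<close>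

definition holo_on :: "(complex^'n \<Rightarrow> complex^'m) \<Rightarrow> (complex^'n) set \<Rightarrow> bool" where
  "holo_on f S \<longleftrightarrow>
     (\<forall>z\<in>S. \<exists>D. (f has_derivative D) (at z) \<and> (\<forall>c v. D (c *s v) = c *s D v))"

text \<open>
  Real differentiability of class \<open>C\<^sup>k\<close> on an open subset of a finite-dimensional space:
  iterated directional derivatives exist and are continuous.
\<close>
primrec Ck_on :: "nat \<Rightarrow> 'a::euclidean_space set \<Rightarrow> ('a \<Rightarrow> 'b::real_normed_vector) \<Rightarrow> bool" where
  "Ck_on 0 S f \<longleftrightarrow> continuous_on S f"
| "Ck_on (Suc k) S f \<longleftrightarrow>
     (\<forall>x\<in>S. f differentiable (at x)) \<and> (\<forall>u. Ck_on k S (\<lambda>x. frechet_derivative f (at x) u))"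

definition smooth_on :: "'a::euclidean_space set \<Rightarrow> ('a \<Rightarrow> 'b::real_normed_vector) \<Rightarrow> bool" where
  "smooth_on S f \<longleftrightarrow> (\<forall>k. Ck_on k S f)"

section \<open>Complex manifolds\<close>

type_synonym ('x, 'n) chart = "'x set \<times> ('x \<Rightarrow> complex^'n)"

definition complex_atlas :: "'x topology \<Rightarrow> ('x, 'n::finite) chart set \<Rightarrow> bool" where
  "complex_atlas X \<A> \<longleftrightarrow>
     (\<forall>(U, \<phi>)\<in>\<A>. openin X U \<and> open (\<phi> ` U) \<and>
        homeomorphic_map (subtopology X U) (top_of_set (\<phi> ` U)) \<phi>) \<and>
     (\<Union>(U, \<phi>)\<in>\<A>. U) = topspace X \<and>
     (\<forall>(U, \<phi>)\<in>\<A>. \<forall>(V, \<psi>)\<in>\<A>. holo_on (\<psi> \<circ> inv_into U \<phi>) (\<phi> ` (U \<inter> V)))"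

definition complex_manifold :: "'x topology \<Rightarrow> ('x, 'n::finite) chart set \<Rightarrow> bool" where
  "complex_manifold X \<A> \<longleftrightarrow> Hausdorff_space X \<and> second_countable X \<and> complex_atlas X \<A>"

definition holomorphic_map ::
  "'x topology \<Rightarrow> ('x, 'n::finite) chart set \<Rightarrow> 'y topology \<Rightarrow> ('y, 'm::finite) chart set \<Rightarrow>
   ('x \<Rightarrow> 'y) \<Rightarrow> bool" where
  "holomorphic_map X \<A> Y \<B> p \<longleftrightarrow> continuous_map X Y p \<and>
     (\<forall>(U, \<phi>)\<in>\<A>. \<forall>(V, \<psi>)\<in>\<B>.
        holo_on (\<psi> \<circ> p \<circ> inv_into U \<phi>) (\<phi> ` (U \<inter> p -` V)))"

definition unramified ::
  "('x, 'n::finite) chart set \<Rightarrow> ('y, 'm::finite) chart set \<Rightarrow> ('x \<Rightarrow> 'y) \<Rightarrow> bool" where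
  "unramified \<A> \<B> p \<longleftrightarrow>
     (\<forall>(U, \<phi>)\<in>\<A>. \<forall>(V, \<psi>)\<in>\<B>. \<forall>z \<in> \<phi> ` (U \<inter> p -` V).
        bij (frechet_derivative (\<psi> \<circ> p \<circ> inv_into U \<phi>) (at z)))"

text \<open>
  The analogue of \<^const>\<open>covering_space\<close> for abstract topologies, with finitely many sheets.
\<close>
definition finite_covering :: "'x topology \<Rightarrow> 'y topology \<Rightarrow> ('x \<Rightarrow> 'y) \<Rightarrow> bool" where
  "finite_covering M X p \<longleftrightarrow>
     continuous_map M X p \<and> p ` topspace M = topspace X \<and>
     (\<forall>x\<in>topspace X. \<exists>U. x \<in> U \<and> openin X U \<and>
        (\<exists>\<V>. finite \<V> \<and> \<Union>\<V> = {y \<in> topspace M. p y \<in> U} \<and> pairwise disjnt \<V> \<and>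
           (\<forall>V\<in>\<V>. openin M V \<and>
              homeomorphic_map (subtopology M V) (subtopology X U) p)))"

section \<open>Similarity Hopf manifolds\<close>

definition unitary_matrix :: "complex^'n^'n \<Rightarrow> bool" where
  "unitary_matrix A \<longleftrightarrow>
     A ** (\<chi> i j. cnj (A $ j $ i)) = mat 1 \<and> (\<chi> i j. cnj (A $ j $ i)) ** A = mat 1"

definition similarity :: "real \<Rightarrow> complex^'n^'n \<Rightarrow> complex^'n \<Rightarrow> complex^'n" where
  "similarity a A z = complex_of_real a *s (z v* A)"

text \<open>The orbit of a point under the cyclic group generated by a bijection \<open>f\<close>.\<close>
definition cyclic_orbit :: "('a \<Rightarrow> 'a) \<Rightarrow> 'a \<Rightarrow> 'a set" where
  "cyclic_orbit f z = (\<Union>k::nat. {(f ^^ k) z, (inv f ^^ k) z})"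

text \<open>
  The quotient of the punctured space by the cyclic group, with the quotient topology.
  Its charts are the inverses of the projection restricted to the
  open sets on which the projection is injective.
\<close>
definition hopf_space :: "(complex^'n::finite \<Rightarrow> complex^'n) \<Rightarrow> (complex^'n) set topology" where
  "hopf_space f = topology (\<lambda>U. U \<subseteq> cyclic_orbit f ` (- {0}) \<and>
     open {z. z \<noteq> 0 \<and> cyclic_orbit f z \<in> U})"

definition hopf_atlas ::
  "(complex^'n::finite \<Rightarrow> complex^'n) \<Rightarrow> ((complex^'n) set, 'n) chart set" where
  "hopf_atlas f = {(cyclic_orbit f ` V, inv_into V (cyclic_orbit f)) | V.
     open V \<and> 0 \<notin> V \<and> inj_on (cyclic_orbit f) V}"

lemma openin_hopf_space:
  "openin (hopf_space f) U \<longleftrightarrow>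
     U \<subseteq> cyclic_orbit f ` (- {0}) \<and> open {z. z \<noteq> 0 \<and> cyclic_orbit f z \<in> U}"
proof -
  have "istopology (\<lambda>U. U \<subseteq> cyclic_orbit f ` (- {0}) \<and>
          open {z. z \<noteq> 0 \<and> cyclic_orbit f z \<in> U})" (is "istopology ?P")
    unfolding istopology_def
  proof (intro conjI allI impI)
    fix S T assume S: "?P S" and T: "?P T"
    show "S \<inter> T \<subseteq> cyclic_orbit f ` (- {0})"
      using S by blast
    have "{z. z \<noteq> 0 \<and> cyclic_orbit f z \<in> S \<inter> T} =
          {z. z \<noteq> 0 \<and> cyclic_orbit f z \<in> S} \<inter> {z. z \<noteq> 0 \<and> cyclic_orbit f z \<in> T}"
      by blast
    then show "open {z. z \<noteq> 0 \<and> cyclic_orbit f z \<in> S \<inter> T}"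
      using S T by auto
  next
    fix \<K> assume K: "\<forall>K\<in>\<K>. ?P K"
    show "\<Union>\<K> \<subseteq> cyclic_orbit f ` (- {0})"
      using K by blast
    have "{z. z \<noteq> 0 \<and> cyclic_orbit f z \<in> \<Union>\<K>} =
          (\<Union>K\<in>\<K>. {z. z \<noteq> 0 \<and> cyclic_orbit f z \<in> K})"
      by blast
    then show "open {z. z \<noteq> 0 \<and> cyclic_orbit f z \<in> \<Union>\<K>}"
      using K by auto
  qed
  then show ?thesis
    by (simp add: hopf_space_def)
qed

definition similarity_hopf_manifold :: "'x topology \<Rightarrow> ('x, 'n::finite) chart set \<Rightarrow> bool" where
  "similarity_hopf_manifold X \<A> \<longleftrightarrow>
     complex_manifold X \<A> \<and> compact_space X \<and>
     (\<exists>(a::real) (A::complex^'n^'n) p. a > 1 \<and> unitary_matrix A \<and>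
        (let f = similarity a A in
           holomorphic_map (hopf_space f) (hopf_atlas f) X \<A> p \<and>
           unramified (hopf_atlas f) \<A> p \<and>
           finite_covering (hopf_space f) X p))"

section \<open>Differential forms on open subsets of complex coordinate space\<close>

text \<open>
  A complex-valued \<open>k\<close>-form is a function of a point \<open>z\<close> and a sequence \<open>v\<close> of tangent
  vectors, of which only \<open>v 0, \<dots>, v (k - 1)\<close> are used.
\<close>
type_synonym 'n form = "complex^'n \<Rightarrow> (nat \<Rightarrow> complex^'n) \<Rightarrow> complex"

definition wedge :: "nat \<Rightarrow> nat \<Rightarrow> 'n form \<Rightarrow> 'n form \<Rightarrow> 'n form" where
  "wedge p q \<alpha> \<beta> z v =
     (\<Sum>\<sigma> | \<sigma> permutes {..<p + q}.
        of_int (sign \<sigma>) * \<alpha> z (\<lambda>i. v (\<sigma> i)) * \<beta> z (\<lambda>i. v (\<sigma> (p + i)))) / (fact p * fact q)"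

primrec wedge_power2 :: "'n form \<Rightarrow> nat \<Rightarrow> 'n form" \<comment> \<open>powers of a 2-form\<close> where
  "wedge_power2 \<omega> 0 = (\<lambda>z v. 1)"
| "wedge_power2 \<omega> (Suc k) = wedge 2 (2 * k) \<omega> (wedge_power2 \<omega> k)"

text \<open>
  The values at \<open>u\<close> of \<open>\<partial>f = \<Sum>\<^sub>j (\<partial>f/\<partial>z\<^sub>j) dz\<^sub>j\<close> and of its conjugate counterpart: the
  complex-linear and complex-antilinear parts of the real differential of \<open>f\<close>.
\<close>
definition d_hol :: "(complex^'n::finite \<Rightarrow> complex) \<Rightarrow> complex^'n \<Rightarrow> complex^'n \<Rightarrow> complex" where
  "d_hol f z u =
     (frechet_derivative f (at z) u - \<i> * frechet_derivative f (at z) (\<i> *s u)) / 2"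

definition d_antihol :: "(complex^'n::finite \<Rightarrow> complex) \<Rightarrow> complex^'n \<Rightarrow> complex^'n \<Rightarrow> complex" where
  "d_antihol f z u =
     (frechet_derivative f (at z) u + \<i> * frechet_derivative f (at z) (\<i> *s u)) / 2"

text \<open>
  The Dolbeault operators on \<open>k\<close>-forms.  Writing \<open>dw\<^sub>j\<close> for the conjugate of \<open>dz\<^sub>j\<close>, if \<open>\<alpha> = \<Sum> f\<^sub>I\<^sub>J dz\<^sub>I \<and> dw\<^sub>J\<close>, then
  \<open>\<partial>\<alpha> = \<Sum> \<partial>f\<^sub>I\<^sub>J \<and> dz\<^sub>I \<and> dw\<^sub>J\<close>; evaluated on constant vector fields this is the usual
  alternating sum over the omitted vector, with \<open>d\<close> of the coefficients replaced
  by \<open>\<partial>\<close>.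
\<close>
definition del :: "nat \<Rightarrow> 'n::finite form \<Rightarrow> 'n form" where
  "del k \<alpha> z v = (\<Sum>i\<le>k. (-1) ^ i *
     d_hol (\<lambda>y. \<alpha> y (\<lambda>j. v (if j < i then j else Suc j))) z (v i))"

definition delbar :: "nat \<Rightarrow> 'n::finite form \<Rightarrow> 'n form" where
  "delbar k \<alpha> z v = (\<Sum>i\<le>k. (-1) ^ i *
     d_antihol (\<lambda>y. \<alpha> y (\<lambda>j. v (if j < i then j else Suc j))) z (v i))"

section \<open>Hermitian and astheno-Kaehler metrics\<close>

text \<open>
  A Hermitian metric is given by its local expressions \<open>H c\<close> in the charts \<open>c\<close> of the atlas,
  related by the tensor transformation law.
\<close>
type_synonym ('x, 'n) local_sesquilinear =
  "('x, 'n) chart \<Rightarrow> complex^'n \<Rightarrow> complex^'n \<Rightarrow> complex^'n \<Rightarrow> complex"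

definition hermitian_inner :: "(complex^'n::finite \<Rightarrow> complex^'n \<Rightarrow> complex) \<Rightarrow> bool" where
  "hermitian_inner h \<longleftrightarrow>
     (\<forall>u v w. h (u + v) w = h u w + h v w) \<and> (\<forall>c u w. h (c *s u) w = c * h u w) \<and>
     (\<forall>u w. h w u = cnj (h u w)) \<and> (\<forall>u. u \<noteq> 0 \<longrightarrow> Re (h u u) > 0)"

definition hermitian_metric ::
  "('x, 'n::finite) chart set \<Rightarrow> ('x, 'n) local_sesquilinear \<Rightarrow> bool" where
  "hermitian_metric \<A> H \<longleftrightarrow>
     (\<forall>(U, \<phi>)\<in>\<A>. (\<forall>z\<in>\<phi> ` U. hermitian_inner (H (U, \<phi>) z)) \<and>
        (\<forall>u w. smooth_on (\<phi> ` U) (\<lambda>z. H (U, \<phi>) z u w))) \<and>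
     (\<forall>(U, \<phi>)\<in>\<A>. \<forall>(V, \<psi>)\<in>\<A>. \<forall>z \<in> \<phi> ` (U \<inter> V). \<forall>u w.
        (let \<tau> = \<psi> \<circ> inv_into U \<phi>; D = frechet_derivative \<tau> (at z)
         in H (U, \<phi>) z u w = H (V, \<psi>) (\<tau> z) (D u) (D w)))"

text \<open>
  \<open>(\<i>/2) \<Sum> h\<^sub>j\<^sub>k dz\<^sub>j \<and> dw\<^sub>k\<close> for \<open>h = \<Sum> h\<^sub>j\<^sub>k dz\<^sub>j \<otimes> dw\<^sub>k\<close>, that is \<open>- Im h\<close>,
  where again \<open>dw\<^sub>k\<close> is the conjugate of \<open>dz\<^sub>k\<close>.
\<close>
definition fundamental_form ::
  "(complex^'n \<Rightarrow> complex^'n \<Rightarrow> complex^'n \<Rightarrow> complex) \<Rightarrow> 'n form" where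
  "fundamental_form h z v = \<i> / 2 * (h z (v 0) (v 1) - h z (v 1) (v 0))"

text \<open>
  The equation \<open>del (delbar (\<omega>\<^bsup>n-2\<^esup>)) = 0\<close> is invariant under holomorphic coordinate changes and is
  imposed in every chart.
\<close>
definition astheno_kaehler ::
  "('x, 'n::finite) chart set \<Rightarrow> ('x, 'n) local_sesquilinear \<Rightarrow> bool" where
  "astheno_kaehler \<A> H \<longleftrightarrow>
     (let k = CARD('n) - 2 in
      \<forall>(U, \<phi>)\<in>\<A>. \<forall>z\<in>\<phi> ` U. \<forall>v.
        del (2 * k + 1) (delbar (2 * k)
          (wedge_power2 (fundamental_form (H (U, \<phi>))) k)) z v = 0)"

end

theory Submission
  imports Defs "HOL-Complex_Analysis.Cauchy_Integral_Formula"
begin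

text \<open>
  Pull the metric back to \<open>h\<close> on \<open>\<complex>\<^sup>n - {0}\<close>.  Invariance under the similarity makes \<open>|z|\<^sup>2 h\<^sub>z\<close> uniformly
  comparable to the Euclidean metric, and this is all that is kept of the group action.  Put
  \<open>t = ln |z|\<^sup>2\<close>.  On a complex hyperplane missing the origin, of dimension \<open>d = n - 1 \<ge> 2\<close>, the equation
  \<open>dd\<^sup>c \<omega>\<^bsup>n-2\<^esup> = 0\<close> gives \<open>\<integral> \<omega>\<^bsup>d-1\<^esup> \<and> dd\<^sup>c g = 0\<close> for every test function \<open>g\<close>.  Take \<open>g = (max 0 (T - t))\<^sup>3\<close>.
  Where \<open>t < T\<close>, \<open>dd\<^sup>c g\<close> is \<open>- 3 (T - t)\<^sup>2 dd\<^sup>c t + 6 (T - t) dt \<and> d\<^sup>c t\<close>, and \<open>\<omega>\<^bsup>d-1\<^esup> \<and> dt \<and> d\<^sup>c t\<close> is at most a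
  constant multiple of \<open>\<omega>\<^bsup>d-1\<^esup> \<and> dd\<^sup>c t\<close> because \<open>d \<ge> 2\<close>.  So the integrand has a sign except in the shell where
  \<open>T - t\<close> is bounded.  The contribution of the shell stays bounded as \<open>T\<close> grows, while that of a fixed
  box tends to infinity.
\<close>

section \<open>Calculus of smooth functions\<close>

text \<open>Degrees dictate the hyperplanes: \<omega>^(n-2) wedged with a (1,1)-form has top degree
  on a complex subspace of dimension \<open>n - 1\<close>. A hyperplane missing the origin also
  avoids the singularity of \<open>t\<close>, so only infinity has to be cut off. Integrals over
  single hyperplanes are never formed: the remaining coordinate runs over a unit square, and all
  integrals are over boxes in the full space. The cube is the smallest integral power of the
  positive part with continuous second derivatives. The obstacle is that dd^c t degenerates along
  the line through z, to which a single tangent direction can become asymptotic at infinity. Of two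
  orthogonal tangent directions at least one stays away from that line, which bounds the trace of
  the Levi form with respect to \<omega> from below. The shell lies in a region of volume of order
  exp(dT), and the density of \<omega>^(d-1) wedge dd^c t is at most of order exp(-dT) there. These
  rates cancel exactly, and this is where the weight |z|^2 in the comparison of metrics
  enters.\<close>

lemma frechet_derivative_cong_open:
  assumes "open S" "x \<in> S" "\<And>y. y \<in> S \<Longrightarrow> f y = g y"
  shows "frechet_derivative f (at x) = frechet_derivative g (at x)"
proof -
  have "(f has_derivative D) (at x) \<longleftrightarrow> (g has_derivative D) (at x)" for D
    using has_derivative_transform_within_open[OF _ assms(1,2), of f D UNIV g]
      has_derivative_transform_within_open[OF _ assms(1,2), of g D UNIV f] assms(3) by auto
  then show ?thesis unfolding frechet_derivative_def by simp
qed

lemma frechet_derivative_eq: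
  "(f has_derivative D) (at x) \<Longrightarrow> frechet_derivative f (at x) = D"
  using frechet_derivative_at by metis

lemma Ck_on_SucD: "Ck_on (Suc k) S f \<Longrightarrow> Ck_on k S f"
proof (induction k arbitrary: f)
  case 0
  then show ?case
    by (auto intro!: continuous_at_imp_continuous_on differentiable_imp_continuous_within)
next
  case (Suc k)
  then show ?case by (metis Ck_on.simps(2))
qed

lemma Ck_on_mono: "Ck_on k S f \<Longrightarrow> j \<le> k \<Longrightarrow> Ck_on j S f"
  by (induction k) (auto simp: le_Suc_eq simp del: Ck_on.simps dest: Ck_on_SucD)

lemma Ck_on_cong:
  assumes "open S" "\<And>y. y \<in> S \<Longrightarrow> f y = g y"
  shows "Ck_on k S f \<longleftrightarrow> Ck_on k S g"
  using assms(2)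
proof (induction k arbitrary: f g)
  case 0
  then show ?case by (simp cong: continuous_on_cong)
next
  case (Suc k)
  have d: "f differentiable at x \<longleftrightarrow> g differentiable at x" if "x \<in> S" for x
    unfolding differentiable_def
    using has_derivative_transform_within_open[OF _ assms(1) that, of f _ UNIV g]
      has_derivative_transform_within_open[OF _ assms(1) that, of g _ UNIV f] Suc.prems by metis
  have e: "Ck_on k S (\<lambda>x. frechet_derivative f (at x) u) \<longleftrightarrow>
      Ck_on k S (\<lambda>x. frechet_derivative g (at x) u)" for u
    by (rule Suc.IH) (use frechet_derivative_cong_open[OF assms(1) _ Suc.prems] in auto)
  show ?case using d e by simp
qed

lemma Ck_on_const: "Ck_on k S (\<lambda>x. c)"
  by (induction k arbitrary: c) (auto simp: frechet_derivative_const)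

lemma Ck_on_Suc_I:
  assumes "open S" "\<And>x. x \<in> S \<Longrightarrow> (f has_derivative D x) (at x)"
    and "\<And>u. Ck_on k S (\<lambda>x. D x u)"
  shows "Ck_on (Suc k) S f"
proof -
  have "Ck_on k S (\<lambda>x. frechet_derivative f (at x) u)" for u
    using assms(3)[of u] Ck_on_cong[OF assms(1), of "\<lambda>x. frechet_derivative f (at x) u" "\<lambda>x. D x u" k]
      frechet_derivative_eq[OF assms(2)] by auto
  then show ?thesis using assms(2) by (auto simp: differentiable_def)
qed

lemma Ck_on_derivative:
  assumes "Ck_on (Suc k) S f" "x \<in> S"
  shows "(f has_derivative frechet_derivative f (at x)) (at x)"
  using assms frechet_derivative_works by auto

lemma Ck_on_add:
  assumes "open S" "Ck_on k S f" "Ck_on k S g"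
  shows "Ck_on k S (\<lambda>x. f x + g x)"
  using assms(2,3)
proof (induction k arbitrary: f g)
  case 0
  then show ?case by (auto intro: continuous_intros)
next
  case (Suc k)
  show ?case
    by (rule Ck_on_Suc_I[OF assms(1) has_derivative_add[OF Ck_on_derivative Ck_on_derivative]])
      (use Suc in auto)
qed

lemma Ck_on_sum:
  assumes "open S" "\<And>i. i \<in> I \<Longrightarrow> Ck_on k S (f i)"
  shows "Ck_on k S (\<lambda>x. \<Sum>i\<in>I. f i x)"
  using assms(2)
  by (induction I rule: infinite_finite_induct) (auto intro: Ck_on_const Ck_on_add assms(1))

text \<open>The product rule turns a derivative of \<open>B (f x) (g x)\<close> into a sum of terms
  of the same shape with one factor differentiated, so the induction closes. A general bounded
  bilinear \<open>B\<close> serves products, scalar multiples and inner products at once.\<close>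

lemma Ck_on_bilinear:
  assumes "open S" "bounded_bilinear B" "Ck_on k S f" "Ck_on k S g"
  shows "Ck_on k S (\<lambda>x. B (f x) (g x))"
  using assms(3,4)
proof (induction k arbitrary: f g)
  case 0
  then show ?case by (auto intro: bounded_bilinear.continuous_on[OF assms(2)])
next
  case (Suc k)
  have "Ck_on k S f" "Ck_on k S g" using Suc.prems Ck_on_SucD by blast+
  then show ?case
    by (intro Ck_on_Suc_I[OF assms(1) bounded_bilinear.FDERIV[OF assms(2)
            Ck_on_derivative Ck_on_derivative]] Ck_on_add[OF assms(1)] Suc.IH)
      (use Suc in auto)
qed

lemmas Ck_on_mult = Ck_on_bilinear[OF _ bounded_bilinear_mult]
lemmas Ck_on_scaleR = Ck_on_bilinear[OF _ bounded_bilinear_scaleR]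

lemma Ck_on_linear:
  assumes "open S" "bounded_linear L" "Ck_on k S f"
  shows "Ck_on k S (\<lambda>x. L (f x))"
  using assms(3)
proof (induction k arbitrary: f)
  case 0
  then show ?case by (auto intro: bounded_linear.continuous_on[OF assms(2)])
next
  case (Suc k)
  show ?case
    by (rule Ck_on_Suc_I[OF assms(1) bounded_linear.has_derivative[OF assms(2) Ck_on_derivative]])
      (use Suc in auto)
qed

lemma linear_euclidean_expansion:
  assumes "linear D"
  shows "D x = (\<Sum>b\<in>Basis. (x \<bullet> b) *\<^sub>R D b)"
proof -
  have "D (\<Sum>b\<in>Basis. (x \<bullet> b) *\<^sub>R b) = (\<Sum>b\<in>Basis. (x \<bullet> b) *\<^sub>R D b)"
    using assms by (simp add: linear_sum linear_scale)
  then show ?thesis by (simp add: euclidean_representation)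
qed

text \<open>\<open>Ck_on\<close> controls derivatives in fixed directions only, whereas the chain
  rule evaluates the derivative of \<open>f\<close> in a direction that moves with \<open>x\<close>.
  Expanding this direction in the standard basis leaves products covered by the induction
  hypothesis.\<close>

lemma Ck_on_compose:
  assumes S: "open S" and "Ck_on k T f" "Ck_on k S g" and T: "\<And>x. x \<in> S \<Longrightarrow> g x \<in> T"
  shows "Ck_on k S (\<lambda>x. f (g x))"
  using assms(2,3)
proof (induction k arbitrary: f)
  case 0
  then show ?case using T by (auto intro: continuous_on_compose2)
next
  case (Suc k)
  have k: "Ck_on k S g" using Suc.prems Ck_on_SucD by blast
  let ?f = "\<lambda>x. frechet_derivative f (at x)" and ?g = "\<lambda>x. frechet_derivative g (at x)"
  have d: "((\<lambda>x. f (g x)) has_derivative (\<lambda>u. ?f (g x) (?g x u))) (at x)" if "x \<in> S" for x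
    by (rule has_derivative_compose[OF Ck_on_derivative[OF Suc.prems(2) that]
          Ck_on_derivative[OF Suc.prems(1) T[OF that]]])
  have e: "?f (g x) (?g x u) = (\<Sum>b\<in>Basis. (?g x u \<bullet> b) *\<^sub>R ?f (g x) b)" if "x \<in> S" for x u
    by (rule linear_euclidean_expansion)
      (use Ck_on_derivative[OF Suc.prems(1) T[OF that]] has_derivative_linear in blast)
  have "Ck_on k S (\<lambda>x. ?f (g x) (?g x u))" for u
    by (rule iffD2[OF Ck_on_cong[OF S e]])
      (assumption, intro Ck_on_sum[OF S] Ck_on_scaleR[OF S] Suc.IH k Ck_on_linear[OF S bounded_linear_inner_left], use Suc.prems in auto)
  then show ?case using Ck_on_Suc_I[OF S d] by blast
qed

section \<open>Symmetry of second derivatives\<close>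

lemma has_vector_derivative_along_line:
  assumes "(g has_derivative D) (at (p + t *\<^sub>R w))"
  shows "((\<lambda>t. g (p + t *\<^sub>R w)) has_vector_derivative D w) (at t within X)"
proof -
  have "((\<lambda>t. p + t *\<^sub>R w) has_derivative (\<lambda>h. h *\<^sub>R w)) (at t within X)"
    by (auto intro!: derivative_eq_intros)
  then have "((\<lambda>t. g (p + t *\<^sub>R w)) has_derivative (\<lambda>h. D (h *\<^sub>R w))) (at t within X)"
    by (rule has_derivative_compose) (rule assms)
  moreover have "linear D" using assms has_derivative_linear by blast
  ultimately show ?thesis by (simp add: has_vector_derivative_def linear_scale)
qed

text \<open>The difference \<open>g (z + s u + t w) - g (z + s u)\<close> is the integral of the
  \<open>w\<close>-derivative over \<open>[0, t]\<close>. Differentiating in \<open>s\<close> under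
  the integral sign, and then in \<open>t\<close> at 0, produces one mixed derivative from the
  difference and the other from the integral.\<close>

lemma symmetric_mixed_derivatives:
  fixes g :: "'a::euclidean_space \<Rightarrow> 'b::euclidean_space"
  assumes S: "open S" and g: "Ck_on 2 S g" and z: "z \<in> S"
  shows "frechet_derivative (\<lambda>y. frechet_derivative g (at y) u) (at z) w =
         frechet_derivative (\<lambda>y. frechet_derivative g (at y) w) (at z) u"
proof -
  let ?D = "\<lambda>w y. frechet_derivative g (at y) w"
  let ?E = "\<lambda>u w y. frechet_derivative (?D u) (at y) w"
  have dg: "(g has_derivative frechet_derivative g (at y)) (at y)" if "y \<in> S" for y
    using g that Ck_on_derivative[of 1 S g] by (simp add: numeral_2_eq_2)
  have dD: "(?D w has_derivative (\<lambda>u. ?E w u y)) (at y)" if "y \<in> S" for w y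
    using g that Ck_on_derivative[of 0 S "?D w"] by (auto simp: numeral_2_eq_2)
  have cE: "continuous_on S (?E u w)" for u w
    using g by (simp add: numeral_2_eq_2)
  have cD: "continuous_on S (?D w)" for w
    by (rule continuous_at_imp_continuous_on) (use dD has_derivative_continuous in blast)
  obtain e where e: "e > 0" "ball z e \<subseteq> S" using S z open_contains_ball by blast
  \<comment> \<open>With this \<open>r\<close> the parallelogram with parameters bounded by
    \<open>r\<close> lies in the ball; the summand 1 excludes division by zero when both directions
    vanish.\<close>
  define r where "r = e / (2 * (1 + norm u + norm w))"
  have r0: "r > 0" using e by (simp add: r_def add_pos_nonneg)
  have inS: "z + s *\<^sub>R u + t *\<^sub>R w \<in> S" if "\<bar>s\<bar> \<le> r" "\<bar>t\<bar> \<le> r" for s t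
  proof -
    have "norm (s *\<^sub>R u + t *\<^sub>R w) \<le> r * norm u + r * norm w"
      using that by (intro order_trans[OF norm_triangle_ineq] add_mono)
        (auto intro: mult_right_mono)
    also have "\<dots> < r * (2 * (1 + norm u + norm w))"
      using r0 by (simp add: distrib_left add_pos_nonneg add.assoc add_nonneg_pos)
    also have "\<dots> = e"
    proof -
      have "1 + norm u + norm w > 0" by (simp add: add_pos_nonneg)
      then show ?thesis unfolding r_def by simp
    qed
    finally have "dist z (z + s *\<^sub>R u + t *\<^sub>R w) < e" by (simp add: dist_norm norm_minus_commute ac_simps)
    then show ?thesis using e(2) by auto
  qed
  define G where "G s t = g (z + s *\<^sub>R u + t *\<^sub>R w)" for s t
  define P where "P s t = ?D w (z + s *\<^sub>R u + t *\<^sub>R w)" for s t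
  define Q where "Q s t = ?E w u (z + s *\<^sub>R u + t *\<^sub>R w)" for s t
  have Gt: "(G s has_vector_derivative P s t) (at t within X)" if "\<bar>s\<bar> \<le> r" "\<bar>t\<bar> \<le> r" for s t X
    unfolding G_def P_def by (rule has_vector_derivative_along_line[OF dg[OF inS[OF that]]])
  have swap: "z + s *\<^sub>R u + t *\<^sub>R w = (z + t *\<^sub>R w) + s *\<^sub>R u" for s t
    by simp
  have Ps: "((\<lambda>s. P s t) has_vector_derivative Q s t) (at s within X)" if "\<bar>s\<bar> \<le> r" "\<bar>t\<bar> \<le> r" for s t X
    using inS[OF that] unfolding Q_def P_def swap
    by (rule has_vector_derivative_along_line[OF dD])
  have Gs: "((\<lambda>s. G s t) has_vector_derivative ?D u (z + s *\<^sub>R u + t *\<^sub>R w)) (at s within X)"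
    if "\<bar>s\<bar> \<le> r" "\<bar>t\<bar> \<le> r" for s t X
    using inS[OF that] unfolding G_def swap
    by (rule has_vector_derivative_along_line[OF dg])
  have cQ: "continuous_on ({-r..r} \<times> {0..t}) (\<lambda>(s, t). Q s t)" if "t \<le> r" for t
    unfolding Q_def split_beta
    by (rule continuous_on_compose2[OF cE[of w u]])
      (use that inS in \<open>auto intro!: continuous_intros\<close>)
  have "?D u (z + t *\<^sub>R w) - ?D u z = integral {0..t} (Q 0)" if t: "0 < t" "t \<le> r" for t
  proof -
    have F: "(P s has_integral G s t - G s 0) {0..t}" if "s \<in> {-r..r}" for s
      by (rule fundamental_theorem_of_calculus) (use t that Gt in auto)
    have "((\<lambda>s. integral (cbox 0 t) (P s)) has_vector_derivative integral (cbox 0 t) (Q 0))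
        (at 0 within {-r..r})"
      by (rule leibniz_rule_vector_derivative)
        (use t r0 Ps has_integral_integrable[OF F] cQ in auto)
    then have "((\<lambda>s. G s t - G s 0) has_vector_derivative integral (cbox 0 t) (Q 0))
        (at 0 within {-r..r})"
      by (rule has_vector_derivative_transform[rotated 2]) (use r0 integral_unique[OF F] in auto)
    moreover have "((\<lambda>s. G s t - G s 0) has_vector_derivative
        ?D u (z + 0 *\<^sub>R u + t *\<^sub>R w) - ?D u (z + 0 *\<^sub>R u + 0 *\<^sub>R w)) (at 0 within {-r..r})"
      by (rule has_vector_derivative_diff) (use t r0 Gs[of 0 t] Gs[of 0 0] in auto)
    ultimately show ?thesis
      using vector_derivative_unique_within_closed_interval[of "-r" r 0] r0 by (auto simp: cbox_interval)
  qed
  then have I: "?D u (z + t *\<^sub>R w) = ?D u z + integral {0..t} (Q 0)" if "t \<in> {0..r}" for t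
    using that by (cases "t = 0") (auto simp: algebra_simps)
  have "continuous_on {0..r} (Q 0)"
    by (rule continuous_on_compose2[OF cQ[OF order_refl], of _ "\<lambda>t. (0, t)", simplified])
      (use r0 in \<open>auto intro!: continuous_intros\<close>)
  then have "((\<lambda>t. integral {0..t} (Q 0)) has_vector_derivative Q 0 0) (at 0 within {0..r})"
    by (rule integral_has_vector_derivative) (use r0 in auto)
  then have "((\<lambda>t. ?D u z + integral {0..t} (Q 0)) has_vector_derivative Q 0 0) (at 0 within {0..r})"
    by (auto intro!: derivative_eq_intros)
  then have "((\<lambda>t. ?D u (z + t *\<^sub>R w)) has_vector_derivative Q 0 0) (at 0 within {0..r})"
    by (rule has_vector_derivative_transform[rotated 2]) (use r0 I in auto)
  moreover have "((\<lambda>t. ?D u (z + t *\<^sub>R w)) has_vector_derivative ?E u w z) (at 0 within {0..r})"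
    using has_vector_derivative_along_line[of "?D u" _ z 0 w] dD z by simp
  ultimately have "Q 0 0 = ?E u w z"
    using vector_derivative_unique_within_closed_interval[of 0 r 0] r0 by (auto simp: cbox_interval)
  then show ?thesis by (simp add: Q_def)
qed

section \<open>Holomorphic functions of several variables are smooth\<close>

text \<open>The scalar-valued counterpart of \<open>holo_on\<close>, to which the one-variable
  Cauchy formula applies.\<close>

definition cholo_on :: "(complex^'n::finite) set \<Rightarrow> (complex^'n \<Rightarrow> complex) \<Rightarrow> bool" where
  "cholo_on S g \<longleftrightarrow> (\<forall>z\<in>S. \<exists>D. (g has_derivative D) (at z) \<and> (\<forall>c v. D (c *s v) = c * D v))"

abbreviation Dir :: "('a::real_normed_vector \<Rightarrow> 'b::real_normed_vector) \<Rightarrow> 'a \<Rightarrow> 'a \<Rightarrow> 'b" where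
  "Dir g z v \<equiv> frechet_derivative g (at z) v"

lemma cholo_onD:
  assumes "cholo_on S g" "z \<in> S"
  shows "(g has_derivative frechet_derivative g (at z)) (at z)" "Dir g z (c *s v) = c * Dir g z v"
  using assms frechet_derivative_eq unfolding cholo_on_def by metis+

lemma cholo_on_continuous: "cholo_on S g \<Longrightarrow> continuous_on S g"
  by (rule continuous_at_imp_continuous_on) (use cholo_onD(1) has_derivative_continuous in blast)

lemma scaleR_eq_vector_mult: "x *\<^sub>R (v :: complex^'n) = complex_of_real x *s v"
  unfolding vec_eq_iff by (simp add: scaleR_conv_of_real[where 'a = complex])

lemma norm_complex_vector_mult: "norm (c *s v) = cmod c * norm (v :: complex^'n::finite)"
  unfolding norm_vec_def by (simp add: L2_set_right_distrib norm_mult)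

lemma bounded_linear_complex_line: "bounded_linear (\<lambda>c. c *s (v :: complex^'n::finite))"
  by (rule bounded_linear_intro[where K = "norm v"])
    (auto simp: vec_eq_iff algebra_simps norm_complex_vector_mult)

lemma continuous_on_complex_scale [continuous_intros]:
  assumes "continuous_on X f" "continuous_on X g"
  shows "continuous_on X (\<lambda>x. f x *s (g x :: complex^'n::finite))"
  unfolding vector_scalar_mult_def
  by (intro continuous_on_vec_lambda continuous_intros assms)

lemma cholo_on_slice:
  assumes "cholo_on S g" "z + c *s v \<in> S"
  shows "((\<lambda>c. g (z + c *s v)) has_field_derivative Dir g (z + c *s v) v) (at c within X)"
proof -
  have "((\<lambda>c. z + c *s v) has_derivative (\<lambda>h. h *s v)) (at c within X)"
    by (rule has_derivative_eq_rhs[OF has_derivative_add[OF has_derivative_const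
        bounded_linear.has_derivative[OF bounded_linear_complex_line has_derivative_ident]]]) auto
  then have "((\<lambda>c. g (z + c *s v)) has_derivative (\<lambda>h. Dir g (z + c *s v) (h *s v))) (at c within X)"
    by (rule has_derivative_compose) (rule cholo_onD[OF assms])
  then show ?thesis
    unfolding has_field_derivative_def
    by (rule has_derivative_eq_rhs) (simp add: fun_eq_iff cholo_onD(2)[OF assms])
qed

text \<open>Cauchy's formula on the complex line through \<open>z\<close> in direction
  \<open>v\<close>. The right side contains only values of \<open>g\<close>, over a contour
  independent of \<open>z\<close>, so regularity of \<open>g\<close> passes to its
  derivative.\<close>

lemma cholo_on_Cauchy:
  assumes g: "cholo_on S g" and r: "r > 0" and S: "\<And>c. cmod c \<le> r \<Longrightarrow> z + c *s v \<in> S"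
  shows "Dir g z v = integral (cbox 0 1) (\<lambda>t. g (z + circlepath 0 r t *s v) / circlepath 0 r t)"
proof -
  let ?f = "\<lambda>c. g (z + c *s v)"
  have hol: "?f holomorphic_on cball 0 r"
    unfolding holomorphic_on_def field_differentiable_def
  proof
    fix c :: complex assume "c \<in> cball 0 r"
    then show "\<exists>f'. (?f has_field_derivative f') (at c within cball 0 r)"
      using cholo_on_slice[OF g S[of c]] by auto
  qed
  have "contour_integral (circlepath 0 r) (\<lambda>c. ?f c / (c - 0)^2) = (2 * pi * \<i>) * deriv ?f 0"
    by (rule Cauchy_contour_integral_circlepath_2[OF holomorphic_on_imp_continuous_on[OF hol]
          holomorphic_on_subset[OF hol ball_subset_cball]]) (use r in simp)
  moreover have "deriv ?f 0 = Dir g z v"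
    using DERIV_imp_deriv[OF cholo_on_slice[OF g S, of 0 UNIV]] r by simp
  \<comment> \<open>On a circle about 0 the velocity is \<open>2 * pi * \<i>\<close> times the
    position, which cancels one of the two denominators.\<close>
  moreover have "contour_integral (circlepath 0 r) (\<lambda>c. ?f c / (c - 0)^2) =
      integral {0..1} (\<lambda>t. (2 * pi * \<i>) * (?f (circlepath 0 r t) / circlepath 0 r t))"
    unfolding contour_integral_integral
  proof (rule integral_cong)
    fix t :: real
    have "circlepath 0 r t \<noteq> 0" using r by (simp add: circlepath)
    then show "?f (circlepath 0 r t) / (circlepath 0 r t - 0)^2 * vector_derivative (circlepath 0 r) (at t) =
        (2 * pi * \<i>) * (?f (circlepath 0 r t) / circlepath 0 r t)"
      unfolding vector_derivative_circlepath by (simp add: circlepath power2_eq_square field_simps)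
  qed
  ultimately have "(2 * pi * \<i>) * Dir g z v =
      (2 * pi * \<i>) * integral {0..1} (\<lambda>t. ?f (circlepath 0 r t) / circlepath 0 r t)"
    by (simp only: integral_mult_right)
  moreover have "2 * pi * \<i> \<noteq> 0" by simp
  ultimately show ?thesis unfolding cbox_interval mult_cancel_left by blast
qed

lemma cholo_on_local_disc:
  fixes S :: "(complex^'n::finite) set"
  assumes "open S" "z \<in> S"
  obtains e r where "e > 0" "r > 0" "\<And>y c. y \<in> ball z e \<Longrightarrow> cmod c \<le> r \<Longrightarrow> y + c *s v \<in> S"
proof -
  obtain d where d: "d > 0" "ball z d \<subseteq> S" using assms open_contains_ball by blast
  define r where "r = d / (2 * (1 + norm v))"
  have r: "r > 0" using d by (simp add: r_def add_pos_nonneg)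
  have "y + c *s v \<in> S" if "y \<in> ball z (d/2)" "cmod c \<le> r" for y c
  proof -
    have "norm (c *s v) \<le> r * norm v"
      using that by (simp add: norm_complex_vector_mult mult_right_mono)
    also have "\<dots> \<le> r * (1 + norm v)" using r by (simp add: distrib_left)
    also have "\<dots> = d / 2"
    proof -
      have "1 + norm v > 0" by (simp add: add_pos_nonneg)
      then show ?thesis unfolding r_def by (simp add: field_simps)
    qed
    finally have "norm (c *s v) \<le> d / 2" .
    moreover have "norm (z - (y + c *s v)) \<le> norm (z - y) + norm (c *s v)"
      using norm_triangle_ineq4[of "z - y" "c *s v"] by (simp add: algebra_simps)
    ultimately have "dist z (y + c *s v) < d" using that by (simp add: dist_norm)
    then show ?thesis using d by auto
  qed
  then show thesis using that[of "d/2" r] d r by auto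
qed

lemma continuous_on_circlepath: "continuous_on X (circlepath z r)"
  unfolding circlepath by (intro continuous_intros)

text \<open>Continuity has to come first: differentiating Cauchy's formula under the integral sign
  in \<open>cholo_on_Dir\<close> requires a continuous derivative of the integrand.\<close>

lemma cholo_on_Dir_continuous:
  assumes S: "open S" and g: "cholo_on S g"
  shows "continuous_on S (\<lambda>y. Dir g y v)"
proof (rule continuous_at_imp_continuous_on, rule)
  fix z assume z: "z \<in> S"
  obtain e r where er: "e > 0" "r > 0" "\<And>y c. y \<in> ball z e \<Longrightarrow> cmod c \<le> r \<Longrightarrow> y + c *s v \<in> S"
    using cholo_on_local_disc[OF S z, of v thesis] by blast
  have nz: "circlepath 0 r t \<noteq> 0" and cm: "cmod (circlepath 0 r t) \<le> r" for t
    using er by (auto simp: circlepath norm_mult)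
  have cg: "continuous_on S g"
    by (rule cholo_on_continuous[OF g])
  have "continuous_on (ball z e) (\<lambda>y. integral (cbox 0 1)
      (\<lambda>t. g (y + circlepath 0 r t *s v) / circlepath 0 r t))"
    by (rule integral_continuous_on_param, unfold split_beta,
        intro continuous_intros continuous_on_compose2[OF cg] continuous_on_compose2[OF continuous_on_circlepath[of UNIV]])
      (use er nz cm in auto)
  then have "continuous_on (ball z e) (\<lambda>y. Dir g y v)"
    by (rule continuous_on_eq) (use cholo_on_Cauchy[OF g er(2) er(3)] in auto)
  then show "isCont (\<lambda>y. Dir g y v) z"
    using er(1) by (simp add: continuous_on_eq_continuous_at)
qed

text \<open>Cauchy's formula is differentiated under the integral sign with respect to the base
  point, and complex linearity is inherited from the integrand. This drives the induction to all
  orders.\<close>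

lemma cholo_on_Dir:
  assumes S: "open S" and g: "cholo_on S g"
  shows "cholo_on S (\<lambda>y. Dir g y v)"
  unfolding cholo_on_def
proof
  fix z assume z: "z \<in> S"
  obtain e r where er: "e > 0" "r > 0" "\<And>y c. y \<in> ball z e \<Longrightarrow> cmod c \<le> r \<Longrightarrow> y + c *s v \<in> S"
    using cholo_on_local_disc[OF S z, of v thesis] by blast
  let ?c = "circlepath 0 r"
  have nz: "?c t \<noteq> 0" and cm: "cmod (?c t) \<le> r" for t
    using er by (auto simp: circlepath norm_mult)
  have inS: "y + ?c t *s v \<in> S" if "y \<in> ball z e" for y t
    using er(3)[OF that cm] .
  have cg: "continuous_on S g"
    by (rule cholo_on_continuous[OF g])
  \<comment> \<open>The Leibniz rule asks for the derivative as a bounded operator depending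
    continuously on both variables; in finite dimension this can be tested on fixed vectors.\<close>
  define fx where "fx y t = Blinfun (\<lambda>w. Dir g (y + ?c t *s v) w / ?c t)" for y t
  have fx: "blinfun_apply (fx y t) = (\<lambda>w. Dir g (y + ?c t *s v) w / ?c t)" if "y \<in> ball z e" for y t
    unfolding fx_def
    by (rule bounded_linear_Blinfun_apply[OF bounded_linear_compose[OF bounded_linear_divide
          has_derivative_bounded_linear[OF cholo_onD(1)[OF g inS[OF that]]]]])
  have *: "((\<lambda>y. integral (cbox 0 1) (\<lambda>t. g (y + ?c t *s v) / ?c t)) has_derivative
      integral (cbox 0 1) (fx z)) (at z within ball z e)"
  proof (rule leibniz_rule)
    fix y t assume y: "y \<in> ball z e"
    have "((\<lambda>y. y + ?c t *s v) has_derivative (\<lambda>w. w)) (at y within ball z e)"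
      by (rule has_derivative_add_const[OF has_derivative_ident])
    then have "((\<lambda>y. g (y + ?c t *s v)) has_derivative (\<lambda>w. Dir g (y + ?c t *s v) w)) (at y within ball z e)"
      by (rule has_derivative_compose) (rule cholo_onD(1)[OF g inS[OF y]])
    then show "((\<lambda>y. g (y + ?c t *s v) / ?c t) has_derivative blinfun_apply (fx y t)) (at y within ball z e)"
      unfolding fx[OF y] by (rule bounded_linear.has_derivative[OF bounded_linear_divide])
    show "(\<lambda>t. g (y + ?c t *s v) / ?c t) integrable_on cbox 0 1"
      by (intro integrable_continuous continuous_intros continuous_on_compose2[OF cg] continuous_on_circlepath)
        (use y inS nz in auto)
  next
    have "continuous_on (ball z e \<times> cbox 0 1) (\<lambda>x. Dir g (fst x + ?c (snd x) *s v) i / ?c (snd x))" for i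
      by (intro continuous_intros continuous_on_compose2[OF cholo_on_Dir_continuous[OF S g]]
           continuous_on_compose2[OF continuous_on_circlepath[of UNIV]])
        (use inS nz in auto)
    then have "continuous_on (ball z e \<times> cbox 0 1) (\<lambda>x. blinfun_apply (fx (fst x) (snd x)) i)" for i
      by (rule continuous_on_eq) (auto simp: fx)
    then show "continuous_on (ball z e \<times> cbox 0 1) (\<lambda>(y, t). fx y t)"
      unfolding split_beta by (rule continuous_on_blinfun_componentwise)
  qed (use er in auto)
  have lin: "blinfun_apply (integral (cbox 0 1) (fx z)) (c *s w) = c * blinfun_apply (integral (cbox 0 1) (fx z)) w" for c w
  proof -
    have ci: "continuous_on (cbox 0 1) (fx z)"
    proof (rule continuous_on_blinfun_componentwise)
      fix i :: "complex^'a"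
      have "continuous_on (cbox 0 1) (\<lambda>t. Dir g (z + ?c t *s v) i / ?c t)"
        by (intro continuous_intros continuous_on_compose2[OF cholo_on_Dir_continuous[OF S g]]
           continuous_on_circlepath) (use inS nz er in auto)
      then show "continuous_on (cbox 0 1) (\<lambda>t. blinfun_apply (fx z t) i)"
        using er by (simp add: fx)
    qed
    have "integral (cbox 0 1) (fx z) w = integral (cbox 0 1) (\<lambda>t. fx z t w)" for w
      by (rule blinfun_apply_integral) (rule integrable_continuous[OF ci])
    moreover have "fx z t (c *s w) = c * fx z t w" for t
      using er by (simp add: fx cholo_onD(2)[OF g inS])
    ultimately show ?thesis by (simp only: integral_mult_right)
  qed
  have "((\<lambda>y. Dir g y v) has_derivative integral (cbox 0 1) (fx z)) (at z within ball z e)"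
    by (rule has_derivative_transform[OF _ cholo_on_Cauchy[OF g er(2) er(3)] *]) (use er in auto)
  then have "((\<lambda>y. Dir g y v) has_derivative integral (cbox 0 1) (fx z)) (at z)"
    using at_within_open[of z "ball z e"] er by simp
  then show "\<exists>D. ((\<lambda>y. Dir g y v) has_derivative D) (at z) \<and> (\<forall>c v. D (c *s v) = c * D v)"
    using lin by blast
qed

lemma cholo_on_Ck_on:
  assumes "open S" "cholo_on S g"
  shows "Ck_on k S g"
  using assms(2)
proof (induction k arbitrary: g)
  case 0
  then show ?case
    by (simp add: cholo_on_continuous)
next
  case (Suc k)
  show ?case
    by (rule Ck_on_Suc_I[OF assms(1) cholo_onD(1)[OF Suc.prems]])
      (use Suc cholo_on_Dir[OF assms(1)] in auto)
qed

section \<open>Holomorphic maps into coordinate space\<close>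

lemma holo_onD:
  assumes "holo_on f S" "z \<in> S"
  shows "(f has_derivative frechet_derivative f (at z)) (at z)" "Dir f z (c *s v) = c *s Dir f z v"
  using assms frechet_derivative_eq unfolding holo_on_def by metis+

lemma holo_on_nth:
  assumes "holo_on f S"
  shows "cholo_on S (\<lambda>z. f z $ j)" "z \<in> S \<Longrightarrow> Dir (\<lambda>z. f z $ j) z v = Dir f z v $ j"
proof -
  have *: "((\<lambda>z. f z $ j) has_derivative (\<lambda>v. Dir f z v $ j)) (at z)" if "z \<in> S" for z
    by (rule bounded_linear.has_derivative[OF bounded_linear_vec_nth holo_onD(1)[OF assms that]])
  then show "cholo_on S (\<lambda>z. f z $ j)"
    unfolding cholo_on_def
    by (intro ballI exI[of _ "\<lambda>v. Dir f _ v $ j"] conjI) (assumption, simp add: holo_onD(2)[OF assms])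
  show "z \<in> S \<Longrightarrow> Dir (\<lambda>z. f z $ j) z v = Dir f z v $ j"
    using frechet_derivative_eq[OF *] by simp
qed

lemma complex_vector_expansion: "(\<Sum>j\<in>UNIV. z $ j *s axis j 1) = (z :: complex^'n::finite)"
  by (simp add: vec_eq_iff axis_def if_distrib cong: if_cong)

lemma Ck_on_componentwise:
  fixes f :: "'a::euclidean_space \<Rightarrow> complex^'n::finite"
  assumes S: "open S" and f: "\<And>j. Ck_on k S (\<lambda>z. f z $ j)"
  shows "Ck_on k S f"
proof -
  have "Ck_on k S (\<lambda>z. \<Sum>j\<in>UNIV. f z $ j *s (axis j 1 :: complex^'n))"
    by (intro Ck_on_sum[OF S] Ck_on_linear[OF S bounded_linear_complex_line] f)
  then show ?thesis by (simp add: complex_vector_expansion)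
qed

lemma has_derivative_vec:
  fixes f :: "'a::euclidean_space \<Rightarrow> complex^'n::finite"
  assumes "\<And>j. ((\<lambda>z. f z $ j) has_derivative (\<lambda>v. D v $ j)) (at z)"
  shows "(f has_derivative D) (at z)"
proof -
  have "((\<lambda>z. \<Sum>j\<in>UNIV. f z $ j *s (axis j 1 :: complex^'n)) has_derivative
      (\<lambda>v. \<Sum>j\<in>UNIV. D v $ j *s axis j 1)) (at z)"
    by (intro has_derivative_sum bounded_linear.has_derivative[OF bounded_linear_complex_line] assms)
  then show ?thesis by (simp add: complex_vector_expansion)
qed

lemma holo_on_Ck_on: "open S \<Longrightarrow> holo_on f S \<Longrightarrow> Ck_on k S f"
  by (rule Ck_on_componentwise) (auto intro: cholo_on_Ck_on holo_on_nth)

lemma holo_on_Dir: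
  assumes "open S" "holo_on f S"
  shows "holo_on (\<lambda>z. Dir f z v) S"
  unfolding holo_on_def
proof
  fix z assume z: "z \<in> S"
  let ?D = "\<lambda>w. \<chi> j. Dir (\<lambda>y. Dir (\<lambda>y. f y $ j) y v) z w"
  have c: "cholo_on S (\<lambda>y. Dir (\<lambda>y. f y $ j) y v)" for j
    by (rule cholo_on_Dir[OF assms(1) holo_on_nth(1)[OF assms(2)]])
  have "((\<lambda>y. \<chi> j. Dir (\<lambda>y. f y $ j) y v) has_derivative ?D) (at z)"
    by (rule has_derivative_vec) (simp add: cholo_onD(1)[OF c z])
  then have "((\<lambda>y. Dir f y v) has_derivative ?D) (at z)"
    by (rule has_derivative_transform_within_open[OF _ assms(1) z])
      (simp add: vec_eq_iff holo_on_nth(2)[OF assms(2)])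
  then show "\<exists>D. ((\<lambda>z. Dir f z v) has_derivative D) (at z) \<and> (\<forall>c v. D (c *s v) = c *s D v)"
    using cholo_onD(2)[OF c z] by (intro exI[of _ ?D]) (simp add: vec_eq_iff)
qed

section \<open>Alternating forms\<close>

text \<open>The coface map: \<open>v \<circ> skip i\<close> is the list \<open>v\<close> with the
  argument \<open>v i\<close> dropped, as in the alternating sums of \<open>del\<close> and
  \<open>delbar\<close>.\<close>

definition skip :: "nat \<Rightarrow> nat \<Rightarrow> nat" where
  "skip i j = (if j < i then j else Suc j)"

lemma skip_neq [simp]: "skip i j \<noteq> i" "i \<noteq> skip i j"
  by (auto simp: skip_def)

lemma skip_eq_iff [simp]: "skip i j = skip i j' \<longleftrightarrow> j = j'"
  by (auto simp: skip_def)

lemma skip_less: "j < n \<Longrightarrow> skip i j < Suc n"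
  by (auto simp: skip_def)

lemma skip_surj:
  assumes "i \<le> n" "j \<le> n" "j \<noteq> i"
  obtains j' where "j' < n" "skip i j' = j"
proof (cases "j < i")
  case True
  then show ?thesis using assms that[of j] by (auto simp: skip_def)
next
  case False
  then show ?thesis using assms that[of "j - 1"] by (auto simp: skip_def)
qed

lemma bij_betw_skip: "i \<le> n \<Longrightarrow> bij_betw (skip i) {..<n} ({..n} - {i})"
  unfolding bij_betw_def
  by (auto simp: inj_on_def image_iff skip_less less_Suc_eq_le[symmetric] elim: skip_surj)
    (metis lessThan_iff less_Suc_eq_le skip_surj)

lemma prod_skip:
  fixes f :: "nat \<Rightarrow> 'a::comm_monoid_mult"
  assumes "i \<le> n"
  shows "f i * (\<Prod>j<n. f (skip i j)) = (\<Prod>j\<le>n. f j)"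
proof -
  have "(\<Prod>j\<le>n. f j) = f i * (\<Prod>j\<in>{..n} - {i}. f j)"
    using assms by (simp add: prod.remove)
  also have "(\<Prod>j\<in>{..n} - {i}. f j) = (\<Prod>j<n. f (skip i j))"
    by (rule prod.reindex_bij_betw[OF bij_betw_skip[OF assms], symmetric])
  finally show ?thesis by simp
qed

text \<open>Arguments are infinite sequences, so dependence on the first \<open>K\<close> entries is
  part of the notion. Signs are demanded for adjacent swaps only, which is what can be checked
  directly on alternating sums over an omitted argument.\<close>

definition alt_form :: "nat \<Rightarrow> ((nat \<Rightarrow> 'a::real_vector) \<Rightarrow> complex) \<Rightarrow> bool" where
  "alt_form K M \<longleftrightarrow>
     (\<forall>v w. (\<forall>i<K. v i = w i) \<longrightarrow> M v = M w) \<and>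
     (\<forall>v j. Suc j < K \<longrightarrow> M (v \<circ> Transposition.transpose j (Suc j)) = - M v) \<and>
     (\<forall>v j. j < K \<longrightarrow> linear (\<lambda>x. M (v(j := x))))"

lemma alt_formD:
  assumes "alt_form K M"
  shows alt_form_cong: "(\<And>i. i < K \<Longrightarrow> v i = w i) \<Longrightarrow> M v = M w"
    and alt_form_adjacent: "Suc j < K \<Longrightarrow> M (v \<circ> Transposition.transpose j (Suc j)) = - M v"
    and alt_form_linear: "j < K \<Longrightarrow> linear (\<lambda>x. M (v(j := x)))"
  using assms by (auto simp: alt_form_def)

text \<open>Conjugating with the adjacent swap of \<open>j\<close> and \<open>j + 1\<close> shortens
  the distance by one, at the cost of two further sign changes.\<close>

lemma alt_form_transpose:
  assumes M: "alt_form K M" and "i < j" "j < K"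
  shows "M (v \<circ> Transposition.transpose i j) = - M v"
  using assms(2,3)
proof (induction j arbitrary: v)
  case (Suc j)
  show ?case
  proof (cases "i = j")
    case True
    then show ?thesis using alt_form_adjacent[OF M Suc.prems(2)] by (simp only:)
  next
    case False
    let ?t = "Transposition.transpose j (Suc j)"
    have "Transposition.transpose i (Suc j) = ?t \<circ> Transposition.transpose i j \<circ> ?t"
      using False Suc.prems by (auto simp: fun_eq_iff Transposition.transpose_def)
    then have "M (v \<circ> Transposition.transpose i (Suc j)) = M (((v \<circ> ?t) \<circ> Transposition.transpose i j) \<circ> ?t)"
      by (simp add: o_assoc)
    also have "\<dots> = - M ((v \<circ> ?t) \<circ> Transposition.transpose i j)"
      by (rule alt_form_adjacent[OF M Suc.prems(2)])
    also have "\<dots> = M (v \<circ> ?t)"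
      using Suc.IH[of "v \<circ> ?t"] Suc.prems False by (simp only: minus_minus)
    also have "\<dots> = - M v"
      by (rule alt_form_adjacent[OF M Suc.prems(2)])
    finally show ?thesis .
  qed
qed simp

lemma alt_form_equal_args:
  assumes M: "alt_form K M" and "i \<noteq> j" "i < K" "j < K" "v i = v j"
  shows "M v = 0"
proof -
  have "v \<circ> Transposition.transpose i j = v" using assms(5) by (auto simp: fun_eq_iff Transposition.transpose_def)
  moreover have "M (v \<circ> Transposition.transpose i j) = - M v"
    using assms alt_form_transpose[OF M, of i j] alt_form_transpose[OF M, of j i]
    by (cases "i < j") (auto simp: transpose_commute)
  ultimately show ?thesis by simp
qed

lemma alt_form_permutes:
  assumes M: "alt_form K M" and p: "p permutes {..<K}"
  shows "M (v \<circ> p) = of_int (sign p) * M v"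
  using p finite_lessThan
proof (induction arbitrary: v rule: permutes_induct)
  case id
  then show ?case by (simp add: sign_id)
next
  case (swap a b p)
  have "M (v \<circ> Transposition.transpose a b) = - M v"
    using swap alt_form_transpose[OF M, of a b] alt_form_transpose[OF M, of b a]
    by (cases "a < b") (auto simp: transpose_commute)
  moreover have "sign (Transposition.transpose a b \<circ> p) = - sign p"
    using swap by (simp add: sign_compose permutation_swap_id sign_swap_id
        permutes_imp_permutation[OF finite_lessThan])
  moreover have "M (v \<circ> (Transposition.transpose a b \<circ> p)) = of_int (sign p) * M (v \<circ> Transposition.transpose a b)"
    using swap.IH[of "v \<circ> Transposition.transpose a b"] by (simp only: o_assoc)
  ultimately show ?case by (simp only: of_int_minus mult_minus_left mult_minus_right)
qed

text \<open>If two arguments agree, omitting one or the other leaves the same list up to moving the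
  survivor past the \<open>a - i - 1\<close> arguments in between, one adjacent transposition
  each.\<close>

lemma alt_form_skip_equal_args:
  assumes M: "alt_form K M" and "i < a" "a \<le> K" "v i = v a"
  shows "M (v \<circ> skip i) = (-1) ^ (a - i - 1) * M (v \<circ> skip a)"
  using assms(2-4)
proof (induction a arbitrary: v)
  case (Suc a)
  show ?case
  proof (cases "i = a")
    case True
    have "v \<circ> skip i = v \<circ> skip (Suc a)"
    proof
      fix x show "(v \<circ> skip i) x = (v \<circ> skip (Suc a)) x"
        using True Suc.prems by (cases x a rule: linorder_cases) (simp_all add: skip_def)
    qed
    then show ?thesis using True by simp
  next
    case False
    then obtain b where a: "a = Suc b" and ib: "i \<le> b" using Suc.prems by (cases a) auto
    let ?w = "v \<circ> Transposition.transpose a (Suc a)"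
    have 1: "(v \<circ> skip i) \<circ> Transposition.transpose b (Suc b) = ?w \<circ> skip i"
      using ib by (auto simp: fun_eq_iff skip_def Transposition.transpose_def a)
    have 2: "?w \<circ> skip a = v \<circ> skip (Suc a)"
    proof
      fix x show "(?w \<circ> skip a) x = (v \<circ> skip (Suc a)) x"
        by (cases x a rule: linorder_cases) (simp_all add: skip_def Transposition.transpose_def)
    qed
    have "M (v \<circ> skip i) = - M (?w \<circ> skip i)"
      using alt_form_adjacent[OF M, of b "v \<circ> skip i"] Suc.prems unfolding 1 by (simp add: a)
    also have "M (?w \<circ> skip i) = (-1) ^ (a - i - 1) * M (?w \<circ> skip a)"
      by (rule Suc.IH) (use False Suc.prems in \<open>auto simp: Transposition.transpose_def\<close>)
    finally show ?thesis
      unfolding 2 using ib by (simp add: a Suc_diff_le o_def)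
  qed
qed simp

lemma linear_cmult: "linear f \<Longrightarrow> linear (\<lambda>x. (c::complex) * f x)"
  by (simp add: linear_iff algebra_simps)

lemma linear_multc: "linear f \<Longrightarrow> linear (\<lambda>x. f x * (c::complex))"
  by (simp add: linear_iff algebra_simps)

text \<open>The Dolbeault operators and the wedge product with a bilinear form are both instances of
  this alternating sum, so alternation is proved once for all of them.\<close>

definition ins :: "nat \<Rightarrow> ('a \<Rightarrow> (nat \<Rightarrow> 'a) \<Rightarrow> complex) \<Rightarrow> (nat \<Rightarrow> 'a) \<Rightarrow> complex" where
  "ins K T v = (\<Sum>i\<le>K. (-1) ^ i * T (v i) (v \<circ> skip i))"

text \<open>Swapping slots \<open>j\<close> and \<open>j + 1\<close> exchanges the terms
  \<open>i = j\<close> and \<open>i = j + 1\<close>, which carry opposite signs; every other term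
  still contains both arguments and changes sign by itself.\<close>

lemma alt_form_ins:
  assumes T: "\<And>x. alt_form K (T x)" and L: "\<And>w. linear (\<lambda>x. T x w)"
  shows "alt_form (Suc K) (ins K T)"
  unfolding alt_form_def
proof (intro conjI allI impI)
  fix v w :: "nat \<Rightarrow> 'a" assume vw: "\<forall>i<Suc K. v i = w i"
  have "T (v i) (v \<circ> skip i) = T (w i) (w \<circ> skip i)" if "i \<le> K" for i
  proof -
    have "T (w i) (v \<circ> skip i) = T (w i) (w \<circ> skip i)"
      by (rule alt_form_cong[OF T]) (use vw skip_less in auto)
    then show ?thesis using vw that by simp
  qed
  then show "ins K T v = ins K T w" by (simp add: ins_def)
next
  fix v :: "nat \<Rightarrow> 'a" and j assume j: "Suc j < Suc K"
  let ?t = "Transposition.transpose j (Suc j)"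
  let ?f = "\<lambda>v i. (-1) ^ i * T (v i) (v \<circ> skip i)"
  have 1: "?f (v \<circ> ?t) i = - ?f v i" if i: "i \<le> K" "i \<noteq> j" "i \<noteq> Suc j" for i
  proof -
    have vi: "(v \<circ> ?t) i = v i" using i by (simp add: Transposition.transpose_def)
    have "\<exists>b. Suc b < K \<and> (v \<circ> ?t) \<circ> skip i = (v \<circ> skip i) \<circ> Transposition.transpose b (Suc b)"
    proof (cases "i < j")
      case True
      then obtain b where b: "j = Suc b" by (cases j) auto
      then show ?thesis
        using True i j by (intro exI[of _ b]) (auto simp: fun_eq_iff skip_def Transposition.transpose_def)
    next
      case False
      then show ?thesis
        using i j by (intro exI[of _ j]) (auto simp: fun_eq_iff skip_def Transposition.transpose_def)
    qed
    then obtain b where b: "Suc b < K" "(v \<circ> ?t) \<circ> skip i = (v \<circ> skip i) \<circ> Transposition.transpose b (Suc b)"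
      by blast
    show ?thesis using alt_form_adjacent[OF T b(1)] unfolding vi b(2) by simp
  qed
  have 2: "?f (v \<circ> ?t) j = - ?f v (Suc j)" "?f (v \<circ> ?t) (Suc j) = - ?f v j"
  proof -
    have "((v \<circ> ?t) \<circ> skip j) x = (v \<circ> skip (Suc j)) x"
      "((v \<circ> ?t) \<circ> skip (Suc j)) x = (v \<circ> skip j) x" for x
      by (cases x j rule: linorder_cases; simp add: skip_def Transposition.transpose_def)+
    then have "(v \<circ> ?t) \<circ> skip j = v \<circ> skip (Suc j)" "(v \<circ> ?t) \<circ> skip (Suc j) = v \<circ> skip j"
      by blast+
    then show "?f (v \<circ> ?t) j = - ?f v (Suc j)" "?f (v \<circ> ?t) (Suc j) = - ?f v j"
      by simp_all
  qed
  have split: "(\<Sum>i\<le>K. g i) = g j + (g (Suc j) + (\<Sum>i\<in>{..K} - {j} - {Suc j}. g i))" for g :: "nat \<Rightarrow> complex"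
    using j by (subst sum.remove[of _ j], simp, simp, subst sum.remove[of _ "Suc j"]) auto
  have 3: "(\<Sum>i\<in>{..K} - {j} - {Suc j}. ?f (v \<circ> ?t) i) = (\<Sum>i\<in>{..K} - {j} - {Suc j}. - ?f v i)"
    by (rule sum.cong[OF refl], rule 1) auto
  show "ins K T (v \<circ> ?t) = - ins K T v"
    unfolding ins_def split 2 3 by (simp only: sum_negf minus_add_distrib) simp
next
  fix v :: "nat \<Rightarrow> 'a" and j assume j: "j < Suc K"
  have "linear (\<lambda>x. T ((v(j := x)) i) (v(j := x) \<circ> skip i))" if i: "i \<le> K" for i
  proof (cases "i = j")
    case True
    have "v(j := x) \<circ> skip i = v \<circ> skip i" for x using True by (auto simp: fun_eq_iff)
    then show ?thesis using L True by simp
  next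
    case False
    then obtain j' where j': "j' < K" "skip i j' = j" using i j skip_surj[of i K j] by auto
    have "v(j := x) \<circ> skip i = (v \<circ> skip i)(j' := x)" for x
      using j' by (auto simp: fun_eq_iff)
    then show ?thesis using alt_form_linear[OF T j'(1)] False by simp
  qed
  then show "linear (\<lambda>x. ins K T (v(j := x)))"
    unfolding ins_def by (intro linear_compose_sum ballI linear_cmult) auto
qed

section \<open>Products with bilinear forms\<close>

lemma alt_form_cmult: "alt_form K M \<Longrightarrow> alt_form K (\<lambda>v. c * M v)"
  unfolding alt_form_def by (auto intro: linear_cmult)

text \<open>Twice the wedge product of \<open>q\<close> and \<open>M\<close>. Here \<open>q\<close>
  may be any bilinear map, antisymmetrised by the sum itself; this admits the sesquilinear forms
  \<open>qA\<close> and \<open>qB\<close>.\<close>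

definition pair2 :: "('a \<Rightarrow> 'a \<Rightarrow> complex) \<Rightarrow> ((nat \<Rightarrow> 'a) \<Rightarrow> complex) \<Rightarrow> nat \<Rightarrow> (nat \<Rightarrow> 'a) \<Rightarrow> complex" where
  "pair2 q M K = ins (Suc K) (\<lambda>x. ins K (\<lambda>y w. q x y * M w))"

lemma ins_linear: "(\<And>w y. linear (\<lambda>x. T x y w)) \<Longrightarrow> linear (\<lambda>x. ins K (T x) v)"
  unfolding ins_def by (intro linear_compose_sum ballI linear_cmult) auto

lemma alt_form_pair2:
  assumes "alt_form K M" "\<And>x. linear (q x)" "\<And>y. linear (\<lambda>x. q x y)"
  shows "alt_form (Suc (Suc K)) (pair2 q M K)"
  unfolding pair2_def
  by (intro alt_form_ins alt_form_cmult assms ins_linear linear_multc)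

lemma pair2_expand:
  "pair2 q M K v = (\<Sum>i\<le>Suc K. \<Sum>l\<le>K. (-1) ^ (i + l) *
     (q (v i) (v (skip i l)) * M (v \<circ> skip i \<circ> skip l)))"
  unfolding pair2_def ins_def by (simp add: sum_distrib_left power_add mult.assoc)

section \<open>Expansion of wedge powers\<close>

text \<open>The permutation is the lift of \<open>s\<close> that fixes 0, followed by a cycle of
  length \<open>i + 1\<close>, which is a product of \<open>i\<close> adjacent
  transpositions.\<close>

lemma permutes_case_nat:
  assumes s: "s permutes {..<N}" and i: "i \<le> N"
  defines "p \<equiv> case_nat i (skip i \<circ> s)"
  shows "p permutes {..<Suc N}" "sign p = (-1) ^ i * sign s"
proof -
  define lift where "lift s = case_nat 0 (Suc \<circ> s)" for s :: "nat \<Rightarrow> nat"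
  define cyc where "cyc i = case_nat i (skip i)" for i
  have lift_comp: "lift (f \<circ> g) = lift f \<circ> lift g" for f g
    by (auto simp: lift_def fun_eq_iff split: nat.splits)
  have lift_id: "lift id = id"
    by (auto simp: lift_def fun_eq_iff split: nat.splits)
  have lift_tr: "lift (Transposition.transpose a b) = Transposition.transpose (Suc a) (Suc b)" for a b
    by (auto simp: lift_def fun_eq_iff Transposition.transpose_def split: nat.splits)
  have l: "lift s permutes {..<Suc N} \<and> sign (lift s) = sign s"
    using s finite_lessThan
  proof (induction rule: permutes_induct)
    case id
    then show ?case by (simp add: lift_id permutes_id del: id_apply)
  next
    case (swap a b p)
    have "Transposition.transpose (Suc a) (Suc b) permutes {..<Suc N}"
      using swap by (intro permutes_swap_id) auto
    moreover have "permutation (lift p)" "permutation p"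
      using swap permutes_imp_permutation[OF finite_lessThan] by blast+
    ultimately show ?case
      unfolding lift_comp lift_tr using swap
      by (simp add: permutes_compose sign_compose permutation_swap_id sign_swap_id del: o_apply)
  qed
  have cyc_Suc: "cyc (Suc i) = Transposition.transpose i (Suc i) \<circ> cyc i" for i
    by (auto simp: cyc_def fun_eq_iff Transposition.transpose_def skip_def split: nat.splits)
  have c: "cyc i permutes {..<Suc N} \<and> sign (cyc i) = (-1) ^ i"
    using i
  proof (induction i)
    case 0
    have "cyc 0 = id" by (auto simp: cyc_def fun_eq_iff skip_def split: nat.splits)
    then show ?case by (simp only: permutes_id sign_id power_0 simp_thms)
  next
    case (Suc i)
    have "Transposition.transpose i (Suc i) permutes {..<Suc N}"
      using Suc by (intro permutes_swap_id) auto
    moreover have "permutation (cyc i)"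
      using Suc permutes_imp_permutation[OF finite_lessThan, of "cyc i" "Suc N"] by auto
    ultimately show ?case
      unfolding cyc_Suc using Suc
      by (simp add: permutes_compose sign_compose permutation_swap_id sign_swap_id del: o_apply)
  qed
  have p: "p = cyc i \<circ> lift s"
    by (auto simp: p_def cyc_def lift_def fun_eq_iff split: nat.splits)
  show "p permutes {..<Suc N}" using l c by (simp add: p permutes_compose)
  show "sign p = (-1) ^ i * sign s"
    using l c permutes_imp_permutation[OF finite_lessThan, of "lift s" "Suc N"]
      permutes_imp_permutation[OF finite_lessThan, of "cyc i" "Suc N"] by (simp add: p sign_compose)
qed

definition altsum :: "nat \<Rightarrow> ((nat \<Rightarrow> 'a) \<Rightarrow> complex) \<Rightarrow> (nat \<Rightarrow> 'a) \<Rightarrow> complex" where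
  "altsum N T v = (\<Sum>s | s permutes {..<N}. of_int (sign s) * T (v \<circ> s))"

text \<open>Laplace expansion along the first argument: a permutation of \<open>N + 1\<close>
  letters is the image \<open>i\<close> of 0 together with a permutation of the remaining
  letters.\<close>

lemma altsum_Suc:
  "altsum (Suc N) T v = (\<Sum>i\<le>N. (-1) ^ i * altsum N (\<lambda>w. T (case_nat (v i) w)) (v \<circ> skip i))"
proof -
  let ?P = "\<lambda>N. {s. s permutes {..<N}}"
  let ?g = "\<lambda>(i, s). case_nat i (skip i \<circ> s)"
  have inj: "inj_on ?g ({..N} \<times> ?P N)"
  proof (rule inj_onI, clarify)
    fix i s i' s' assume "case_nat i (skip i \<circ> s) = case_nat i' (skip i' \<circ> s')"
    then have *: "case_nat i (skip i \<circ> s) j = case_nat i' (skip i' \<circ> s') j" for j by simp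
    have "i = i'" using *[of 0] by simp
    then show "i = i' \<and> s = s'" using *[of "Suc _"] by (auto simp: fun_eq_iff)
  qed
  have sub: "?g ` ({..N} \<times> ?P N) \<subseteq> ?P (Suc N)"
    using permutes_case_nat(1) by auto
  \<comment> \<open>Surjectivity comes from counting: \<open>N + 1\<close> choices of
    \<open>i\<close> times the factorial of \<open>N\<close> already exhaust all
    permutations.\<close>
  have "card (?g ` ({..N} \<times> ?P N)) = card (?P (Suc N))"
    by (simp add: card_image[OF inj] card_cartesian_product card_permutations)
  then have "?g ` ({..N} \<times> ?P N) = ?P (Suc N)"
    by (intro card_subset_eq sub finite_permutations) auto
  then have bij: "bij_betw ?g ({..N} \<times> ?P N) (?P (Suc N))"
    using inj by (simp add: bij_betw_def)
  have "altsum (Suc N) T v = (\<Sum>x\<in>{..N} \<times> ?P N. of_int (sign (?g x)) * T (v \<circ> ?g x))"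
    unfolding altsum_def by (rule sum.reindex_bij_betw[OF bij, symmetric])
  also have "\<dots> = (\<Sum>(i, s)\<in>{..N} \<times> ?P N. (-1) ^ i * (of_int (sign s) * T (case_nat (v i) (v \<circ> skip i \<circ> s))))"
  proof (rule sum.cong[OF refl])
    fix x assume "x \<in> {..N} \<times> ?P N"
    then obtain i s where x: "x = (i, s)" and "i \<le> N" "s permutes {..<N}" by auto
    then have "sign (case_nat i (skip i \<circ> s)) = (-1) ^ i * sign s"
      using permutes_case_nat(2) by auto
    moreover have "v \<circ> case_nat i (skip i \<circ> s) = case_nat (v i) (v \<circ> skip i \<circ> s)"
      by (auto simp: fun_eq_iff split: nat.splits)
    ultimately show "of_int (sign (?g x)) * T (v \<circ> ?g x) =
        (case x of (i, s) \<Rightarrow> (-1) ^ i * (of_int (sign s) * T (case_nat (v i) (v \<circ> skip i \<circ> s))))"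
      by (simp add: x)
  qed
  finally show ?thesis
    by (simp add: sum.cartesian_product[symmetric] altsum_def sum_distrib_left)
qed

lemma altsum_alt_form:
  assumes "alt_form K M"
  shows "altsum K (\<lambda>w. c * M w) v = fact K * (c * M v)"
proof -
  have "of_int (sign s) * (c * M (v \<circ> s)) = c * M v" if "s permutes {..<K}" for s
  proof -
    have "(of_int (sign s) * of_int (sign s) :: complex) = 1"
      by (metis of_int_1 of_int_mult sign_idempotent)
    then show ?thesis unfolding alt_form_permutes[OF assms that]
      by (metis mult.left_commute mult.left_neutral mult.assoc)
  qed
  then have "altsum K (\<lambda>w. c * M w) v = (\<Sum>s | s permutes {..<K}. c * M v)"
    unfolding altsum_def by (intro sum.cong) auto
  then show ?thesis by (simp add: card_permutations)
qed

text \<open>Two Laplace expansions isolate the arguments of \<open>q\<close>. The remaining sum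
  repeats a single term because \<open>\<alpha>\<close> alternates; this cancels
  \<open>fact K\<close> and leaves the 2 from \<open>fact 2\<close>.\<close>

lemma wedge_pair2:
  assumes M: "alt_form K (\<alpha> z)"
  shows "wedge 2 K (\<lambda>z v. q z (v 0) (v 1)) \<alpha> z v = pair2 (q z) (\<alpha> z) K v / 2"
proof -
  let ?T = "\<lambda>w. q z (w 0) (w 1) * \<alpha> z (\<lambda>i. w (Suc (Suc i)))"
  have "wedge 2 K (\<lambda>z v. q z (v 0) (v 1)) \<alpha> z v = altsum (Suc (Suc K)) ?T v / (2 * fact K)"
    by (simp add: wedge_def altsum_def o_def mult.assoc)
  also have "altsum (Suc (Suc K)) ?T v = (\<Sum>i\<le>Suc K. \<Sum>l\<le>K. (-1) ^ (i + l) *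
     altsum K (\<lambda>w. q z (v i) (v (skip i l)) * \<alpha> z w) (v \<circ> skip i \<circ> skip l))"
    by (simp add: altsum_Suc sum_distrib_left power_add mult.assoc)
  also have "\<dots> = fact K * pair2 (q z) (\<alpha> z) K v"
    unfolding altsum_alt_form[OF M] pair2_expand sum_distrib_left by (simp only: mult.left_commute)
  finally show ?thesis by simp
qed

section \<open>Powers of a Hermitian form\<close>

lemma hermitian_innerD:
  assumes "hermitian_inner h"
  shows herm_add_left: "h (u + v) w = h u w + h v w"
    and herm_scale_left: "h (c *s u) w = c * h u w"
    and herm_cnj: "h w u = cnj (h u w)"
    and herm_pos: "u \<noteq> 0 \<Longrightarrow> Re (h u u) > 0"
  using assms unfolding hermitian_inner_def by blast+

lemma herm_add_right:
  assumes h: "hermitian_inner h"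
  shows "h w (u + v) = h w u + h w v"
proof -
  have "h w (u + v) = cnj (h (u + v) w)" by (rule herm_cnj[OF h])
  also have "\<dots> = cnj (h u w) + cnj (h v w)" by (simp only: herm_add_left[OF h] complex_cnj_add)
  finally show ?thesis by (simp only: herm_cnj[OF h, of w u] herm_cnj[OF h, of w v])
qed

lemma herm_scale_right:
  assumes h: "hermitian_inner h"
  shows "h w (c *s u) = cnj c * h w u"
proof -
  have "h w (c *s u) = cnj (h (c *s u) w)" by (rule herm_cnj[OF h])
  also have "\<dots> = cnj c * cnj (h u w)" by (simp only: herm_scale_left[OF h] complex_cnj_mult)
  finally show ?thesis by (simp only: herm_cnj[OF h, of w u])
qed

lemma herm_zero_left: "hermitian_inner h \<Longrightarrow> h 0 w = 0"
  using herm_scale_left[of h 0 0 w] by simp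

lemma herm_zero_right: "hermitian_inner h \<Longrightarrow> h w 0 = 0"
  using herm_scale_right[of h w 0 0] by simp

lemma herm_sum_left: "hermitian_inner h \<Longrightarrow> h (\<Sum>i\<in>I. f i) w = (\<Sum>i\<in>I. h (f i) w)"
  by (induction I rule: infinite_finite_induct) (auto simp: herm_zero_left herm_add_left)

lemma herm_sum_right: "hermitian_inner h \<Longrightarrow> h w (\<Sum>i\<in>I. f i) = (\<Sum>i\<in>I. h w (f i))"
  by (induction I rule: infinite_finite_induct) (auto simp: herm_zero_right herm_add_right)

lemma herm_real: "hermitian_inner h \<Longrightarrow> h u u = of_real (Re (h u u))"
  by (metis herm_cnj Reals_cnj_iff of_real_Re)

lemma herm_nonneg: "hermitian_inner h \<Longrightarrow> Re (h u u) \<ge> 0"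
  using herm_pos[of h u] herm_zero_left[of h 0] by (cases "u = 0") auto

definition om :: "(complex^'n \<Rightarrow> complex^'n \<Rightarrow> complex) \<Rightarrow> complex^'n \<Rightarrow> complex^'n \<Rightarrow> complex" where
  "om h x y = \<i> / 2 * (h x y - h y x)"

lemma om_linear:
  assumes "hermitian_inner h"
  shows "linear (om h x)" "linear (\<lambda>x. om h x y)"
  unfolding linear_iff om_def
  by (auto simp: herm_add_left[OF assms] herm_add_right[OF assms] herm_scale_left[OF assms]
      herm_scale_right[OF assms] scaleR_eq_vector_mult scaleR_conv_of_real algebra_simps)

text \<open>The value of \<open>wedge_power2\<close> at one point, for a fixed Hermitian form, so
  that the linear algebra need not mention a base point.\<close>

primrec pw :: "(complex^'n \<Rightarrow> complex^'n \<Rightarrow> complex) \<Rightarrow> nat \<Rightarrow> (nat \<Rightarrow> complex^'n) \<Rightarrow> complex" where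
  "pw h 0 v = 1"
| "pw h (Suc k) v = pair2 (om h) (pw h k) (2 * k) v / 2"

lemma alt_form_pw:
  assumes "hermitian_inner h"
  shows "alt_form (2 * k) (pw h k)"
proof (induction k)
  case 0
  then show ?case by (simp add: alt_form_def)
next
  case (Suc k)
  have "alt_form (Suc (Suc (2 * k))) (\<lambda>v. 1/2 * pair2 (om h) (pw h k) (2 * k) v)"
    by (intro alt_form_cmult alt_form_pair2 Suc om_linear assms)
  then show ?case by simp
qed

lemma wedge_power2_pw:
  assumes "hermitian_inner (H z)"
  shows "wedge_power2 (fundamental_form H) k z = pw (H z) k"
proof (induction k)
  case 0
  then show ?case by (simp add: fun_eq_iff)
next
  case (Suc k)
  have F: "fundamental_form H = (\<lambda>z v. om (H z) (v 0) (v 1))"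
    by (simp add: fun_eq_iff fundamental_form_def om_def)
  have *: "alt_form (2 * k) (wedge_power2 (fundamental_form H) k z)"
    unfolding Suc by (rule alt_form_pw[OF assms])
  show ?case
  proof
    fix v
    show "wedge_power2 (fundamental_form H) (Suc k) z v = pw (H z) (Suc k) v"
      using wedge_pair2[where K = "2 * k" and z = z and \<alpha> = "wedge_power2 (fundamental_form H) k"
        and q = "\<lambda>z. om (H z)" and v = v, OF *] unfolding F[symmetric] Suc by simp
  qed
qed

text \<open>In each term of the expansion the distinguished argument either enters
  \<open>om\<close>, which then vanishes, or survives into the lower power, where induction
  applies.\<close>

lemma pw_orthogonal_arg:
  assumes h: "hermitian_inner h" and "s < 2 * k"
    and "\<And>r. r < 2 * k \<Longrightarrow> r \<noteq> s \<Longrightarrow> om h (v s) (v r) = 0 \<and> om h (v r) (v s) = 0"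
  shows "pw h k v = 0"
  using assms(2,3)
proof (induction k arbitrary: v s)
  case (Suc k)
  have "om h (v i) (v (skip i l)) * pw h k (v \<circ> skip i \<circ> skip l) = 0"
    if i: "i \<le> Suc (2 * k)" and l: "l \<le> 2 * k" for i l
  proof (cases "s = i \<or> s = skip i l")
    case True
    have "i < 2 * Suc k" "skip i l < 2 * Suc k" using i l skip_less[of l "Suc (2 * k)" i] by auto
    then have "om h (v i) (v (skip i l)) = 0"
      using True Suc.prems(2)[of i] Suc.prems(2)[of "skip i l"] by fastforce
    then show ?thesis by simp
  next
    case False
    obtain s1 where s1: "s1 < Suc (2 * k)" "skip i s1 = s"
      using skip_surj[of i "Suc (2 * k)" s] i False Suc.prems(1) by auto
    obtain s' where s': "s' < 2 * k" "skip l s' = s1"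
      using skip_surj[of l "2 * k" s1] l s1 False by auto
    have "pw h k (v \<circ> skip i \<circ> skip l) = 0"
    proof (rule Suc.IH[OF s'(1)])
      fix r assume r: "r < 2 * k" "r \<noteq> s'"
      then have "skip i (skip l r) < 2 * Suc k" by (simp add: skip_less)
      moreover have "skip i (skip l r) \<noteq> s" using r s1 s' by auto
      ultimately show "om h ((v \<circ> skip i \<circ> skip l) s') ((v \<circ> skip i \<circ> skip l) r) = 0 \<and>
          om h ((v \<circ> skip i \<circ> skip l) r) ((v \<circ> skip i \<circ> skip l) s') = 0"
        using Suc.prems(2) s1 s' by simp
    qed
    then show ?thesis by simp
  qed
  then have "pair2 (om h) (pw h k) (2 * k) v = 0"
    unfolding pair2_expand by (intro sum.neutral ballI) simp
  then show ?case by simp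
qed simp

text \<open>The real frame \<open>b 0, \<i> b 0, b 1, \<i> b 1, ...\<close> underlying a complex
  frame, in the order on which powers of a positive (1,1)-form are positive.\<close>

definition realify :: "(nat \<Rightarrow> complex^'n) \<Rightarrow> nat \<Rightarrow> complex^'n" where
  "realify b i = (if even i then b (i div 2) else \<i> *s b (i div 2))"

lemma realify_simps [simp]: "realify b (2 * j) = b j" "realify b (Suc (2 * j)) = \<i> *s b j"
  by (auto simp: realify_def)

lemma sum_even_odd: "(\<Sum>i\<le>Suc (2 * k). g i) = (\<Sum>j\<le>k. g (2 * j) + g (Suc (2 * j)))"
  for g :: "nat \<Rightarrow> 'a::comm_monoid_add"
  by (induction k) (auto simp: add.assoc)

lemma om_orthogonal:
  assumes h: "hermitian_inner h" and "h (b (i div 2)) (b (j div 2)) = 0"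
  shows "om h (realify b i) (realify b j) = 0"
proof -
  have "h (b (j div 2)) (b (i div 2)) = 0"
    using assms(2) herm_cnj[OF h, of "b (j div 2)" "b (i div 2)"] by simp
  then show ?thesis
    using assms(2) by (simp add: om_def realify_def herm_scale_left[OF h] herm_scale_right[OF h])
qed

text \<open>Orthogonality makes \<open>om\<close> vanish between different complex lines. If
  \<open>q\<close> takes one vector of a pair \<open>b j, \<i> b j\<close> without the other, the
  partner left behind pairs to zero with everything remaining, so only complete pairs
  contribute.\<close>

lemma pair2_pw_orthogonal:
  assumes h: "hermitian_inner h"
    and orth: "\<And>i j. i \<le> k \<Longrightarrow> j \<le> k \<Longrightarrow> i \<noteq> j \<Longrightarrow> h (b i) (b j) = 0"
  shows "pair2 q (pw h k) (2 * k) (realify b) =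
    (\<Sum>j\<le>k. (q (b j) (\<i> *s b j) - q (\<i> *s b j) (b j)) * pw h k (realify (b \<circ> skip j)))"
proof -
  let ?t = "\<lambda>i l. (-1) ^ (i + l) *
      (q (realify b i) (realify b (skip i l)) * pw h k (realify b \<circ> skip i \<circ> skip l))"
  have off: "pw h k (realify b \<circ> skip i \<circ> skip l) = 0"
    if i: "i \<le> Suc (2 * k)" and l: "l \<le> 2 * k" and ne: "i div 2 \<noteq> skip i l div 2" for i l
  proof -
    \<comment> \<open>\<open>s\<close> is the other vector of the pair containing
      \<open>i\<close>.\<close>
    define s where "s = (if even i then Suc i else i - 1)"
    have s: "s div 2 = i div 2" "s \<noteq> i" "s \<le> Suc (2 * k)" "s \<noteq> skip i l"
      using i ne by (auto simp: s_def elim!: evenE oddE)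
    have two: "j = s" if "j div 2 = i div 2" "j \<noteq> i" for j
      using that by (cases "even i"; cases "even j") (auto simp: s_def elim!: evenE oddE)
    obtain s1 where s1: "s1 < Suc (2 * k)" "skip i s1 = s"
      using skip_surj[of i "Suc (2 * k)" s] i s by auto
    obtain s' where s': "s' < 2 * k" "skip l s' = s1"
      using skip_surj[of l "2 * k" s1] l s1 s by auto
    show ?thesis
    proof (rule pw_orthogonal_arg[OF h s'(1)])
      fix r assume r: "r < 2 * k" "r \<noteq> s'"
      let ?r = "skip i (skip l r)"
      have "?r \<noteq> s" using r s1 s' by auto
      then have d: "?r div 2 \<noteq> s div 2" using two[of ?r] s(1) by auto
      have "?r < Suc (Suc (2 * k))" using r by (simp add: skip_less)
      then have "?r div 2 \<le> k" "s div 2 \<le> k" using s(3) by auto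
      then have "h (b (s div 2)) (b (?r div 2)) = 0" "h (b (?r div 2)) (b (s div 2)) = 0"
        using orth d by auto
      then show "om h ((realify b \<circ> skip i \<circ> skip l) s') ((realify b \<circ> skip i \<circ> skip l) r) = 0 \<and>
          om h ((realify b \<circ> skip i \<circ> skip l) r) ((realify b \<circ> skip i \<circ> skip l) s') = 0"
        using s' s1 om_orthogonal[OF h] by simp
    qed
  qed
  \<comment> \<open>After \<open>i\<close> is dropped, its partner sits at position
    \<open>2 * (i div 2)\<close> of the remaining list, whether \<open>i\<close> is even or
    odd.\<close>
  have single: "(\<Sum>l\<le>2 * k. ?t i l) = ?t i (2 * (i div 2))" if i: "i \<le> Suc (2 * k)" for i
  proof -
    have "2 * (i div 2) \<le> 2 * k" using i by auto
    moreover have "?t i l = 0" if "l \<le> 2 * k" "l \<noteq> 2 * (i div 2)" for l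
    proof -
      have "i div 2 \<noteq> skip i l div 2"
        using that(2) by (cases "even i") (auto simp: skip_def elim!: evenE oddE)
      then show ?thesis using off[OF i that(1)] by simp
    qed
    ultimately have "(\<Sum>l\<in>{..2 * k}. ?t i l) = (\<Sum>l\<in>{2 * (i div 2)}. ?t i l)"
      by (intro sum.mono_neutral_right) auto
    then show ?thesis by simp
  qed
  have comp: "realify b \<circ> skip (2 * j) \<circ> skip (2 * j) = realify (b \<circ> skip j)"
    "realify b \<circ> skip (Suc (2 * j)) \<circ> skip (2 * j) = realify (b \<circ> skip j)" for j
    by (auto simp: fun_eq_iff realify_def skip_def)
  have "pair2 q (pw h k) (2 * k) (realify b) = (\<Sum>i\<le>Suc (2 * k). ?t i (2 * (i div 2)))"
    unfolding pair2_expand by (intro sum.cong refl single) simp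
  also have "\<dots> = (\<Sum>j\<le>k. ?t (2 * j) (2 * j) + ?t (Suc (2 * j)) (2 * j))"
    unfolding sum_even_odd by simp
  also have "\<dots> = (\<Sum>j\<le>k. (q (b j) (\<i> *s b j) - q (\<i> *s b j) (b j)) * pw h k (realify (b \<circ> skip j)))"
  proof (rule sum.cong[OF refl])
    fix j
    have "skip (2 * j) (2 * j) = Suc (2 * j)" "skip (Suc (2 * j)) (2 * j) = 2 * j"
      by (auto simp: skip_def)
    then show "?t (2 * j) (2 * j) + ?t (Suc (2 * j)) (2 * j) =
        (q (b j) (\<i> *s b j) - q (\<i> *s b j) (b j)) * pw h k (realify (b \<circ> skip j))"
      unfolding comp by (simp add: power_add left_diff_distrib)
  qed
  finally show ?thesis .
qed

text \<open>Splitting off any of the pairs gives the same full product, since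
  \<open>om h (b j) (\<i> *s b j)\<close> is \<open>h (b j) (b j)\<close>; iterating over the powers
  produces the factorial.\<close>

lemma pw_orthogonal:
  assumes h: "hermitian_inner h"
    and orth: "\<And>i j. i < k \<Longrightarrow> j < k \<Longrightarrow> i \<noteq> j \<Longrightarrow> h (b i) (b j) = 0"
  shows "pw h k (realify b) = fact k * (\<Prod>j<k. h (b j) (b j))"
  using orth
proof (induction k arbitrary: b)
  case (Suc k)
  have o: "om h (b j) (\<i> *s b j) - om h (\<i> *s b j) (b j) = 2 * h (b j) (b j)" for j
    by (simp add: om_def herm_scale_left[OF h] herm_scale_right[OF h] algebra_simps)
  have "pw h (Suc k) (realify b) =
      (\<Sum>j\<le>k. 2 * h (b j) (b j) * pw h k (realify (b \<circ> skip j))) / 2"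
    using pair2_pw_orthogonal[OF h, of k b "om h"] Suc.prems by (simp add: o)
  also have "(\<Sum>j\<le>k. 2 * h (b j) (b j) * pw h k (realify (b \<circ> skip j))) =
      (\<Sum>j\<le>k. 2 * fact k * (\<Prod>i\<le>k. h (b i) (b i)))"
  proof (rule sum.cong[OF refl])
    fix j assume j: "j \<in> {..k}"
    have "pw h k (realify (b \<circ> skip j)) = fact k * (\<Prod>i<k. h ((b \<circ> skip j) i) ((b \<circ> skip j) i))"
      by (rule Suc.IH) (use Suc.prems skip_less[of _ k j] in auto)
    then show "2 * h (b j) (b j) * pw h k (realify (b \<circ> skip j)) =
        2 * fact k * (\<Prod>i\<le>k. h (b i) (b i))"
      using prod_skip[of j k "\<lambda>i. h (b i) (b i)"] j by simp
  qed
  finally show ?case by (simp add: lessThan_Suc_atMost)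
qed simp

text \<open>The conditions on \<open>q\<close> hold for every sesquilinear form; they make each pair
  contribute \<open>- 2 * \<i> * q (b j) (b j)\<close>. This common factor is divided out
  later.\<close>

lemma pair2_pw_diagonal:
  assumes h: "hermitian_inner h"
    and orth: "\<And>i j. i \<le> k \<Longrightarrow> j \<le> k \<Longrightarrow> i \<noteq> j \<Longrightarrow> h (b i) (b j) = 0"
    and q: "\<And>x. q x (\<i> *s x) = - \<i> * q x x" "\<And>x. q (\<i> *s x) x = \<i> * q x x"
  shows "pair2 q (pw h k) (2 * k) (realify b) =
    - 2 * \<i> * fact k * (\<Sum>j\<le>k. q (b j) (b j) * (\<Prod>i<k. h (b (skip j i)) (b (skip j i))))"
proof -
  have "pw h k (realify (b \<circ> skip j)) = fact k * (\<Prod>i<k. h (b (skip j i)) (b (skip j i)))" if "j \<le> k" for j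
    using pw_orthogonal[OF h, of k "b \<circ> skip j"] orth skip_less[of _ k j] that
    by (auto simp: less_Suc_eq_le)
  then show ?thesis
    using pair2_pw_orthogonal[OF h, of k b q] orth unfolding sum_distrib_left
    by (auto simp: q algebra_simps intro!: sum.cong)
qed

section \<open>Change of complex frame and orthogonalisation\<close>

lemma realify_upd: "realify (b(m := x)) = (realify b)(2 * m := x, Suc (2 * m) := \<i> *s x)"
  by (auto simp: realify_def fun_eq_iff elim!: evenE oddE)

text \<open>A complex multiple of \<open>x\<close> is a real combination of \<open>x\<close> and
  \<open>\<i> *s x\<close>, both of which already occur among the other arguments.\<close>

lemma alt_form_add_multiple:
  assumes M: "alt_form K M" and s: "s < K" "s \<noteq> i" "s \<noteq> j" "i < K" "j < K"
    and v: "v i = x" "v j = \<i> *s x"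
  shows "M (v(s := a + c *s x)) = M (v(s := a))"
proof -
  have L: "linear (\<lambda>y. M (v(s := y)))" by (rule alt_form_linear[OF M s(1)])
  have "c *s x = Re c *\<^sub>R v i + Im c *\<^sub>R v j"
    unfolding v scaleR_eq_vector_mult by (simp add: vec_eq_iff complex_eq_iff)
  then have "M (v(s := a + c *s x)) = M (v(s := a)) + (Re c *\<^sub>R M (v(s := v i)) + Im c *\<^sub>R M (v(s := v j)))"
    using L by (simp add: linear_iff)
  moreover have "M (v(s := v i)) = 0"
    by (rule alt_form_equal_args[OF M s(2) s(1) s(4)]) (use s in auto)
  moreover have "M (v(s := v j)) = 0"
    by (rule alt_form_equal_args[OF M s(3) s(1) s(5)]) (use s in auto)
  ultimately show ?thesis by simp
qed

lemma alt_form_realify_add: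
  assumes M: "alt_form (2 * d) M" and im: "i \<noteq> m" "i < d" "m < d"
  shows "M (realify (b(m := b m + c *s b i))) = M (realify b)"
proof -
  let ?v = "realify b"
  have "M (?v(2 * m := b m + c *s b i, Suc (2 * m) := \<i> *s (b m + c *s b i))) =
        M (?v(2 * m := b m + c *s b i, Suc (2 * m) := \<i> *s b m + (\<i> * c) *s b i))"
    by (simp add: vector_add_ldistrib)
  also have "\<dots> = M (?v(2 * m := b m + c *s b i, Suc (2 * m) := \<i> *s b m))"
    by (rule alt_form_add_multiple[OF M, of _ "2 * i" "Suc (2 * i)"])
      (use im in auto)
  also have "\<dots> = M ((?v(Suc (2 * m) := \<i> *s b m))(2 * m := b m + c *s b i))"
    by (simp add: fun_upd_twist)
  also have "\<dots> = M ((?v(Suc (2 * m) := \<i> *s b m))(2 * m := b m))"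
    by (rule alt_form_add_multiple[OF M, of _ "2 * i" "Suc (2 * i)"])
      (use im in auto)
  also have "(?v(Suc (2 * m) := \<i> *s b m))(2 * m := b m) = ?v"
    by (auto simp: fun_eq_iff)
  finally show ?thesis unfolding realify_upd .
qed

lemma alt_form_realify_add_sum:
  assumes M: "alt_form (2 * d) M" and I: "finite I" "I \<subseteq> {..<d} - {m}" and m: "m < d"
  shows "M (realify (b(m := b m + (\<Sum>i\<in>I. c i *s b i)))) = M (realify b)"
  using I
proof (induction I)
  case (insert i I)
  let ?b = "b(m := b m + (\<Sum>i\<in>I. c i *s b i))"
  have "M (realify (?b(m := ?b m + c i *s ?b i))) = M (realify ?b)"
    by (rule alt_form_realify_add[OF M]) (use insert m in auto)
  also have "M (realify ?b) = M (realify b)" using insert by blast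
  also have "?b(m := ?b m + c i *s ?b i) = b(m := b m + (\<Sum>i\<in>insert i I. c i *s b i))"
    using insert by (auto simp: fun_eq_iff ac_simps)
  finally show ?case .
qed simp

text \<open>Orthogonalisation without normalisation: each change is a unitriangular column
  operation, which an alternating form on the whole frame does not notice, and replacing a vector by
  its component orthogonal to its predecessors only shortens it. Together these facts yield
  Hadamard's inequality.\<close>

lemma gram_schmidt:
  fixes e :: "nat \<Rightarrow> complex^'n::finite"
  assumes h: "hermitian_inner h" and s: "inj_on s {..<d}" and e: "\<And>j. j < d \<Longrightarrow> e j = axis (s j) 1"
  obtains b where "\<And>i j. i < d \<Longrightarrow> j < d \<Longrightarrow> i \<noteq> j \<Longrightarrow> h (b i) (b j) = 0"
    "\<And>M. alt_form (2 * d) M \<Longrightarrow> M (realify b) = M (realify e)"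
    "\<And>j. j < d \<Longrightarrow> Re (h (b j) (b j)) \<le> Re (h (e j) (e j))"
    "\<And>j. j < d \<Longrightarrow> b j \<noteq> 0"
proof -
  \<comment> \<open>The last conjunct says that \<open>b\<close> is unitriangular in the coordinates
    \<open>s j\<close>; it keeps all vectors nonzero, so that the next projection may divide by
    their squared lengths.\<close>
  have "\<exists>b. (\<forall>i<m. \<forall>j<m. i \<noteq> j \<longrightarrow> h (b i) (b j) = 0) \<and> (\<forall>j\<ge>m. b j = e j) \<and>
     (\<forall>M. alt_form (2 * d) M \<longrightarrow> M (realify b) = M (realify e)) \<and>
     (\<forall>j<d. Re (h (b j) (b j)) \<le> Re (h (e j) (e j))) \<and>
     (\<forall>j<d. b j $ s j = 1 \<and> (\<forall>i<d. j < i \<longrightarrow> b j $ s i = 0))" if "m \<le> d" for m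
    using that
  proof (induction m)
    case 0
    show ?case
      by (rule exI[of _ e]) (use e s in \<open>auto simp: axis_def dest: inj_onD\<close>)
  next
    case (Suc m)
    let ?P = "\<lambda>m b. (\<forall>i<m. \<forall>j<m. i \<noteq> j \<longrightarrow> h (b i) (b j) = 0) \<and> (\<forall>j\<ge>m. b j = e j) \<and>
       (\<forall>M. alt_form (2 * d) M \<longrightarrow> M (realify b) = M (realify e)) \<and>
       (\<forall>j<d. Re (h (b j) (b j)) \<le> Re (h (e j) (e j))) \<and>
       (\<forall>j<d. b j $ s j = 1 \<and> (\<forall>i<d. j < i \<longrightarrow> b j $ s i = 0))"
    obtain b where B: "?P m b" using Suc by (auto simp: Suc_le_eq less_imp_le)
    have b: "\<And>i j. i < m \<Longrightarrow> j < m \<Longrightarrow> i \<noteq> j \<Longrightarrow> h (b i) (b j) = 0"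
      "\<And>j. j \<ge> m \<Longrightarrow> b j = e j"
      "\<And>M. alt_form (2 * d) M \<Longrightarrow> M (realify b) = M (realify e)"
      "\<And>j. j < d \<Longrightarrow> Re (h (b j) (b j)) \<le> Re (h (e j) (e j))"
      "\<And>j. j < d \<Longrightarrow> b j $ s j = 1" "\<And>i j. i < d \<Longrightarrow> j < i \<Longrightarrow> b j $ s i = 0"
      using B by simp_all
    have nz: "h (b i) (b i) \<noteq> 0" if "i < m" for i
      using herm_pos[OF h, of "b i"] b(5)[of i] that Suc.prems by fastforce
    define c where "c i = - h (b m) (b i) / h (b i) (b i)" for i
    define y where "y = (\<Sum>i<m. c i *s b i)"
    define x where "x = b m + y"
    have xb: "h x (b i) = 0" if i: "i < m" for i
    proof -
      have "h y (b i) = (\<Sum>i'<m. c i' * h (b i') (b i))"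
        unfolding y_def by (simp add: herm_sum_left[OF h] herm_scale_left[OF h])
      also have "\<dots> = (\<Sum>i'\<in>{i}. c i' * h (b i') (b i))"
        by (rule sum.mono_neutral_right) (use i b(1) in auto)
      also have "\<dots> = - h (b m) (b i)" using nz[OF i] by (simp add: c_def)
      finally show ?thesis by (simp add: x_def herm_add_left[OF h])
    qed
    have bx: "h (b i) x = 0" if "i < m" for i
      using xb[OF that] herm_cnj[OF h, of "b i" x] by simp
    have xy: "h x y = 0" "h y x = 0"
      unfolding y_def using xb bx
      by (simp_all add: herm_sum_left[OF h] herm_sum_right[OF h] herm_scale_left[OF h] herm_scale_right[OF h])
    \<comment> \<open>Pythagoras for \<open>b m\<close>, split into the orthogonal vectors
      \<open>x\<close> and \<open>- y\<close>.\<close>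
    have "b m = x + (-1) *s y" by (simp add: x_def vec_eq_iff)
    then have "h (b m) (b m) = h x x + h y y"
      by (simp only: herm_add_left[OF h] herm_add_right[OF h] herm_scale_left[OF h] herm_scale_right[OF h] xy)
         simp
    then have le: "Re (h x x) \<le> Re (h (b m) (b m))" using herm_nonneg[OF h, of y] by simp
    show ?case
    proof (intro exI[of _ "b(m := x)"] conjI allI impI)
      fix i j assume "i < Suc m" "j < Suc m" "i \<noteq> j"
      then show "h ((b(m := x)) i) ((b(m := x)) j) = 0"
        using b(1) xb bx by (auto simp: less_Suc_eq)
    next
      fix M :: "(nat \<Rightarrow> complex^'n) \<Rightarrow> complex" assume M: "alt_form (2 * d) M"
      have "M (realify (b(m := x))) = M (realify b)"
        unfolding x_def y_def by (rule alt_form_realify_add_sum[OF M]) (use Suc.prems in auto)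
      then show "M (realify (b(m := x))) = M (realify e)" using b(3)[OF M] by simp
    next
      fix j assume "j < d"
      then show "Re (h ((b(m := x)) j) ((b(m := x)) j)) \<le> Re (h (e j) (e j))"
        using b(4)[of j] le by auto
    next
      fix j assume "j < d"
      then show "(b(m := x)) j $ s j = 1"
        using b(5)[of j] b(6)[of m] by (auto simp: x_def y_def)
    next
      fix j i assume "j < d" "i < d" "j < i"
      then show "(b(m := x)) j $ s i = 0"
        using b(6)[of i] by (auto simp: x_def y_def)
    qed (use b(2) in auto)
  qed
  from this[OF order_refl] obtain b where B: "(\<forall>i<d. \<forall>j<d. i \<noteq> j \<longrightarrow> h (b i) (b j) = 0)"
     "(\<forall>M. alt_form (2 * d) M \<longrightarrow> M (realify b) = M (realify e))"
     "(\<forall>j<d. Re (h (b j) (b j)) \<le> Re (h (e j) (e j)))"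
     "(\<forall>j<d. b j $ s j = 1 \<and> (\<forall>i<d. j < i \<longrightarrow> b j $ s i = 0))" by (elim exE conjE)
  have "b j \<noteq> 0" if "j < d" for j
    using B(4) that by (metis zero_index zero_neq_one)
  then show thesis using B(1-3) by (intro that[of b]) simp_all
qed

section \<open>The complex Hessian of the logarithm of the squared norm\<close>

definition ip :: "complex^'n::finite \<Rightarrow> complex^'n \<Rightarrow> complex" where
  "ip x y = (\<Sum>j\<in>UNIV. x $ j * cnj (y $ j))"

text \<open>
  With \<open>t = ln |z|\<^sup>2\<close>, \<open>qB z x y\<close> is \<open>\<partial>t\<close> at \<open>x\<close> times the conjugate of \<open>\<partial>t\<close> at \<open>y\<close>, and \<open>qA z\<close> is the Levi form of \<open>t\<close>.
\<close>

definition qB :: "complex^'n::finite \<Rightarrow> complex^'n \<Rightarrow> complex^'n \<Rightarrow> complex" where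
  "qB z x y = ip x z * cnj (ip y z) / (of_real ((norm z)\<^sup>2))\<^sup>2"

definition qA :: "complex^'n::finite \<Rightarrow> complex^'n \<Rightarrow> complex^'n \<Rightarrow> complex" where
  "qA z x y = ip x y / of_real ((norm z)\<^sup>2) - qB z x y"

lemma ip_self: "ip x x = of_real ((norm x)\<^sup>2)"
  by (simp add: ip_def norm_vec_def L2_set_def sum_nonneg complex_norm_square[symmetric])

lemma norm_axis_complex: "norm (axis i (x::complex) :: complex^'n::finite) = cmod x"
  unfolding norm_vec_def L2_set_def axis_def
  by (simp add: if_distrib[of norm] if_distrib[of "\<lambda>x. x ^ 2"] cong: if_cong)

lemma hermitian_inner_ip: "hermitian_inner (ip :: complex^'n::finite \<Rightarrow> _)"
  unfolding hermitian_inner_def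
proof (intro conjI allI impI)
  fix u v w :: "complex^'n" and c
  show "ip (u + v) w = ip u w + ip v w"
    by (simp add: ip_def algebra_simps sum.distrib)
  show "ip (c *s u) w = c * ip u w"
    by (simp add: ip_def sum_distrib_left mult.assoc)
  show "ip w u = cnj (ip u w)"
    by (simp add: ip_def mult.commute)
  show "0 < Re (ip u u)" if "u \<noteq> 0"
    using that by (simp add: ip_self)
qed

lemmas ip_simps = herm_add_left[OF hermitian_inner_ip] herm_add_right[OF hermitian_inner_ip]
  herm_scale_left[OF hermitian_inner_ip] herm_scale_right[OF hermitian_inner_ip]

lemma qB_linear: "linear (qB z x)" "linear (\<lambda>x. qB z x y)"
  unfolding linear_iff qB_def
  by (auto simp: ip_simps scaleR_eq_vector_mult scaleR_conv_of_real add_divide_distrib algebra_simps)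

lemma qA_linear: "linear (qA z x)" "linear (\<lambda>x. qA z x y)"
  unfolding qA_def
  by (intro linear_compose_sub qB_linear;
      auto simp: linear_iff ip_simps scaleR_eq_vector_mult scaleR_conv_of_real add_divide_distrib algebra_simps)+

lemma qB_i: "qB z x (\<i> *s x) = - \<i> * qB z x x" "qB z (\<i> *s x) x = \<i> * qB z x x"
  by (simp_all add: qB_def ip_simps)

lemma qA_i: "qA z x (\<i> *s x) = - \<i> * qA z x x" "qA z (\<i> *s x) x = \<i> * qA z x x"
  by (simp_all add: qA_def qB_i ip_simps algebra_simps)

lemma qB_self: "qB z x x = of_real ((cmod (ip x z))\<^sup>2 / ((norm z)\<^sup>2)\<^sup>2)"
  by (simp only: qB_def complex_norm_square[symmetric] of_real_divide of_real_power)

text \<open>By Pythagoras, removing the component of \<open>x\<close> along \<open>z\<close>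
  subtracts exactly the \<open>qB\<close> term. So \<open>qA\<close> is the Fubini-Study form,
  nonnegative with the line through \<open>z\<close> as its kernel.\<close>

lemma qA_self:
  assumes "z \<noteq> 0"
  shows "qA z x x = of_real ((norm (x - (ip x z / of_real ((norm z)\<^sup>2)) *s z))\<^sup>2 / (norm z)\<^sup>2)"
proof -
  define u :: complex where "u = of_real ((norm z)\<^sup>2)"
  have u: "u \<noteq> 0" "cnj u = u" using assms by (auto simp: u_def)
  have zx: "ip z x = cnj (ip x z)" by (rule herm_cnj[OF hermitian_inner_ip])
  define l where "l = - (ip x z / u)"
  have "x - (ip x z / u) *s z = x + l *s z"
    by (simp add: vec_eq_iff l_def)
  moreover have "ip (x + l *s z) (x + l *s z) = ip x x - ip x z * cnj (ip x z) / u"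
    using u by (simp only: ip_simps zx ip_self[of z] u_def[symmetric]) (simp add: l_def field_simps)
  ultimately have "ip (x - (ip x z / u) *s z) (x - (ip x z / u) *s z) =
      ip x x - ip x z * cnj (ip x z) / u" by (simp only:)
  then have "of_real ((norm (x - (ip x z / u) *s z))\<^sup>2) / u = ip x x / u - ip x z * cnj (ip x z) / u\<^sup>2"
    unfolding ip_self[symmetric, of "x - (ip x z / u) *s z"] using u
    by (simp add: diff_divide_distrib power2_eq_square)
  then show ?thesis
    by (simp only: qA_def qB_def u_def of_real_divide)
qed

lemma qA_qB_sum: "Re (qA z x x) + Re (qB z x x) = (norm x)\<^sup>2 / (norm z)\<^sup>2"
  unfolding qA_def minus_complex.sel ip_self of_real_divide[symmetric] Re_complex_of_real by simp

text \<open>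
  The Levi form is degenerate only along \<open>z\<close>, and two \<open>h\<close>-orthogonal vectors cannot both be close to
  the line through \<open>z\<close>.
\<close>

lemma qA_orthogonal_pair:
  assumes h: "hermitian_inner h" and z: "z \<noteq> 0" and C: "C > 0"
    and hC: "\<And>v. (norm z)\<^sup>2 * Re (h v v) \<le> C * (norm v)\<^sup>2"
    and xy: "x \<noteq> 0" "y \<noteq> 0" "h x y = 0"
  shows "Re (qA z x x) / Re (h x x) + Re (qA z y y) / Re (h y y) \<ge> 1 / (2 * C)"
proof -
  define u where "u = (norm z)\<^sup>2"
  have u: "u > 0" using z by (simp add: u_def)
  define l where "l = ip x z / of_real u"
  define m where "m = ip y z / of_real u"
  define r where "r = x - l *s z"
  define s where "s = y - m *s z"
  have hx: "Re (h x x) > 0" and hy: "Re (h y y) > 0" using herm_pos[OF h] xy by auto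
  have qx: "Re (qA z x x) = (norm r)\<^sup>2 / u" and qy: "Re (qA z y y) = (norm s)\<^sup>2 / u"
    using qA_self[OF z] by (simp_all add: r_def l_def s_def m_def u_def)
  have "u * Re (h x x) / (2 * C) \<le> (norm r)\<^sup>2 \<or> u * Re (h y y) / (2 * C) \<le> (norm s)\<^sup>2"
  proof (cases "l = 0 \<and> m = 0")
    case True
    then have "r = x" by (simp add: r_def)
    moreover have "u * Re (h x x) / (2 * C) \<le> u * Re (h x x) / C"
      using C hx u by (simp add: field_simps)
    moreover have "u * Re (h x x) / C \<le> (norm x)\<^sup>2"
      using hC[of x] C by (simp add: u_def field_simps)
    ultimately show ?thesis by simp
  next
    case False
    show ?thesis
    proof (rule ccontr)
      assume "\<not> ?thesis"
      then have lt: "2 * C * (norm r)\<^sup>2 < u * Re (h x x)" "2 * C * (norm s)\<^sup>2 < u * Re (h y y)"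
        using C by (simp_all add: field_simps)
      \<comment> \<open>The components along \<open>z\<close> cancel in this combination, so it
        equals \<open>m r - l s\<close> and is short when \<open>r\<close> and \<open>s\<close> are.
        By orthogonality of \<open>x\<close> and \<open>y\<close> its \<open>h\<close>-length is too
        large for that.\<close>
      let ?w = "m *s x + (- l) *s y"
      have w: "?w = m *s r + (- l) *s s"
        by (simp add: r_def s_def vec_eq_iff algebra_simps)
      have yx: "h y x = 0" using herm_cnj[OF h, of y x] xy by simp
      have "h ?w ?w = (m * cnj m) * h x x + (l * cnj l) * h y y"
        by (simp only: herm_add_left[OF h] herm_add_right[OF h] herm_scale_left[OF h]
            herm_scale_right[OF h] xy yx) simp
      then have "Re (h ?w ?w) = (cmod m)\<^sup>2 * Re (h x x) + (cmod l)\<^sup>2 * Re (h y y)"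
        by (subst (asm) herm_real[OF h, of x], subst (asm) herm_real[OF h, of y])
          (simp only: complex_norm_square[symmetric] of_real_mult[symmetric] of_real_add[symmetric] Re_complex_of_real)
      then have "u * ((cmod m)\<^sup>2 * Re (h x x) + (cmod l)\<^sup>2 * Re (h y y)) \<le> C * (norm ?w)\<^sup>2"
        using hC[of ?w] by (simp add: u_def)
      moreover have "(norm ?w)\<^sup>2 \<le> 2 * ((cmod m)\<^sup>2 * (norm r)\<^sup>2 + (cmod l)\<^sup>2 * (norm s)\<^sup>2)"
      proof -
        have "norm ?w \<le> cmod m * norm r + cmod l * norm s"
          unfolding w using norm_triangle_ineq[of "m *s r" "(- l) *s s"]
          by (simp only: norm_complex_vector_mult norm_minus_cancel)
        then have "(norm ?w)\<^sup>2 \<le> (cmod m * norm r + cmod l * norm s)\<^sup>2"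
          by (rule power_mono) simp
        also have "\<dots> \<le> 2 * ((cmod m * norm r)\<^sup>2 + (cmod l * norm s)\<^sup>2)"
          using zero_le_power2[of "cmod m * norm r - cmod l * norm s"]
          unfolding power2_diff power2_sum distrib_left by linarith
        finally show ?thesis by (simp only: power_mult_distrib)
      qed
      ultimately have "u * ((cmod m)\<^sup>2 * Re (h x x) + (cmod l)\<^sup>2 * Re (h y y)) \<le>
          C * (2 * ((cmod m)\<^sup>2 * (norm r)\<^sup>2 + (cmod l)\<^sup>2 * (norm s)\<^sup>2))"
        using C by (meson mult_left_mono order_trans less_imp_le)
      then have "(cmod m)\<^sup>2 * (u * Re (h x x)) + (cmod l)\<^sup>2 * (u * Re (h y y)) \<le>
          (cmod m)\<^sup>2 * (2 * C * (norm r)\<^sup>2) + (cmod l)\<^sup>2 * (2 * C * (norm s)\<^sup>2)"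
        by (simp add: algebra_simps)
      moreover have "(cmod m)\<^sup>2 * (2 * C * (norm r)\<^sup>2) \<le> (cmod m)\<^sup>2 * (u * Re (h x x))"
        "(cmod l)\<^sup>2 * (2 * C * (norm s)\<^sup>2) \<le> (cmod l)\<^sup>2 * (u * Re (h y y))"
        using lt by (intro mult_left_mono; simp)+
      moreover have "(cmod m)\<^sup>2 * (2 * C * (norm r)\<^sup>2) < (cmod m)\<^sup>2 * (u * Re (h x x)) \<or>
        (cmod l)\<^sup>2 * (2 * C * (norm s)\<^sup>2) < (cmod l)\<^sup>2 * (u * Re (h y y))"
        using lt False by (auto simp: mult_less_cancel_left)
      ultimately show False by linarith
    qed
  qed
  then have "1 / (2 * C) \<le> Re (qA z x x) / Re (h x x) \<or> 1 / (2 * C) \<le> Re (qA z y y) / Re (h y y)"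
    unfolding qx qy using u C hx hy by (simp add: field_simps)
  moreover have "0 \<le> Re (qA z x x) / Re (h x x)" "0 \<le> Re (qA z y y) / Re (h y y)"
    unfolding qx qy using u hx hy by simp_all
  ultimately show ?thesis by linarith
qed

text \<open>The value is the determinant of \<open>h\<close> in the orthogonal frame times the
  \<open>h\<close>-trace of \<open>q\<close>, so comparing different \<open>q\<close> amounts to
  comparing traces.\<close>

lemma pair2_pw_real:
  assumes h: "hermitian_inner h"
    and orth: "\<And>i j. i \<le> k \<Longrightarrow> j \<le> k \<Longrightarrow> i \<noteq> j \<Longrightarrow> h (b i) (b j) = 0"
    and b: "\<And>j. j \<le> k \<Longrightarrow> b j \<noteq> 0"
    and q: "\<And>x. q x (\<i> *s x) = - \<i> * q x x" "\<And>x. q (\<i> *s x) x = \<i> * q x x"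
    and r: "\<And>x. q x x = of_real (Re (q x x))"
  shows "pair2 q (pw h k) (2 * k) (realify b) = - 2 * \<i> * fact k *
     of_real ((\<Prod>j\<le>k. Re (h (b j) (b j))) * (\<Sum>j\<le>k. Re (q (b j) (b j)) / Re (h (b j) (b j))))"
proof -
  let ?H = "\<lambda>j. Re (h (b j) (b j))"
  have "q (b j) (b j) * (\<Prod>i<k. h (b (skip j i)) (b (skip j i))) =
      of_real ((\<Prod>j\<le>k. ?H j) * (Re (q (b j) (b j)) / ?H j))" if j: "j \<le> k" for j
  proof -
    have "?H j \<noteq> 0" using herm_pos[OF h b[OF j]] by simp
    then have "(\<Prod>i<k. ?H (skip j i)) = (\<Prod>j\<le>k. ?H j) / ?H j"
      using prod_skip[OF j, of ?H] by (simp add: field_simps)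
    moreover have "(\<Prod>i<k. h (b (skip j i)) (b (skip j i))) = of_real (\<Prod>i<k. ?H (skip j i))"
      using herm_real[OF h] by simp
    ultimately show ?thesis by (subst r) (simp add: field_simps)
  qed
  then show ?thesis
    unfolding pair2_pw_diagonal[where q = q and b = b and k = k, OF h orth q, simplified]
    by (simp add: sum_distrib_left sum_negf)
qed

text \<open>\<open>a\<close> and \<open>b\<close> are a common Gram determinant times the
  \<open>h\<close>-traces of \<open>qA\<close> and \<open>qB\<close>. Two orthogonal vectors,
  available since \<open>k \<ge> 1\<close>, keep the first trace above \<open>1 / (2 * C)\<close>;
  comparison with the Euclidean metric keeps both below \<open>(k + 1) / c\<close>. The quotient of
  these bounds is the constant in the estimate of \<open>b\<close>.\<close>

lemma hessian_pairing:
  fixes e :: "nat \<Rightarrow> complex^'n::finite"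
  assumes h: "hermitian_inner h" and z: "z \<noteq> 0" and c: "c > 0"
    and hc: "\<And>v. c * (norm v)\<^sup>2 \<le> (norm z)\<^sup>2 * Re (h v v)"
    and hC: "\<And>v. (norm z)\<^sup>2 * Re (h v v) \<le> C * (norm v)\<^sup>2"
    and s: "inj_on s {..<Suc k}" and e: "\<And>j. j < Suc k \<Longrightarrow> e j = axis (s j) 1" and k: "k \<ge> 1"
  obtains a b :: real where
    "pair2 (qA z) (pw h k) (2 * k) (realify e) = - 2 * \<i> * fact k * of_real a"
    "pair2 (qB z) (pw h k) (2 * k) (realify e) = - 2 * \<i> * fact k * of_real b"
    "0 < a" "0 \<le> b" "b \<le> 2 * C * real (Suc k) / c * a"
    "a * ((norm z)\<^sup>2) ^ Suc k \<le> C ^ Suc k * real (Suc k) / c"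
proof -
  define u where "u = (norm z)\<^sup>2"
  have u: "u > 0" using z by (simp add: u_def)
  have "c * (norm z)\<^sup>2 \<le> C * (norm z)\<^sup>2" using hc[of z] hC[of z] by linarith
  then have C: "C > 0" using u c by (simp add: u_def)
  obtain b where b: "\<And>i j. i < Suc k \<Longrightarrow> j < Suc k \<Longrightarrow> i \<noteq> j \<Longrightarrow> h (b i) (b j) = 0"
    "\<And>M. alt_form (2 * Suc k) M \<Longrightarrow> M (realify b) = M (realify e)"
    "\<And>j. j < Suc k \<Longrightarrow> Re (h (b j) (b j)) \<le> Re (h (e j) (e j))"
    "\<And>j. j < Suc k \<Longrightarrow> b j \<noteq> 0"
    using gram_schmidt[OF h s e] by metis
  have orth: "h (b i) (b j) = 0" if "i \<le> k" "j \<le> k" "i \<noteq> j" for i j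
    using b(1) that by simp
  have nz: "b j \<noteq> 0" if "j \<le> k" for j using b(4) that by simp
  let ?H = "\<lambda>j. Re (h (b j) (b j))"
  let ?a = "\<lambda>q. (\<Prod>j\<le>k. ?H j) * (\<Sum>j\<le>k. Re (q (b j) (b j)) / ?H j)"
  have H: "?H j > 0" if "j \<le> k" for j using herm_pos[OF h nz[OF that]] .
  then have P: "(\<Prod>j\<le>k. ?H j) > 0" by (intro prod_pos) auto
  have eqA: "pair2 (qA z) (pw h k) (2 * k) (realify e) = - 2 * \<i> * fact k * of_real (?a (qA z))"
  proof -
    have "alt_form (Suc (Suc (2 * k))) (pair2 (qA z) (pw h k) (2 * k))"
      by (rule alt_form_pair2[OF alt_form_pw[OF h] qA_linear])
    then have "pair2 (qA z) (pw h k) (2 * k) (realify e) = pair2 (qA z) (pw h k) (2 * k) (realify b)"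
      by (intro b(2)[symmetric]) simp
    also have "\<dots> = - 2 * \<i> * fact k * of_real (?a (qA z))"
    proof (rule pair2_pw_real[OF h])
      show "qA z x x = of_real (Re (qA z x x))" for x
        unfolding qA_self[OF z] by simp
    qed (use orth nz qA_i qB_i in auto)
    finally show ?thesis .
  qed
  have eqB: "pair2 (qB z) (pw h k) (2 * k) (realify e) = - 2 * \<i> * fact k * of_real (?a (qB z))"
  proof -
    have "alt_form (Suc (Suc (2 * k))) (pair2 (qB z) (pw h k) (2 * k))"
      by (rule alt_form_pair2[OF alt_form_pw[OF h] qB_linear])
    then have "pair2 (qB z) (pw h k) (2 * k) (realify e) = pair2 (qB z) (pw h k) (2 * k) (realify b)"
      by (intro b(2)[symmetric]) simp
    also have "\<dots> = - 2 * \<i> * fact k * of_real (?a (qB z))"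
    proof (rule pair2_pw_real[OF h])
      show "qB z x x = of_real (Re (qB z x x))" for x
        unfolding qB_self by simp
    qed (use orth nz qA_i qB_i in auto)
    finally show ?thesis .
  qed
  have A0: "0 \<le> Re (qA z x x)" and B0: "0 \<le> Re (qB z x x)" for x
    unfolding qA_self[OF z] qB_self by simp_all
  have le: "(Re (qA z (b j) (b j)) + Re (qB z (b j) (b j))) / ?H j \<le> 1 / c" if "j \<le> k" for j
    unfolding qA_qB_sum using hc[of "b j"] H[OF that] c z by (simp add: field_simps)
  have leA: "Re (qA z (b j) (b j)) / ?H j \<le> 1 / c" and leB: "Re (qB z (b j) (b j)) / ?H j \<le> 1 / c"
    if "j \<le> k" for j
    using le[OF that] A0[of "b j"] B0[of "b j"] H[OF that]
    by (auto simp: add_divide_distrib intro: order_trans[rotated])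
  have SA: "(\<Sum>j\<le>k. Re (qA z (b j) (b j)) / ?H j) \<le> real (Suc k) / c"
    using sum_bounded_above[of "{..k}" "\<lambda>j. Re (qA z (b j) (b j)) / ?H j" "1 / c"] leA by simp
  have SB: "(\<Sum>j\<le>k. Re (qB z (b j) (b j)) / ?H j) \<le> real (Suc k) / c"
    using sum_bounded_above[of "{..k}" "\<lambda>j. Re (qB z (b j) (b j)) / ?H j" "1 / c"] leB by simp
  have SA2: "1 / (2 * C) \<le> (\<Sum>j\<le>k. Re (qA z (b j) (b j)) / ?H j)"
  proof -
    have "1 / (2 * C) \<le> (\<Sum>j\<in>{0, 1}. Re (qA z (b j) (b j)) / ?H j)"
      using qA_orthogonal_pair[OF h z C hC, of "b 0" "b 1"] nz orth[of 0 1] k by simp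
    also have "\<dots> \<le> (\<Sum>j\<le>k. Re (qA z (b j) (b j)) / ?H j)"
      using k A0 H by (intro sum_mono2) (auto intro!: divide_nonneg_pos)
    finally show ?thesis .
  qed
  show thesis
  proof (rule that[OF eqA eqB])
    show "0 < ?a (qA z)" using P SA2 C by (intro mult_pos_pos) (auto intro: less_le_trans[rotated])
    show "0 \<le> ?a (qB z)"
      using P B0 H by (intro mult_nonneg_nonneg sum_nonneg) (auto intro!: divide_nonneg_pos)
    have "real (Suc k) / c \<le> 2 * C * real (Suc k) / c * (\<Sum>j\<le>k. Re (qA z (b j) (b j)) / ?H j)"
      using mult_left_mono[OF SA2, of "2 * C * real (Suc k) / c"] C c by simp
    then have "(\<Sum>j\<le>k. Re (qB z (b j) (b j)) / ?H j) \<le>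
        2 * C * real (Suc k) / c * (\<Sum>j\<le>k. Re (qA z (b j) (b j)) / ?H j)"
      using SB by linarith
    then have "?a (qB z) \<le> (\<Prod>j\<le>k. ?H j) * (2 * C * real (Suc k) / c * (\<Sum>j\<le>k. Re (qA z (b j) (b j)) / ?H j))"
      using P by (intro mult_left_mono) auto
    then show "?a (qB z) \<le> 2 * C * real (Suc k) / c * ?a (qA z)"
      by (simp only: mult.left_commute)
    \<comment> \<open>Hadamard's inequality: orthogonalisation does not increase
      \<open>h (e j) (e j)\<close>, which is at most \<open>C / u\<close> on coordinate
      vectors.\<close>
    have "(\<Prod>j\<le>k. ?H j) \<le> (\<Prod>j\<le>k. C / u)"
    proof (rule prod_mono, rule conjI)
      fix j assume j: "j \<in> {..k}"
      show "0 \<le> ?H j" using H j by (auto intro: less_imp_le)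
      have "u * Re (h (e j) (e j)) \<le> C"
        using hC[of "e j"] e[of j] j by (simp add: u_def norm_axis_complex)
      then have "Re (h (e j) (e j)) \<le> C / u" using u by (simp add: field_simps)
      then show "?H j \<le> C / u" using b(3)[of j] j by auto
    qed
    then have "(\<Prod>j\<le>k. ?H j) * u ^ Suc k \<le> C ^ Suc k"
      using u by (simp add: power_divide field_simps)
    moreover have "?a (qA z) \<le> (\<Prod>j\<le>k. ?H j) * (real (Suc k) / c)"
      using P SA by (intro mult_left_mono) auto
    ultimately have "?a (qA z) * u ^ Suc k \<le> C ^ Suc k * (real (Suc k) / c)"
      using u c by (smt (verit) mult.assoc mult.commute mult_right_mono zero_le_power divide_nonneg_pos of_nat_0_le_iff)
    then show "?a (qA z) * ((norm z)\<^sup>2) ^ Suc k \<le> C ^ Suc k * real (Suc k) / c"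
      by (simp add: u_def)
  qed
qed

section \<open>Pullback of the Dolbeault operators\<close>

text \<open>The parameter \<open>s\<close> is \<open>- \<i>\<close> for the holomorphic and
  \<open>\<i>\<close> for the antiholomorphic part of the differential, so both Dolbeault operators
  are handled together.\<close>

definition dsg :: "complex \<Rightarrow> (complex^'n::finite \<Rightarrow> complex) \<Rightarrow> complex^'n \<Rightarrow> complex^'n \<Rightarrow> complex" where
  "dsg s f z u = (Dir f z u + s * Dir f z (\<i> *s u)) / 2"

definition dform :: "complex \<Rightarrow> nat \<Rightarrow> 'n::finite form \<Rightarrow> 'n form" where
  "dform s K \<alpha> z = ins K (\<lambda>x w. dsg s (\<lambda>y. \<alpha> y w) z x)"

lemma del_dform: "del K = dform (- \<i>) K"
  by (simp add: fun_eq_iff del_def dform_def ins_def d_hol_def dsg_def skip_def o_def)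

lemma delbar_dform: "delbar K = dform \<i> K"
  by (simp add: fun_eq_iff delbar_def dform_def ins_def d_antihol_def dsg_def skip_def o_def)

lemma dsg_cong_open:
  assumes "open S" "z \<in> S" "\<And>y. y \<in> S \<Longrightarrow> f y = g y"
  shows "dsg s f z u = dsg s g z u"
  using frechet_derivative_cong_open[OF assms] by (simp add: dsg_def)

lemma dform_cong_open:
  assumes "open S" "z \<in> S" "\<And>y w. y \<in> S \<Longrightarrow> \<alpha> y w = \<beta> y w"
  shows "dform s K \<alpha> z v = dform s K \<beta> z v"
proof -
  have "dsg s (\<lambda>y. \<alpha> y w) z x = dsg s (\<lambda>y. \<beta> y w) z x" for w x
    by (rule dsg_cong_open[OF assms(1,2)]) (rule assms(3))
  then show ?thesis by (simp add: dform_def ins_def)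
qed

lemma Dir_linear: "f differentiable (at z) \<Longrightarrow> linear (Dir f z)"
  by (rule has_derivative_linear[OF iffD1[OF frechet_derivative_works]])

lemma dsg_linear:
  assumes "f differentiable (at z)"
  shows "linear (dsg s f z)"
proof -
  have L: "linear (Dir f z)" by (rule Dir_linear[OF assms])
  have i: "\<i> *s (r *\<^sub>R b) = r *\<^sub>R (\<i> *s b)" for r and b :: "complex^'a"
    by (simp add: vec_eq_iff)
  show ?thesis
    using L unfolding linear_iff dsg_def
    by (simp add: vector_add_ldistrib i algebra_simps add_divide_distrib scaleR_conv_of_real[where 'a = complex])
qed

lemma alt_form_derivative:
  assumes S: "open S" "z \<in> S" and A: "\<And>y. y \<in> S \<Longrightarrow> alt_form K (\<alpha> y)"
    and d: "\<And>w. (\<lambda>y. \<alpha> y w) differentiable (at z)"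
  shows "alt_form K (\<lambda>w. Dir (\<lambda>y. \<alpha> y w) z x)"
proof -
  have D: "((\<lambda>y. \<alpha> y w) has_derivative Dir (\<lambda>y. \<alpha> y w) z) (at z)" for w
    by (rule iffD1[OF frechet_derivative_works d])
  show ?thesis
    unfolding alt_form_def
  proof (intro conjI allI impI)
    fix v w :: "nat \<Rightarrow> 'b" assume vw: "\<forall>i<K. v i = w i"
    have "Dir (\<lambda>y. \<alpha> y v) z = Dir (\<lambda>y. \<alpha> y w) z"
      by (rule frechet_derivative_cong_open[OF S], rule alt_form_cong[OF A]) (use vw in auto)
    then show "Dir (\<lambda>y. \<alpha> y v) z x = Dir (\<lambda>y. \<alpha> y w) z x" by simp
  next
    fix v :: "nat \<Rightarrow> 'b" and j assume j: "Suc j < K"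
    have "Dir (\<lambda>y. \<alpha> y (v \<circ> Transposition.transpose j (Suc j))) z = Dir (\<lambda>y. - \<alpha> y v) z"
      by (rule frechet_derivative_cong_open[OF S]) (rule alt_form_adjacent[OF A j])
    also have "\<dots> = (\<lambda>x. - Dir (\<lambda>y. \<alpha> y v) z x)"
      by (rule frechet_derivative_eq) (rule has_derivative_minus[OF D])
    finally show "Dir (\<lambda>y. \<alpha> y (v \<circ> Transposition.transpose j (Suc j))) z x = - Dir (\<lambda>y. \<alpha> y v) z x"
      by simp
  next
    fix v :: "nat \<Rightarrow> 'b" and j assume j: "j < K"
    have "Dir (\<lambda>y. \<alpha> y (v(j := a + b))) z = Dir (\<lambda>y. \<alpha> y (v(j := a)) + \<alpha> y (v(j := b))) z" for a b
      by (rule frechet_derivative_cong_open[OF S]) (use alt_form_linear[OF A j] in \<open>simp add: linear_iff\<close>)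
    moreover have "Dir (\<lambda>y. \<alpha> y (v(j := a)) + \<alpha> y (v(j := b))) z =
        (\<lambda>x. Dir (\<lambda>y. \<alpha> y (v(j := a))) z x + Dir (\<lambda>y. \<alpha> y (v(j := b))) z x)" for a b
      by (rule frechet_derivative_eq) (rule has_derivative_add[OF D D])
    moreover have "Dir (\<lambda>y. \<alpha> y (v(j := r *\<^sub>R a))) z = Dir (\<lambda>y. r *\<^sub>R \<alpha> y (v(j := a))) z" for a r
      by (rule frechet_derivative_cong_open[OF S]) (use alt_form_linear[OF A j] in \<open>simp add: linear_iff\<close>)
    moreover have "Dir (\<lambda>y. r *\<^sub>R \<alpha> y (v(j := a))) z = (\<lambda>x. r *\<^sub>R Dir (\<lambda>y. \<alpha> y (v(j := a))) z x)" for a r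
      by (rule frechet_derivative_eq) (rule has_derivative_scaleR_right[OF D])
    ultimately show "linear (\<lambda>a. Dir (\<lambda>y. \<alpha> y (v(j := a))) z x)"
      by (simp add: linear_iff)
  qed
qed

lemma alt_form_add: "alt_form K M \<Longrightarrow> alt_form K N \<Longrightarrow> alt_form K (\<lambda>v. M v + N v)"
  unfolding alt_form_def by (auto intro: linear_compose_add; metis)

lemma alt_form_dform:
  assumes S: "open S" "z \<in> S" and A: "\<And>y. y \<in> S \<Longrightarrow> alt_form K (\<alpha> y)"
    and d: "\<And>w. (\<lambda>y. \<alpha> y w) differentiable (at z)"
  shows "alt_form (Suc K) (dform s K \<alpha> z)"
  unfolding dform_def
proof (rule alt_form_ins)
  fix x
  have "alt_form K (\<lambda>w. 1/2 * (Dir (\<lambda>y. \<alpha> y w) z x + s * Dir (\<lambda>y. \<alpha> y w) z (\<i> *s x)))"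
    by (intro alt_form_add alt_form_cmult alt_form_derivative[OF S A d])
  then show "alt_form K (\<lambda>w. dsg s (\<lambda>y. \<alpha> y w) z x)" by (simp add: dsg_def)
qed (rule dsg_linear[OF d])

lemma Ck_on_dsg:
  assumes "open S" "Ck_on (Suc k) S f"
  shows "Ck_on k S (\<lambda>z. dsg s f z u)"
proof -
  have "Ck_on k S (\<lambda>z. 1/2 * (Dir f z u + s * Dir f z (\<i> *s u)))"
    using assms by (intro Ck_on_mult Ck_on_add Ck_on_const) auto
  then show ?thesis by (simp add: dsg_def)
qed

lemma Ck_on_dform:
  assumes "open S" "\<And>w. Ck_on (Suc k) S (\<lambda>y. \<alpha> y w)"
  shows "Ck_on k S (\<lambda>z. dform s K \<alpha> z v)"
  unfolding dform_def ins_def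
  by (intro Ck_on_sum Ck_on_mult Ck_on_const Ck_on_dsg assms)

section \<open>Naturality of the Dolbeault operators under holomorphic maps\<close>

lemma alt_form_expand:
  fixes v :: "nat \<Rightarrow> 'a::euclidean_space"
  assumes "alt_form K M" "j < K"
  shows "M (v(j := x)) = (\<Sum>b\<in>Basis. (x \<bullet> b) *\<^sub>R M (v(j := b)))"
  by (rule linear_euclidean_expansion[OF alt_form_linear[OF assms]])

text \<open>Derivatives of \<open>M\<close> are known for constant arguments only, so the arguments
  are released one at a time, each expanded in the basis to make the scalar product rule
  applicable.\<close>

lemma has_derivative_multilinear:
  fixes M :: "'a::euclidean_space \<Rightarrow> (nat \<Rightarrow> 'b::euclidean_space) \<Rightarrow> complex"
  assumes S: "open S" "z \<in> S" and A: "\<And>y. y \<in> S \<Longrightarrow> alt_form K (M y)"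
    and d: "\<And>w. (\<lambda>y. M y w) differentiable (at z)"
    and w: "\<And>i. (w i has_derivative D i) (at z)"
  shows "((\<lambda>y. M y (\<lambda>i. w i y)) has_derivative
     (\<lambda>x. Dir (\<lambda>y. M y (\<lambda>i. w i z)) z x + (\<Sum>l<K. M z ((\<lambda>i. w i z)(l := D l x))))) (at z)"
proof -
  \<comment> \<open>The first \<open>j\<close> arguments move with \<open>y\<close>, the others are
    frozen at \<open>c\<close>.\<close>
  let ?c = "\<lambda>j c y i. if i < j then w i y else c i"
  have E: "alt_form K (\<lambda>c. Dir (\<lambda>y. M y c) z x)" for x
    by (rule alt_form_derivative[OF S A d])
  have "((\<lambda>y. M y (?c j c y)) has_derivative
     (\<lambda>x. Dir (\<lambda>y. M y (?c j c z)) z x + (\<Sum>l<j. M z ((?c j c z)(l := D l x))))) (at z)"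
    if "j \<le> K" for j c
    using that
  proof (induction j arbitrary: c)
    case 0
    show ?case using iffD1[OF frechet_derivative_works d[of c]] by simp
  next
    case (Suc j)
    then have j: "j < K" "j \<le> K" by auto
    have upd: "?c (Suc j) c y = (?c j c y)(j := w j y)" "?c j (c(j := b)) y = (?c j c y)(j := b)" for y b
      by (auto simp: fun_eq_iff less_Suc_eq)
    let ?F = "\<lambda>b x. Dir (\<lambda>y. M y (?c j (c(j := b)) z)) z x + (\<Sum>l<j. M z ((?c j (c(j := b)) z)(l := D l x)))"
    have "((\<lambda>y. \<Sum>b\<in>Basis. (w j y \<bullet> b) *\<^sub>R M y (?c j (c(j := b)) y)) has_derivative
       (\<lambda>x. \<Sum>b\<in>Basis. (w j z \<bullet> b) *\<^sub>R ?F b x + (D j x \<bullet> b) *\<^sub>R M z (?c j (c(j := b)) z))) (at z)"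
      by (intro has_derivative_sum has_derivative_scaleR Suc.IH[OF j(2)] has_derivative_inner_left w)
    moreover have "(\<Sum>b\<in>Basis. (w j z \<bullet> b) *\<^sub>R ?F b x + (D j x \<bullet> b) *\<^sub>R M z (?c j (c(j := b)) z)) =
        Dir (\<lambda>y. M y (?c (Suc j) c z)) z x + (\<Sum>l<Suc j. M z ((?c (Suc j) c z)(l := D l x)))" for x
    proof -
      have 1: "(\<Sum>b\<in>Basis. (w j z \<bullet> b) *\<^sub>R Dir (\<lambda>y. M y (?c j (c(j := b)) z)) z x) =
          Dir (\<lambda>y. M y (?c (Suc j) c z)) z x"
        unfolding upd by (rule alt_form_expand[OF E j(1), symmetric])
      have 2: "(\<Sum>b\<in>Basis. (w j z \<bullet> b) *\<^sub>R M z ((?c j (c(j := b)) z)(l := D l x))) =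
          M z ((?c (Suc j) c z)(l := D l x))" if "l < j" for l
      proof -
        have "((?c j c z)(j := b))(l := D l x) = ((?c j c z)(l := D l x))(j := b)" for b
          using that by (simp add: fun_upd_twist)
        then show ?thesis
          unfolding upd using alt_form_expand[OF A[OF S(2)] j(1), symmetric] by simp
      qed
      have 3: "(\<Sum>b\<in>Basis. (D j x \<bullet> b) *\<^sub>R M z (?c j (c(j := b)) z)) =
          M z ((?c (Suc j) c z)(j := D j x))"
        unfolding upd using alt_form_expand[OF A[OF S(2)] j(1), of "?c j c z" "D j x"] by simp
      have "(\<Sum>b\<in>Basis. (w j z \<bullet> b) *\<^sub>R (\<Sum>l<j. M z ((?c j (c(j := b)) z)(l := D l x)))) =
          (\<Sum>l<j. M z ((?c (Suc j) c z)(l := D l x)))"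
        unfolding scaleR_sum_right by (subst sum.swap, rule sum.cong[OF refl], rule 2, simp)
      then show ?thesis
        unfolding scaleR_add_right sum.distrib 1 3 by simp
    qed
    ultimately have "((\<lambda>y. \<Sum>b\<in>Basis. (w j y \<bullet> b) *\<^sub>R M y (?c j (c(j := b)) y)) has_derivative
       (\<lambda>x. Dir (\<lambda>y. M y (?c (Suc j) c z)) z x + (\<Sum>l<Suc j. M z ((?c (Suc j) c z)(l := D l x))))) (at z)"
      by simp
    then show ?case
    proof (rule has_derivative_transform_within_open[OF _ S])
      fix y assume "y \<in> S"
      then show "(\<Sum>b\<in>Basis. (w j y \<bullet> b) *\<^sub>R M y (?c j (c(j := b)) y)) = M y (?c (Suc j) c y)"
        unfolding upd using alt_form_expand[OF A j(1), symmetric] by simp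
    qed
  qed
  from this[OF order_refl, of "\<lambda>i. w i z"] show ?thesis
  proof (rule has_derivative_transform_within_open[OF _ S, THEN has_derivative_eq_rhs])
    fix y assume "y \<in> S"
    then show "M y (?c K (\<lambda>i. w i z) y) = M y (\<lambda>i. w i y)"
      by (intro alt_form_cong[OF A]) auto
  qed simp
qed

text \<open>The terms for \<open>(i, a)\<close> and \<open>(a, i)\<close> insert the same vector and
  differ by which of two slots is dropped, so they cancel by
  \<open>alt_form_skip_equal_args\<close>. With second derivatives as \<open>X\<close>, this is why
  exterior differentiation commutes with pullback.\<close>

lemma alt_form_symmetric_cancel:
  assumes M: "alt_form K M" and X: "\<And>i a. X i a = X a i"
  shows "(\<Sum>i\<le>K. \<Sum>l<K. (-1) ^ i * M ((c \<circ> skip i)(l := X i (skip i l)))) = 0"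
proof -
  \<comment> \<open>The vector is written into both slots; the entry at \<open>i\<close> is dropped
    anyway, but it makes the lists for \<open>(i, a)\<close> and \<open>(a, i)\<close> equal. The
    value 0 on the diagonal lets the sum run over all \<open>a\<close>.\<close>
  define t where "t i a = (if i = a then 0 else (-1) ^ i * M ((c(a := X i a, i := X i a)) \<circ> skip i))" for i a
  have eq: "(\<Sum>l<K. (-1) ^ i * M ((c \<circ> skip i)(l := X i (skip i l)))) = (\<Sum>a\<le>K. t i a)" if i: "i \<le> K" for i
  proof -
    have "(c(skip i l := x, i := x)) \<circ> skip i = (c \<circ> skip i)(l := x)" for l x
      by (auto simp: fun_eq_iff)
    then have "(\<Sum>l<K. (-1) ^ i * M ((c \<circ> skip i)(l := X i (skip i l)))) = (\<Sum>l<K. t i (skip i l))"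
      by (simp add: t_def)
    also have "\<dots> = (\<Sum>a\<in>{..K} - {i}. t i a)"
      by (rule sum.reindex_bij_betw[OF bij_betw_skip[OF i]])
    also have "\<dots> = (\<Sum>a\<le>K. t i a)"
      by (rule sum.mono_neutral_left) (auto simp: t_def)
    finally show ?thesis .
  qed
  have lt: "t i a = - t a i" if "i < a" "a \<le> K" for i a
  proof -
    let ?v = "c(a := X i a, i := X i a)"
    have "M (?v \<circ> skip i) = (-1) ^ (a - i - 1) * M (?v \<circ> skip a)"
      by (rule alt_form_skip_equal_args[OF M that]) (use that in auto)
    moreover have "?v = c(i := X a i, a := X a i)"
      using that X[of i a] by (simp add: fun_upd_twist)
    moreover have "(-1) ^ i * (-1) ^ (a - i - 1) = - ((-1) ^ a :: complex)"
    proof -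
      obtain d where "a = Suc (i + d)" using \<open>i < a\<close> less_iff_Suc_add by auto
      then show ?thesis by (simp add: power_add[symmetric])
    qed
    ultimately show ?thesis using that by (simp add: t_def mult.assoc[symmetric])
  qed
  have anti: "t i a = - t a i" if "i \<le> K" "a \<le> K" for i a
    using lt[of i a] lt[of a i] that by (cases i a rule: linorder_cases) (auto simp: t_def)
  have "(\<Sum>i\<le>K. \<Sum>a\<le>K. t i a) = (\<Sum>i\<le>K. \<Sum>a\<le>K. - t a i)"
    by (intro sum.cong refl anti) auto
  also have "\<dots> = - (\<Sum>i\<le>K. \<Sum>a\<le>K. t i a)"
    by (subst sum.swap) (simp add: sum_negf)
  finally have "(\<Sum>i\<le>K. \<Sum>a\<le>K. t i a) = 0" by simp
  then show ?thesis using eq by simp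
qed

definition pullback :: "(complex^'n::finite \<Rightarrow> complex^'n) \<Rightarrow> 'n form \<Rightarrow> 'n form" where
  "pullback \<tau> \<alpha> z v = \<alpha> (\<tau> z) (\<lambda>i. Dir \<tau> z (v i))"

text \<open>
  The second derivatives of \<open>\<tau>\<close> enter through symmetric expressions and are annihilated by the alternating sum.
\<close>

lemma dform_pullback:
  assumes S: "open S" "z \<in> S" and T: "open T" and \<tau>: "holo_on \<tau> S" "\<And>y. y \<in> S \<Longrightarrow> \<tau> y \<in> T"
    and A: "\<And>y. y \<in> T \<Longrightarrow> alt_form K (\<alpha> y)"
    and d: "\<And>y w. y \<in> T \<Longrightarrow> (\<lambda>y. \<alpha> y w) differentiable (at y)"
  shows "dform s K (pullback \<tau> \<alpha>) z v = pullback \<tau> (dform s K \<alpha>) z v"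
proof -
  let ?L = "Dir \<tau> z"
  define H where "H x u = Dir (\<lambda>y. Dir \<tau> y u) z x" for x u
  have D\<tau>: "(\<tau> has_derivative ?L) (at z)" by (rule holo_onD(1)[OF \<tau>(1) S(2)])
  have Li: "?L (\<i> *s x) = \<i> *s ?L x" for x by (rule holo_onD(2)[OF \<tau>(1) S(2)])
  have Hi: "H (\<i> *s x) u = \<i> *s H x u" for x u
    unfolding H_def by (rule holo_onD(2)[OF holo_on_Dir[OF S(1) \<tau>(1)] S(2)])
  have Hs: "H x u = H u x" for x u
    unfolding H_def by (rule symmetric_mixed_derivatives[OF S(1) holo_on_Ck_on[OF S(1) \<tau>(1)] S(2)])
  have DH: "((\<lambda>y. Dir \<tau> y u) has_derivative (\<lambda>x. H x u)) (at z)" for u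
    unfolding H_def by (rule holo_onD(1)[OF holo_on_Dir[OF S(1) \<tau>(1)] S(2)])
  have zT: "\<tau> z \<in> T" by (rule \<tau>(2)[OF S(2)])
  let ?E = "\<lambda>w. Dir (\<lambda>y. \<alpha> y w) (\<tau> z)"
  have comp: "((\<lambda>y. \<alpha> (\<tau> y) w) has_derivative (\<lambda>x. ?E w (?L x))) (at z)" for w
    by (rule has_derivative_compose[OF D\<tau> iffD1[OF frechet_derivative_works d[OF zT]]])
  let ?M = "\<alpha> (\<tau> z)"
  have DP: "Dir (\<lambda>y. pullback \<tau> \<alpha> y w) z x =
      ?E (\<lambda>i. ?L (w i)) (?L x) + (\<Sum>l<K. ?M ((\<lambda>i. ?L (w i))(l := H x (w l))))" for w x
  proof -
    have "((\<lambda>y. \<alpha> (\<tau> y) (\<lambda>i. Dir \<tau> y (w i))) has_derivative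
       (\<lambda>x. Dir (\<lambda>y. \<alpha> (\<tau> y) (\<lambda>i. ?L (w i))) z x + (\<Sum>l<K. ?M ((\<lambda>i. ?L (w i))(l := H x (w l)))))) (at z)"
    proof (rule has_derivative_multilinear[OF S])
      show "alt_form K (\<alpha> (\<tau> y))" if "y \<in> S" for y by (rule A[OF \<tau>(2)[OF that]])
      show "(\<lambda>y. \<alpha> (\<tau> y) w) differentiable at z" for w
        unfolding differentiable_def by (rule exI) (rule comp)
    qed (rule DH)
    from frechet_derivative_eq[OF this] show ?thesis
      unfolding pullback_def frechet_derivative_eq[OF comp] by simp
  qed
  let ?c = "\<lambda>i. ?L (v i)"
  let ?R = "\<lambda>i l X. ?M ((?c \<circ> skip i)(l := X))"
  \<comment> \<open>\<open>H\<close> is symmetric and complex linear, so both halves of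
    \<open>dsg\<close> insert vectors symmetric in the two slots.\<close>
  have dsg_term: "dsg s (\<lambda>y. pullback \<tau> \<alpha> y (v \<circ> skip i)) z (v i) =
      dsg s (\<lambda>y. \<alpha> y (?c \<circ> skip i)) (\<tau> z) (?c i) +
      (\<Sum>l<K. 1/2 * ?R i l (H (v i) (v (skip i l))) + s/2 * ?R i l (\<i> *s H (v i) (v (skip i l))))" for i
  proof -
    show ?thesis
      unfolding dsg_def DP
      by (simp add: o_def Li Hi sum.distrib add_divide_distrib sum_divide_distrib sum_distrib_left algebra_simps)
  qed
  have "dform s K (pullback \<tau> \<alpha>) z v = (\<Sum>i\<le>K. (-1) ^ i * dsg s (\<lambda>y. \<alpha> y (?c \<circ> skip i)) (\<tau> z) (?c i)) +
     (\<Sum>i\<le>K. (-1) ^ i * (\<Sum>l<K. 1/2 * ?R i l (H (v i) (v (skip i l))) + s/2 * ?R i l (\<i> *s H (v i) (v (skip i l)))))"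
    unfolding dform_def ins_def dsg_term distrib_left sum.distrib by simp
  also have "(\<Sum>i\<le>K. (-1) ^ i * (\<Sum>l<K. 1/2 * ?R i l (H (v i) (v (skip i l))) + s/2 * ?R i l (\<i> *s H (v i) (v (skip i l))))) =
      1/2 * (\<Sum>i\<le>K. \<Sum>l<K. (-1) ^ i * ?R i l (H (v i) (v (skip i l)))) +
      s/2 * (\<Sum>i\<le>K. \<Sum>l<K. (-1) ^ i * ?R i l (\<i> *s H (v i) (v (skip i l))))"
    by (simp add: sum.distrib sum_distrib_left distrib_left mult.left_commute)
  also have "\<dots> = 0"
    using alt_form_symmetric_cancel[OF A[OF zT], of "\<lambda>i a. H (v i) (v a)" ?c]
      alt_form_symmetric_cancel[OF A[OF zT], of "\<lambda>i a. \<i> *s H (v i) (v a)" ?c] Hs by simp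
  finally show ?thesis
    by (simp add: pullback_def dform_def ins_def o_def)
qed

lemma dform_dform_pullback:
  assumes S: "open S" "z \<in> S" and T: "open T" and \<tau>: "holo_on \<tau> S" "\<And>y. y \<in> S \<Longrightarrow> \<tau> y \<in> T"
    and A: "\<And>y. y \<in> T \<Longrightarrow> alt_form K (\<alpha> y)"
    and d: "\<And>w. Ck_on 2 T (\<lambda>y. \<alpha> y w)"
  shows "dform s' (Suc K) (dform s K (pullback \<tau> \<alpha>)) z v = pullback \<tau> (dform s' (Suc K) (dform s K \<alpha>)) z v"
proof -
  have d1: "(\<lambda>y. \<alpha> y w) differentiable (at y)" if "y \<in> T" for y w
    using d that by (simp add: numeral_2_eq_2)
  have "Ck_on 1 T (\<lambda>y. dform s K \<alpha> y w)" for w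
    using Ck_on_dform[OF T, of 1 \<alpha>] d by (simp add: numeral_2_eq_2)
  then have d2: "(\<lambda>y. dform s K \<alpha> y w) differentiable (at y)" if "y \<in> T" for y w
    using that by simp
  have "dform s' (Suc K) (dform s K (pullback \<tau> \<alpha>)) z v = dform s' (Suc K) (pullback \<tau> (dform s K \<alpha>)) z v"
    by (rule dform_cong_open[OF S]) (rule dform_pullback[OF S(1) _ T \<tau> A d1])
  also have "\<dots> = pullback \<tau> (dform s' (Suc K) (dform s K \<alpha>)) z v"
    by (rule dform_pullback[OF S T \<tau> alt_form_dform[OF T _ A d1] d2])
  finally show ?thesis .
qed

lemma dsg_sum:
  assumes "\<And>i. i \<in> I \<Longrightarrow> f i differentiable (at z)"
  shows "dsg s (\<lambda>y. \<Sum>i\<in>I. c i * f i y) z u = (\<Sum>i\<in>I. c i * dsg s (f i) z u)"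
proof -
  have "((\<lambda>y. \<Sum>i\<in>I. c i * f i y) has_derivative (\<lambda>x. \<Sum>i\<in>I. c i * Dir (f i) z x)) (at z)"
    by (intro has_derivative_sum has_derivative_mult_right iffD1[OF frechet_derivative_works] assms)
  from frechet_derivative_eq[OF this] show ?thesis
    by (simp only: dsg_def sum_distrib_left sum.distrib[symmetric] sum_divide_distrib)
      (rule sum.cong[OF refl], simp add: algebra_simps)
qed

lemma dform_dform_expand:
  assumes S: "open S" "z \<in> S" and d: "\<And>w. Ck_on 2 S (\<lambda>y. \<alpha> y w)"
  shows "dform s' (Suc K) (dform s K \<alpha>) z v = (\<Sum>i\<le>Suc K. \<Sum>l\<le>K. (-1) ^ (i + l) *
     dsg s' (\<lambda>y. dsg s (\<lambda>y. \<alpha> y (v \<circ> skip i \<circ> skip l)) y (v (skip i l))) z (v i))"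
proof -
  have "Ck_on 1 S (\<lambda>y. dsg s (\<lambda>y. \<alpha> y w) y u)" for w u
    using Ck_on_dsg[OF S(1), of 1] d by (simp add: numeral_2_eq_2)
  then have "(\<lambda>y. dsg s (\<lambda>y. \<alpha> y w) y u) differentiable (at z)" for w u
    using S by simp
  then show ?thesis
    by (simp add: dform_def ins_def dsg_sum sum_distrib_left power_add mult.assoc)
qed

lemma Ck_on_pw:
  assumes "open S" "\<And>u w. Ck_on k S (\<lambda>z. h z u w)"
  shows "Ck_on k S (\<lambda>z. pw (h z) j v)"
proof (induction j arbitrary: v)
  case 0
  then show ?case by (simp add: Ck_on_const)
next
  case (Suc j)
  have "Ck_on k S (\<lambda>z. om (h z) u w)" for u w
  proof -
    have "Ck_on k S (\<lambda>z. \<i> / 2 * (h z u w + (-1) * h z w u))"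
      by (intro Ck_on_mult Ck_on_const Ck_on_add assms)
    then show ?thesis by (simp add: om_def)
  qed
  then have "Ck_on k S (\<lambda>z. 1/2 * pair2 (om (h z)) (pw (h z) j) (2 * j) v)"
    unfolding pair2_expand by (intro Ck_on_mult Ck_on_sum Ck_on_const assms(1) Suc) auto
  then show ?case by simp
qed

lemma pw_pullback: "pw (\<lambda>u w. h (L u) (L w)) k v = pw h k (\<lambda>i. L (v i))"
proof (induction k arbitrary: v)
  case (Suc k)
  have "om (\<lambda>u w. h (L u) (L w)) x y = om h (L x) (L y)" for x y by (simp add: om_def)
  then show ?case using Suc by (simp add: pair2_expand o_def)
qed simp

section \<open>Integration by parts on boxes\<close>

text \<open>The integral over the box of \<open>f\<close> translated by \<open>t\<close> times
  \<open>v\<close> is constant in \<open>t\<close>, because \<open>f\<close> vanishes on the parts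
  of space that enter or leave the box. Its derivative at 0 is computed under the integral
  sign.\<close>

lemma integral_directional_derivative_zero:
  fixes f :: "'a::euclidean_space \<Rightarrow> 'b::euclidean_space"
  assumes f: "\<And>z. z \<in> S \<Longrightarrow> (f has_derivative f' z) (at z)"
    and c: "continuous_on S (\<lambda>z. f' z v)"
    and S: "\<And>t z. \<bar>t\<bar> \<le> 1 \<Longrightarrow> z \<in> cbox p r \<Longrightarrow> z + t *\<^sub>R v \<in> S"
    and vanish: "\<And>t z. \<bar>t\<bar> \<le> 1 \<Longrightarrow> z \<in> cbox p r \<Longrightarrow> z - t *\<^sub>R v \<notin> cbox p r \<Longrightarrow> f z = 0"
      "\<And>t z. \<bar>t\<bar> \<le> 1 \<Longrightarrow> z \<notin> cbox p r \<Longrightarrow> z - t *\<^sub>R v \<in> cbox p r \<Longrightarrow> f z = 0"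
  shows "integral (cbox p r) (\<lambda>z. f' z v) = 0"
proof -
  have const: "integral (cbox p r) (\<lambda>z. f (z + t *\<^sub>R v)) = integral (cbox p r) f" if t: "\<bar>t\<bar> \<le> 1" for t
  proof -
    let ?B = "cbox (p + t *\<^sub>R v) (r + t *\<^sub>R v)"
    have B: "z \<in> ?B \<longleftrightarrow> z - t *\<^sub>R v \<in> cbox p r" for z
      by (auto simp: mem_box inner_add_left inner_diff_left)
    have "integral (cbox p r) (\<lambda>z. f (z + t *\<^sub>R v)) = integral ?B f"
      using integral_shift_cbox[of "p + t *\<^sub>R v" "t *\<^sub>R v" "r + t *\<^sub>R v" f] by simp
    also have "\<dots> = integral UNIV (\<lambda>z. if z \<in> ?B then f z else 0)"
      by (rule integral_restrict_UNIV[symmetric])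
    also have "(\<lambda>z. if z \<in> ?B then f z else 0) = (\<lambda>z. if z \<in> cbox p r then f z else 0)"
      using vanish[OF t] by (auto simp: fun_eq_iff B)
    also have "integral UNIV \<dots> = integral (cbox p r) f"
      by (rule integral_restrict_UNIV)
    finally show ?thesis .
  qed
  have cf: "continuous_on S f"
    by (rule continuous_at_imp_continuous_on) (use f has_derivative_continuous in blast)
  have "((\<lambda>t. integral (cbox p r) (\<lambda>z. f (z + t *\<^sub>R v))) has_vector_derivative
      integral (cbox p r) (\<lambda>z. f' (z + 0 *\<^sub>R v) v)) (at 0 within {-1..1})"
  proof (rule leibniz_rule_vector_derivative)
    show "((\<lambda>t. f (z + t *\<^sub>R v)) has_vector_derivative f' (z + t *\<^sub>R v) v) (at t within {-1..1})"
      if "t \<in> {-1..1}" "z \<in> cbox p r" for t z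
      by (rule has_vector_derivative_along_line[OF f[OF S]]) (use that in auto)
    show "(\<lambda>z. f (z + t *\<^sub>R v)) integrable_on cbox p r" if "t \<in> {-1..1}" for t
      by (intro integrable_continuous continuous_on_compose2[OF cf] continuous_intros) (use S that in auto)
    show "continuous_on ({-1..1} \<times> cbox p r) (\<lambda>(t, z). f' (z + t *\<^sub>R v) v)"
      unfolding split_beta
      by (intro continuous_on_compose2[OF c] continuous_intros) (use S in auto)
  qed auto
  then have d1: "((\<lambda>t. integral (cbox p r) f) has_vector_derivative integral (cbox p r) (\<lambda>z. f' z v))
      (at 0 within {-1..1})"
    unfolding scaleR_zero_left add_0_right
    by (rule has_vector_derivative_transform[rotated 2]) (auto simp: const)
  have d2: "((\<lambda>t. integral (cbox p r) f) has_vector_derivative 0) (at 0 within {-1..(1::real)})"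
    by (rule has_vector_derivative_const)
  have "a = b" if "(h has_vector_derivative a) (at 0 within {-1..1})"
      "(h has_vector_derivative b) (at 0 within {-1..1})" for h :: "real \<Rightarrow> 'b" and a b
    using vector_derivative_unique_within_closed_interval[of "-1" 1 0] that by (auto simp: cbox_interval)
  from this[OF d1 d2] show ?thesis .
qed

section \<open>Boxes with one parameter coordinate\<close>

lemma mem_cbox_vec:
  fixes z :: "complex^'n::finite"
  shows "z \<in> cbox p r \<longleftrightarrow> (\<forall>j. z $ j \<in> cbox (p $ j) (r $ j))"
  by (auto simp: mem_box Basis_vec_def inner_axis)

text \<open>
  The coordinate \<open>m\<close> is a parameter that is never differentiated; it is kept away from \<open>0\<close>.
\<close>

definition slab :: "'n \<Rightarrow> real \<Rightarrow> (complex^'n::finite) set" where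
  "slab m N = cbox (\<chi> j. if j = m then Complex 1 0 else Complex (-N) (-N))
                   (\<chi> j. if j = m then Complex 2 1 else Complex N N)"

lemma mem_slab:
  "z \<in> slab m N \<longleftrightarrow> z $ m \<in> cbox (Complex 1 0) (Complex 2 1) \<and>
     (\<forall>j. j \<noteq> m \<longrightarrow> z $ j \<in> cbox (Complex (-N) (-N)) (Complex N N))"
  by (auto simp: slab_def mem_cbox_vec)

lemma slab_norm_ge_1: "z \<in> slab m N \<Longrightarrow> 1 \<le> norm z"
proof -
  assume "z \<in> slab m N"
  then have "1 \<le> Re (z $ m)" by (simp add: mem_slab in_cbox_complex_iff)
  also have "\<dots> \<le> cmod (z $ m)" by (rule complex_Re_le_cmod)
  also have "\<dots> \<le> norm z" by (rule Finite_Cartesian_Product.norm_nth_le)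
  finally show ?thesis .
qed

lemma norm_gt_outside_slab:
  fixes z :: "complex^'n::finite"
  assumes "z \<notin> slab m N" "z $ m \<in> cbox (Complex 1 0) (Complex 2 1)"
  shows "N < norm z"
proof -
  obtain j where "j \<noteq> m" "z $ j \<notin> cbox (Complex (-N) (-N)) (Complex N N)"
    using assms by (auto simp: mem_slab)
  then have "N < \<bar>Re (z $ j)\<bar> \<or> N < \<bar>Im (z $ j)\<bar>"
    by (auto simp: in_cbox_complex_iff)
  then have "N < cmod (z $ j)"
    using abs_Re_le_cmod[of "z $ j"] abs_Im_le_cmod[of "z $ j"] by linarith
  also have "\<dots> \<le> norm z" by (rule Finite_Cartesian_Product.norm_nth_le)
  finally show ?thesis .
qed

text \<open>A direction with \<open>v $ m = 0\<close> never crosses the faces of the parameter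
  square. A point that crosses another face under a shift of length at most 1 has norm above
  \<open>N - 1 \<ge> L\<close>, where \<open>f\<close> vanishes.\<close>

lemma integral_slab_zero:
  fixes f :: "complex^'n::finite \<Rightarrow> complex"
  assumes f: "Ck_on 1 (- {0}) f" and v: "v $ m = 0" "norm v \<le> 1"
    and L: "\<And>z. L \<le> norm z \<Longrightarrow> f z = 0" "L + 1 \<le> N"
  shows "integral (slab m N) (\<lambda>z. Dir f z v) = 0"
  unfolding slab_def
proof (rule integral_directional_derivative_zero[where S = "- {0}"], unfold slab_def[symmetric])
  show "(f has_derivative Dir f z) (at z)" if "z \<in> - {0}" for z
    using f that by (intro Ck_on_derivative[of 0]) simp
  show "continuous_on (- {0}) (\<lambda>z. Dir f z v)"
    using f by simp
  have m: "(z + t *\<^sub>R v) $ m = z $ m" "(z - t *\<^sub>R v) $ m = z $ m" for z t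
    using v by simp_all
  show "z + t *\<^sub>R v \<in> - {0}" if "z \<in> slab m N" for z t
  proof -
    have "Re ((z + t *\<^sub>R v) $ m) \<ge> 1"
      unfolding m using that by (simp add: mem_slab in_cbox_complex_iff)
    then show ?thesis by (auto simp del: vector_add_component)
  qed
  have n: "norm (z - t *\<^sub>R v) \<le> norm z + 1" if "\<bar>t\<bar> \<le> 1" for z t
  proof -
    have "norm (z - t *\<^sub>R v) \<le> norm z + \<bar>t\<bar> * norm v"
      using norm_triangle_ineq4[of z "t *\<^sub>R v"] by simp
    also have "\<dots> \<le> norm z + 1 * 1" using that v by (intro add_left_mono mult_mono) auto
    finally show ?thesis by simp
  qed
  show "f z = 0" if "\<bar>t\<bar> \<le> 1" "z \<in> slab m N" "z - t *\<^sub>R v \<notin> slab m N" for t z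
  proof (rule L(1))
    have "N < norm (z - t *\<^sub>R v)"
      by (rule norm_gt_outside_slab[OF that(3)]) (use that(2) in \<open>simp add: m mem_slab del: vector_minus_component\<close>)
    then show "L \<le> norm z" using n[OF that(1), of z] L(2) by linarith
  qed
  show "f z = 0" if "\<bar>t\<bar> \<le> 1" "z \<notin> slab m N" "z - t *\<^sub>R v \<in> slab m N" for t z
  proof (rule L(1))
    have "z $ m \<in> cbox (Complex 1 0) (Complex 2 1)"
      using that(3) m(2)[of z t] by (simp only: mem_slab)
    then have "N < norm z" by (rule norm_gt_outside_slab[OF that(2)])
    then show "L \<le> norm z" using L(2) by linarith
  qed
qed

lemma open_punctured: "open (- {0 :: 'a::euclidean_space})"
  by (simp add: open_Compl)

lemma slab_subset: "slab m N \<subseteq> - {0}"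
  using slab_norm_ge_1 by fastforce

lemma integrable_on_slab:
  fixes f :: "complex^'n::finite \<Rightarrow> complex"
  assumes "Ck_on k (- {0}) f"
  shows "f integrable_on slab m N"
  unfolding slab_def
proof (rule integrable_continuous)
  have "continuous_on (- {0}) f" using Ck_on_mono[OF assms, of 0] by simp
  then show "continuous_on (cbox (\<chi> j. if j = m then Complex 1 0 else Complex (- N) (- N))
     (\<chi> j. if j = m then Complex 2 1 else Complex N N)) f"
    by (rule continuous_on_subset) (use slab_subset[of m N] in \<open>simp add: slab_def\<close>)
qed

lemma integral_slab_parts:
  fixes f g :: "complex^'n::finite \<Rightarrow> complex"
  assumes f: "Ck_on 1 (- {0}) f" and g: "Ck_on 1 (- {0}) g" and v: "v $ m = 0" "norm v \<le> 1"
    and L: "\<And>z. L \<le> norm z \<Longrightarrow> g z = 0" "L + 1 \<le> N"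
  shows "integral (slab m N) (\<lambda>z. g z * dsg s f z v) = - integral (slab m N) (\<lambda>z. dsg s g z v * f z)"
proof -
  have gf: "Ck_on 1 (- {0}) (\<lambda>z. g z * f z)"
    by (rule Ck_on_mult[OF open_punctured g f])
  have zero: "integral (slab m N) (\<lambda>z. Dir (\<lambda>z. g z * f z) z w) = 0" if "w $ m = 0" "norm w \<le> 1" for w
    by (rule integral_slab_zero[OF gf that _ L(2)]) (simp add: L(1))
  have iv: "(\<i> *s v) $ m = 0" "norm (\<i> *s v) \<le> 1"
    using v by (simp_all add: norm_complex_vector_mult)
  have int: "(\<lambda>z. Dir (\<lambda>z. g z * f z) z w) integrable_on slab m N" for w
    by (rule integrable_on_slab[of 0]) (use gf in simp)
  have "integral (slab m N) (\<lambda>z. 1/2 * (Dir (\<lambda>z. g z * f z) z v + s * Dir (\<lambda>z. g z * f z) z (\<i> *s v))) = 0"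
    using zero[OF v] zero[OF iv]
    by (simp only: integral_mult_right integral_add[OF int integrable_on_mult_right[OF int]])
      simp
  moreover have "1/2 * (Dir (\<lambda>z. g z * f z) z v + s * Dir (\<lambda>z. g z * f z) z (\<i> *s v)) =
      g z * dsg s f z v + dsg s g z v * f z" if "z \<in> slab m N" for z
  proof -
    have z: "z \<in> - {0}" using that slab_subset by blast
    have "Dir (\<lambda>z. g z * f z) z = (\<lambda>w. g z * Dir f z w + Dir g z w * f z)"
      by (rule frechet_derivative_eq, rule has_derivative_mult)
        (use f g z Ck_on_derivative[of 0] in auto)
    then show ?thesis by (simp add: dsg_def field_simps)
  qed
  ultimately have "integral (slab m N) (\<lambda>z. g z * dsg s f z v + dsg s g z v * f z) = 0"
    using integral_cong[of "slab m N"] by (metis (no_types, lifting))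
  moreover have "(\<lambda>z. g z * dsg s f z v) integrable_on slab m N" "(\<lambda>z. dsg s g z v * f z) integrable_on slab m N"
    using f g by (auto intro!: integrable_on_slab[of 0] Ck_on_mult Ck_on_dsg open_punctured
        intro: Ck_on_SucD simp del: Ck_on.simps)
  ultimately show ?thesis by (simp add: integral_add eq_neg_iff_add_eq_0)
qed

lemma dsg_zero_outside:
  fixes g :: "complex^'n::finite \<Rightarrow> complex"
  assumes "\<And>z. L \<le> norm z \<Longrightarrow> g z = 0" "L < norm z"
  shows "dsg s g z v = 0"
proof -
  have "open {z :: complex^'n. L < norm z}"
    by (simp add: open_Collect_less continuous_on_norm_id)
  then have "Dir g z = Dir (\<lambda>_. 0) z"
    by (rule frechet_derivative_cong_open) (use assms in auto)
  then show ?thesis by (simp add: dsg_def frechet_derivative_const)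
qed

lemma integral_double_sum:
  fixes f :: "'i \<Rightarrow> 'j \<Rightarrow> 'a::euclidean_space \<Rightarrow> complex"
  assumes "finite A" "finite B" "\<And>i l. f i l integrable_on S"
  shows "integral S (\<lambda>z. \<Sum>i\<in>A. \<Sum>l\<in>B. c i l * f i l z) = (\<Sum>i\<in>A. \<Sum>l\<in>B. c i l * integral S (f i l))"
  by (intro integral_unique has_integral_sum has_integral_mult_right integrable_integral assms)

text \<open>The equation, expanded as a double sum of second derivatives, is multiplied by
  \<open>g\<close> and integrated by parts twice in every term; the two signs cancel. All directions
  of differentiation are tangent to the hyperplanes on which the coordinate \<open>m\<close> is
  constant.\<close>

lemma integral_pairing_zero:
  fixes \<beta> :: "'n::finite form"
  assumes \<beta>: "\<And>w. Ck_on 2 (- {0}) (\<lambda>z. \<beta> z w)"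
    and closed: "\<And>z. z \<noteq> 0 \<Longrightarrow> dform (- \<i>) (Suc K) (dform \<i> K \<beta>) z v = 0"
    and v: "\<And>i. i < Suc (Suc K) \<Longrightarrow> v i $ m = 0 \<and> norm (v i) \<le> 1"
    and g: "Ck_on 2 (- {0}) g" and L: "\<And>z. L \<le> norm z \<Longrightarrow> g z = 0" "L + 2 \<le> N"
  shows "integral (slab m N)
    (\<lambda>z. pair2 (\<lambda>x y. dsg \<i> (\<lambda>w. dsg (- \<i>) g w x) z y) (\<beta> z) K v) = 0"
proof -
  let ?a = "\<lambda>i l y. \<beta> y (v \<circ> skip i \<circ> skip l)"
  let ?I = "integral (slab m N)"
  have b1: "Ck_on 1 (- {0}) (\<lambda>y. dsg \<i> (\<lambda>z. \<beta> z w) y u)" for w u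
    by (rule Ck_on_dsg[OF open_punctured]) (use \<beta> in \<open>simp add: numeral_2_eq_2\<close>)
  have g1: "Ck_on 1 (- {0}) (\<lambda>y. dsg (- \<i>) g y u)" for u
    by (rule Ck_on_dsg[OF open_punctured]) (use g in \<open>simp add: numeral_2_eq_2\<close>)
  have \<beta>1: "Ck_on 1 (- {0}) (\<lambda>z. \<beta> z w)" for w by (rule Ck_on_mono[OF \<beta>]) simp
  have g1': "Ck_on 1 (- {0}) g" by (rule Ck_on_mono[OF g]) simp
  have c1: "Ck_on 0 (- {0}) (\<lambda>z. g z * dsg (- \<i>) (\<lambda>y. dsg \<i> (?a i l) y u) z x)" for i l u x
    by (rule Ck_on_mult[OF open_punctured Ck_on_mono[OF g1'] Ck_on_dsg[OF open_punctured b1[unfolded One_nat_def]]]) simp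
  have c2: "Ck_on 0 (- {0}) (\<lambda>z. dsg \<i> (\<lambda>w. dsg (- \<i>) g w x) z u * ?a i l z)" for i l u x
    by (rule Ck_on_mult[OF open_punctured Ck_on_dsg[OF open_punctured g1[unfolded One_nat_def]] Ck_on_mono[OF \<beta>1]]) simp
  have parts: "?I (\<lambda>z. g z * dsg (- \<i>) (\<lambda>y. dsg \<i> (?a i l) y (v (skip i l))) z (v i)) =
      ?I (\<lambda>z. dsg \<i> (\<lambda>w. dsg (- \<i>) g w (v i)) z (v (skip i l)) * ?a i l z)"
    if "i \<le> Suc K" "l \<le> K" for i l
  proof -
    have vi: "v i $ m = 0" "norm (v i) \<le> 1" "v (skip i l) $ m = 0" "norm (v (skip i l)) \<le> 1"
      using v[of i] v[of "skip i l"] skip_less[of l "Suc K" i] that by auto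
    have "?I (\<lambda>z. g z * dsg (- \<i>) (\<lambda>y. dsg \<i> (?a i l) y (v (skip i l))) z (v i)) =
        - ?I (\<lambda>z. dsg (- \<i>) g z (v i) * dsg \<i> (?a i l) z (v (skip i l)))"
      by (rule integral_slab_parts[OF b1 g1' vi(1,2) L(1)]) (use L(2) in auto)
    \<comment> \<open>The radius becomes \<open>L + 1\<close> because the derivative of
      \<open>g\<close> is known to vanish only where the norm strictly exceeds \<open>L\<close>; the
      \<open>+ 2\<close> in the hypothesis on \<open>N\<close> pays for this.\<close>
    also have "?I (\<lambda>z. dsg (- \<i>) g z (v i) * dsg \<i> (?a i l) z (v (skip i l))) =
        - ?I (\<lambda>z. dsg \<i> (\<lambda>w. dsg (- \<i>) g w (v i)) z (v (skip i l)) * ?a i l z)"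
      by (rule integral_slab_parts[OF \<beta>1 g1 vi(3,4), of "L + 1"])
        (use L dsg_zero_outside[of L g] in auto)
    finally show ?thesis by (simp only: minus_minus)
  qed
  have "0 = ?I (\<lambda>z. 0)" by simp
  also have "\<dots> = ?I (\<lambda>z. \<Sum>i\<le>Suc K. \<Sum>l\<le>K. (-1) ^ (i + l) *
      (g z * dsg (- \<i>) (\<lambda>y. dsg \<i> (?a i l) y (v (skip i l))) z (v i)))"
  proof (rule integral_cong)
    fix z assume "z \<in> slab m N"
    then have z: "z \<in> - {0}" using slab_subset by blast
    have "0 = g z * dform (- \<i>) (Suc K) (dform \<i> K \<beta>) z v" using closed z by simp
    also have "\<dots> = (\<Sum>i\<le>Suc K. \<Sum>l\<le>K. (-1) ^ (i + l) *
      (g z * dsg (- \<i>) (\<lambda>y. dsg \<i> (?a i l) y (v (skip i l))) z (v i)))"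
      unfolding dform_dform_expand[OF open_punctured z \<beta>] sum_distrib_left
      by (simp only: mult.left_commute)
    finally show "0 = (\<Sum>i\<le>Suc K. \<Sum>l\<le>K. (-1) ^ (i + l) *
      (g z * dsg (- \<i>) (\<lambda>y. dsg \<i> (?a i l) y (v (skip i l))) z (v i)))" .
  qed
  also have "\<dots> = (\<Sum>i\<le>Suc K. \<Sum>l\<le>K. (-1) ^ (i + l) *
      ?I (\<lambda>z. g z * dsg (- \<i>) (\<lambda>y. dsg \<i> (?a i l) y (v (skip i l))) z (v i)))"
    by (intro integral_double_sum integrable_on_slab[OF c1]) auto
  also have "\<dots> = (\<Sum>i\<le>Suc K. \<Sum>l\<le>K. (-1) ^ (i + l) *
      ?I (\<lambda>z. dsg \<i> (\<lambda>w. dsg (- \<i>) g w (v i)) z (v (skip i l)) * ?a i l z))"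
    by (intro sum.cong refl) (simp add: parts)
  also have "\<dots> = ?I (\<lambda>z. \<Sum>i\<le>Suc K. \<Sum>l\<le>K. (-1) ^ (i + l) *
      (dsg \<i> (\<lambda>w. dsg (- \<i>) g w (v i)) z (v (skip i l)) * ?a i l z))"
    by (intro integral_double_sum[symmetric] integrable_on_slab[OF c2]) auto
  finally show ?thesis by (simp add: pair2_expand)
qed

section \<open>The test function\<close>

lemma Ck_on_ident: "open S \<Longrightarrow> Ck_on k S (\<lambda>x. x)"
proof (induction k)
  case (Suc k)
  show ?case by (rule Ck_on_Suc_I[OF Suc.prems has_derivative_ident Ck_on_const])
qed simp

text \<open>Only the point 0 needs an argument: the difference quotient there is at most
  \<open>\<bar>y\<bar> ^ Suc n\<close>, which tends to 0.\<close>

lemma has_real_derivative_pos_part_power: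
  "((\<lambda>x::real. max 0 x ^ Suc (Suc n)) has_real_derivative real (Suc (Suc n)) * max 0 x ^ Suc n) (at x)"
proof (cases x "0::real" rule: linorder_cases)
  case less
  have "((\<lambda>x::real. 0) has_real_derivative real (Suc (Suc n)) * max 0 x ^ Suc n) (at x)"
    using less by simp
  then show ?thesis
    by (rule has_field_derivative_transform_within_open[where S = "{..<0}"]) (use less in auto)
next
  case equal
  have "((\<lambda>y::real. max 0 y ^ Suc (Suc n) / y) \<longlongrightarrow> 0) (at 0)"
  proof (rule Lim_null_comparison)
    have "norm (max 0 y ^ Suc (Suc n) / y) \<le> \<bar>y\<bar> ^ Suc n" for y :: real
    proof (cases "y > 0")
      case False
      then have "max 0 y = 0" by simp
      then show ?thesis by (simp only: power_0_Suc div_0 norm_zero zero_le_power_abs)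
    qed simp
    then show "\<forall>\<^sub>F y in at 0. norm (max 0 y ^ Suc (Suc n) / y) \<le> \<bar>y\<bar> ^ Suc n"
      by simp
    show "((\<lambda>y::real. \<bar>y\<bar> ^ Suc n) \<longlongrightarrow> 0) (at 0)"
      by (rule tendsto_eq_intros tendsto_rabs_zero refl | simp)+
  qed
  then show ?thesis using equal by (simp add: has_field_derivative_iff)
next
  case greater
  have "((\<lambda>x::real. x ^ Suc (Suc n)) has_real_derivative real (Suc (Suc n)) * max 0 x ^ Suc n) (at x)"
    using DERIV_pow[of "Suc (Suc n)" x] greater by (simp add: max_def)
  then show ?thesis
    by (rule has_field_derivative_transform_within_open[where S = "{0<..}"]) (use greater in auto)
qed

lemma Ck_on_pos_part_power: "Ck_on n UNIV (\<lambda>x::real. max 0 x ^ Suc n)"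
proof (induction n)
  case 0
  show ?case by (auto intro!: continuous_intros)
next
  case (Suc n)
  show ?case
    by (rule Ck_on_Suc_I[OF open_UNIV has_real_derivative_pos_part_power[unfolded has_field_derivative_def]])
      (intro Ck_on_mult Ck_on_const Suc open_UNIV)
qed

lemma Ck_on_inverse: "Ck_on k {0<..} (inverse :: real \<Rightarrow> real)"
proof (induction k)
  case 0
  show ?case by (auto intro!: continuous_intros)
next
  case (Suc k)
  show ?case
  proof (rule Ck_on_Suc_I)
    show "((inverse :: real \<Rightarrow> real) has_derivative (\<lambda>h. (- 1) * (inverse x * h * inverse x))) (at x)"
      if "x \<in> {0<..}" for x
      using has_derivative_inverse'[of x] that by simp
    show "Ck_on k {0<..} (\<lambda>x::real. (- 1) * (inverse x * u * inverse x))" for u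
      by (intro Ck_on_mult Ck_on_const Suc) auto
  qed simp
qed

lemma Ck_on_ln: "Ck_on k {0<..} (ln :: real \<Rightarrow> real)"
proof (cases k)
  case 0
  then show ?thesis by (auto intro!: continuous_intros)
next
  case (Suc k)
  have "Ck_on (Suc k) {0<..} (ln :: real \<Rightarrow> real)"
  proof (rule Ck_on_Suc_I)
    show "((ln :: real \<Rightarrow> real) has_derivative (\<lambda>h. inverse x * h)) (at x)" if "x \<in> {0<..}" for x
      using DERIV_ln[of x] that by (simp add: has_field_derivative_def)
    show "Ck_on k {0<..} (\<lambda>x::real. inverse x * u)" for u
      by (intro Ck_on_mult Ck_on_const Ck_on_inverse) auto
  qed simp
  then show ?thesis using Suc by simp
qed

definition depth :: "real \<Rightarrow> complex^'n::finite \<Rightarrow> real" where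
  "depth T z = max 0 (T - ln ((norm z)\<^sup>2))"

lemma Ck_on_norm_sq: "open S \<Longrightarrow> Ck_on k S (\<lambda>z :: 'a::euclidean_space. (norm z)\<^sup>2)"
  unfolding power2_norm_eq_inner
  by (intro Ck_on_bilinear[OF _ bounded_bilinear_inner] Ck_on_ident)

lemma Ck_on_test: "Ck_on 2 (- {0}) (\<lambda>z :: complex^'n::finite. complex_of_real (depth T z ^ 3))"
proof -
  have "Ck_on 2 (- {0}) (\<lambda>z :: complex^'n. T + (-1) * ln ((norm z)\<^sup>2))"
    by (intro Ck_on_add Ck_on_mult Ck_on_const open_punctured
        Ck_on_compose[OF open_punctured Ck_on_ln Ck_on_norm_sq]) auto
  then have "Ck_on 2 (- {0}) (\<lambda>z :: complex^'n. max 0 (T + (-1) * ln ((norm z)\<^sup>2)) ^ Suc 2)"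
    by (rule Ck_on_compose[OF open_punctured Ck_on_pos_part_power]) auto
  then have "Ck_on 2 (- {0}) (\<lambda>z :: complex^'n. complex_of_real (max 0 (T + (-1) * ln ((norm z)\<^sup>2)) ^ Suc 2))"
    by (rule Ck_on_linear[OF open_punctured bounded_linear_of_real])
  then show ?thesis by (simp add: depth_def numeral_3_eq_3)
qed

section \<open>Levi forms of radial functions\<close>

lemma inner_eq_ip: "x \<bullet> y = Re (ip x y)"
  by (simp add: inner_vec_def ip_def inner_complex_def)

lemma has_derivative_norm_sq:
  "((\<lambda>z :: complex^'n::finite. (norm z)\<^sup>2) has_derivative (\<lambda>v. 2 * Re (ip v z))) (at z)"
proof -
  have "((\<lambda>z :: complex^'n. z \<bullet> z) has_derivative (\<lambda>v. z \<bullet> v + v \<bullet> z)) (at z)"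
    by (intro has_derivative_inner has_derivative_ident)
  then show ?thesis
    by (simp add: power2_norm_eq_inner inner_commute inner_eq_ip[symmetric])
qed

lemma has_derivative_radial:
  fixes z :: "complex^'n::finite"
  assumes "(P has_real_derivative p) (at ((norm z)\<^sup>2))"
  shows "((\<lambda>z. complex_of_real (P ((norm z)\<^sup>2))) has_derivative (\<lambda>v. of_real (p * (2 * Re (ip v z))))) (at z)"
  by (rule bounded_linear.has_derivative[OF bounded_linear_of_real])
    (rule has_derivative_compose[OF has_derivative_norm_sq assms[unfolded has_field_derivative_def]])

lemma has_real_derivative_depth_profile:
  assumes "u > (0::real)"
  shows "((\<lambda>u. max 0 (T - ln u) ^ 3) has_real_derivative - 3 * max 0 (T - ln u) ^ 2 / u) (at u)"
    "((\<lambda>u. - 3 * max 0 (T - ln u) ^ 2 / u) has_real_derivative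
      (6 * max 0 (T - ln u) + 3 * max 0 (T - ln u) ^ 2) / u\<^sup>2) (at u)"
proof -
  have d: "((\<lambda>u. T - ln u) has_real_derivative - (1 / u)) (at u)"
    using assms by (auto intro!: derivative_eq_intros)
  show "((\<lambda>u. max 0 (T - ln u) ^ 3) has_real_derivative - 3 * max 0 (T - ln u) ^ 2 / u) (at u)"
    using DERIV_chain2[OF has_real_derivative_pos_part_power[of 1] d] by (simp add: numeral_eq_Suc)
  have "((\<lambda>u. max 0 (T - ln u) ^ 2) has_real_derivative - 2 * max 0 (T - ln u) / u) (at u)"
    using DERIV_chain2[OF has_real_derivative_pos_part_power[of 0] d] by (simp add: numeral_eq_Suc)
  then show "((\<lambda>u. - 3 * max 0 (T - ln u) ^ 2 / u) has_real_derivative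
      (6 * max 0 (T - ln u) + 3 * max 0 (T - ln u) ^ 2) / u\<^sup>2) (at u)"
    by (rule DERIV_cong[OF DERIV_divide[OF DERIV_cmult DERIV_ident]])
      (use assms in \<open>simp_all add: field_simps power2_eq_square\<close>)
qed

text \<open>For a function \<open>P(u)\<close> of \<open>u = |z|^2\<close> the Levi form is
  \<open>P'(u) <x, y> + P''(u) <x, z> <z, y>\<close>. As \<open><x, y> / u\<close> is
  \<open>qA + qB\<close>, the \<open>qB\<close> part of the first term cancels the quadratic part of
  the second, and only a term linear in the depth remains in front of \<open>qB\<close>.\<close>

lemma Levi_form_test:
  fixes z :: "complex^'n::finite"
  assumes z: "z \<noteq> 0"
  shows "dsg \<i> (\<lambda>w. dsg (- \<i>) (\<lambda>z. complex_of_real (depth T z ^ 3)) w x) z y =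
    of_real (6 * depth T z) * qB z x y + of_real (- 3 * (depth T z)\<^sup>2) * qA z x y"
proof -
  define p where "p u = - 3 * max 0 (T - ln u) ^ 2 / u" for u
  define p' where "p' = (6 * depth T z + 3 * (depth T z)\<^sup>2) / ((norm z)\<^sup>2)\<^sup>2"
  have 1: "dsg (- \<i>) (\<lambda>z. complex_of_real (depth T z ^ 3)) w x = of_real (p ((norm w)\<^sup>2)) * ip x w"
    if "w \<in> - {0}" for w
  proof -
    have "(norm w)\<^sup>2 > 0" using that by simp
    from frechet_derivative_eq[OF has_derivative_radial[OF has_real_derivative_depth_profile(1)[OF this]]]
    have "Dir (\<lambda>z. complex_of_real (depth T z ^ 3)) w = (\<lambda>v. of_real (p ((norm w)\<^sup>2) * (2 * Re (ip v w))))"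
      by (simp add: depth_def p_def)
    then show ?thesis
      by (simp add: dsg_def ip_simps complex_eq_iff algebra_simps)
  qed
  have u: "(norm z)\<^sup>2 > 0" using z by simp
  have "((\<lambda>w. complex_of_real (p ((norm w)\<^sup>2))) has_derivative (\<lambda>v. of_real (p' * (2 * Re (ip v z))))) (at z)"
    using has_derivative_radial[OF has_real_derivative_depth_profile(2)[OF u]]
    by (simp add: p_def p'_def depth_def)
  moreover have "((\<lambda>w. ip x w) has_derivative (\<lambda>v. ip x v)) (at z)"
  proof (rule bounded_linear_imp_has_derivative)
    have "linear (\<lambda>v. ip x v)"
      by (auto simp: linear_iff ip_simps scaleR_eq_vector_mult scaleR_conv_of_real)
    then show "bounded_linear (\<lambda>v. ip x v)" by (simp add: linear_conv_bounded_linear)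
  qed
  ultimately have "((\<lambda>w. of_real (p ((norm w)\<^sup>2)) * ip x w) has_derivative
      (\<lambda>v. of_real (p ((norm z)\<^sup>2)) * ip x v + of_real (p' * (2 * Re (ip v z))) * ip x z)) (at z)"
    by (rule has_derivative_mult)
  from frechet_derivative_eq[OF this]
  have "dsg \<i> (\<lambda>w. of_real (p ((norm w)\<^sup>2)) * ip x w) z y =
      of_real (p ((norm z)\<^sup>2)) * ip x y + of_real p' * cnj (ip y z) * ip x z"
    by (simp add: dsg_def ip_simps complex_eq_iff field_simps)
  also have "\<dots> = of_real (6 * depth T z) * qB z x y + of_real (- 3 * (depth T z)\<^sup>2) * qA z x y"
    using z by (simp add: p_def p'_def qA_def qB_def depth_def field_simps power2_eq_square)
  finally show ?thesis
    using dsg_cong_open[OF open_punctured _ 1, of z] z by simp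
qed

lemma depth_eq_0: "exp (T / 2) \<le> norm z \<Longrightarrow> depth T z = 0"
proof -
  assume "exp (T / 2) \<le> norm z"
  then have "exp (T / 2) ^ 2 \<le> (norm z)\<^sup>2" by (intro power_mono) auto
  moreover have "exp (T / 2) ^ 2 = exp T" by (simp add: exp_double[symmetric])
  ultimately have "exp T \<le> (norm z)\<^sup>2" by simp
  then have "T \<le> ln ((norm z)\<^sup>2)"
    by (subst ln_ge_iff) (auto intro: less_le_trans[OF exp_gt_zero])
  then show ?thesis by (simp add: depth_def)
qed

lemma pair2_combination:
  "pair2 (\<lambda>x y. c * q x y + d * q' x y) M K v = c * pair2 q M K v + d * pair2 q' M K v"
  unfolding pair2_expand sum_distrib_left sum.distrib[symmetric]
  by (intro sum.cong refl) (simp add: algebra_simps)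

section \<open>The growth argument\<close>

lemma content_cbox_vec:
  fixes p r :: "complex^'n::finite"
  assumes "cbox p r \<noteq> {}"
  shows "measure lborel (cbox p r) = (\<Prod>j\<in>UNIV. (Re (r $ j) - Re (p $ j)) * (Im (r $ j) - Im (p $ j)))"
proof -
  let ?f = "\<lambda>(j, u). axis j u :: complex^'n"
  have bij: "bij_betw ?f (UNIV \<times> Basis) Basis"
    unfolding bij_betw_def
  proof
    show "inj_on ?f (UNIV \<times> Basis)"
      by (auto simp: inj_on_def axis_eq_axis)
    show "?f ` (UNIV \<times> Basis) = Basis"
      by (auto simp: Basis_vec_def image_iff)
  qed
  have "measure lborel (cbox p r) = (\<Prod>b\<in>Basis. r \<bullet> b - p \<bullet> b)"
    using content_cbox'[OF assms] by (simp add: inner_diff_left)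
  also have "\<dots> = (\<Prod>x\<in>UNIV \<times> Basis. r \<bullet> ?f x - p \<bullet> ?f x)"
    by (rule prod.reindex_bij_betw[OF bij, symmetric])
  also have "\<dots> = (\<Prod>j\<in>UNIV. \<Prod>u\<in>Basis. r \<bullet> axis j u - p \<bullet> axis j u)"
    by (subst prod.cartesian_product) (simp add: split_beta)
  also have "\<dots> = (\<Prod>j\<in>UNIV. (Re (r $ j) - Re (p $ j)) * (Im (r $ j) - Im (p $ j)))"
    by (simp add: Basis_complex_def inner_axis)
  finally show ?thesis .
qed

text \<open>The parameter square has area 1, so the volume is that of a box in the
  hyperplane.\<close>

lemma content_slab:
  fixes m :: "'n::finite"
  assumes "N \<ge> 0"
  shows "measure lborel (slab m N) = ((2 * N)\<^sup>2) ^ (CARD('n) - 1)"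
proof -
  have "(\<chi> j. if j = m then Complex 1 0 else Complex (-N) (-N)) \<in> slab m N"
    using assms by (simp add: mem_slab in_cbox_complex_iff)
  then have "slab m N \<noteq> {}" by blast
  then have "measure lborel (slab m N) = (\<Prod>j\<in>UNIV. if j = m then 1 else (2 * N)\<^sup>2)"
    unfolding slab_def
    by (subst content_cbox_vec) (auto intro!: prod.cong simp: power2_eq_square split: if_splits)
  also have "\<dots> = (\<Prod>j\<in>UNIV - {m}. (2 * N)\<^sup>2)"
    by (subst prod.remove[of _ m]) (auto intro!: prod.cong)
  also have "\<dots> = ((2 * N)\<^sup>2) ^ (CARD('n) - 1)" by (simp add: card_Diff_singleton)
  finally show ?thesis .
qed

text \<open>Since \<open>b z \<le> K * a z\<close>, the integrand is at least
  \<open>3 s (s - 2 K) a\<close> with \<open>s\<close> the depth, which is negative only for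
  \<open>0 < s < 2 K\<close>. There \<open>ln |z|^2\<close> exceeds \<open>T - 2 K\<close>, and the
  decay of \<open>a\<close> offsets the volume of the slab, while on the fixed box the integrand
  grows without bound.\<close>

lemma growth_contradiction:
  fixes a b :: "complex^'n::finite \<Rightarrow> real"
  assumes cont: "continuous_on (- {0}) a" "continuous_on (- {0}) b"
    and ab: "\<And>z. z \<noteq> 0 \<Longrightarrow> 0 < a z \<and> 0 \<le> b z \<and> b z \<le> K * a z \<and> a z * ((norm z)\<^sup>2) ^ (CARD('n) - 1) \<le> M"
    and K: "K > 0"
    and int: "\<And>T N. exp (T / 2) + 2 \<le> N \<Longrightarrow>
      integral (slab m N) (\<lambda>z. 3 * (depth T z)\<^sup>2 * a z - 6 * depth T z * b z) = 0"
  shows False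
proof -
  define d where "d = CARD('n) - 1"
  have comp: "compact (slab m 1)" by (simp add: slab_def)
  have "(\<chi> j. if j = m then Complex 1 0 else 0) \<in> slab m 1"
    by (simp add: mem_slab in_cbox_complex_iff)
  then have ne: "slab m 1 \<noteq> {}" by blast
  have sub: "slab m N \<subseteq> - {0}" for N by (rule slab_subset)
  obtain z0 where z0: "z0 \<in> slab m 1" "\<And>z. z \<in> slab m 1 \<Longrightarrow> a z0 \<le> a z"
    using continuous_attains_inf[OF comp ne continuous_on_subset[OF cont(1) sub]] by blast
  define \<epsilon> where "\<epsilon> = a z0"
  have "z0 \<noteq> 0" using z0(1) sub[of 1] by blast
  then have \<epsilon>: "\<epsilon> > 0" using ab unfolding \<epsilon>_def by blast
  have cl: "continuous_on (- {0}) (\<lambda>z :: complex^'n. ln ((norm z)\<^sup>2))"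
    by (intro continuous_intros) auto
  obtain z1 where z1: "z1 \<in> slab m 1" "\<And>z. z \<in> slab m 1 \<Longrightarrow> ln ((norm z)\<^sup>2) \<le> ln ((norm z1)\<^sup>2)"
    using continuous_attains_sup[OF comp ne continuous_on_subset[OF cl sub]] by blast
  define t0 where "t0 = ln ((norm z1)\<^sup>2)"
  have M: "M > 0"
  proof -
    have z1': "z1 \<noteq> 0" using z1(1) sub[of 1] by blast
    then have "0 < a z1 * ((norm z1)\<^sup>2) ^ d" using ab by (intro mult_pos_pos) auto
    then show ?thesis using ab[OF z1'] unfolding d_def by linarith
  qed
  \<comment> \<open>The volume bound \<open>(36 * exp T) ^ d\<close> of the slab times the bound
    \<open>\<Gamma>\<close> on the negative part; the exponentials of \<open>T\<close>
    cancel.\<close>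
  define W where "W = 3 * K\<^sup>2 * M * exp (2 * K * d) * 36 ^ d"
  have bound: "4 ^ d * (3 * (T - t0 - 2 * K) * \<epsilon>) \<le> W" if T: "T \<ge> t0 + 2 * K + 1" "T \<ge> 0" for T
  proof -
    define N where "N = exp (T / 2) + 2"
    define G where "G z = 3 * (depth T z)\<^sup>2 * a z - 6 * depth T z * b z" for z
    \<comment> \<open>The minimum of \<open>3 s (s - 2 K)\<close> is \<open>- 3 K^2\<close>,
      attained at \<open>s = K\<close>, and in the shell \<open>a\<close> is at most
      \<open>M * exp (- (d * (T - 2 * K)))\<close>.\<close>
    define \<Gamma> where "\<Gamma> = 3 * K\<^sup>2 * (M * exp (- (real d * (T - 2 * K))))"
    have \<Gamma>: "\<Gamma> \<ge> 0" using M by (simp add: \<Gamma>_def)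
    have s0: "depth T z \<ge> 0" for z :: "complex^'n" by (simp add: depth_def)
    have G1: "G z \<ge> 3 * depth T z * (depth T z - 2 * K) * a z" if "z \<noteq> 0" for z
    proof -
      have "6 * depth T z * b z \<le> 6 * depth T z * (K * a z)"
        using ab[OF that] s0[of z] by (intro mult_left_mono) auto
      then show ?thesis by (simp add: G_def power2_eq_square algebra_simps)
    qed
    have G2: "- \<Gamma> \<le> G z" if z: "z \<noteq> 0" for z
    proof -
      have az: "a z > 0" using ab[OF z] by blast
      consider "depth T z = 0" | "depth T z \<ge> 2 * K" | "0 < depth T z" "depth T z < 2 * K"
        using s0[of z] by linarith
      then show ?thesis
      proof cases
        case 1
        then show ?thesis using \<Gamma> by (simp add: G_def)
      next
        case 2
        then have "0 \<le> 3 * depth T z * (depth T z - 2 * K) * a z" using s0[of z] az by simp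
        then show ?thesis using G1[OF z] \<Gamma> by linarith
      next
        case 3
        then have "T - 2 * K < ln ((norm z)\<^sup>2)" by (auto simp: depth_def max_def split: if_splits)
        then have "exp (T - 2 * K) \<le> (norm z)\<^sup>2"
          using z by (simp add: ln_ge_iff[symmetric])
        then have "exp (T - 2 * K) ^ d \<le> ((norm z)\<^sup>2) ^ d" by (intro power_mono) auto
        then have "a z * exp (T - 2 * K) ^ d \<le> a z * ((norm z)\<^sup>2) ^ d"
          using az by (intro mult_left_mono) auto
        also have "\<dots> \<le> M" using ab[OF z] by (simp add: d_def)
        finally have "a z * exp (real d * (T - 2 * K)) \<le> M"
          by (simp add: exp_of_nat_mult)
        then have "a z \<le> M * exp (- (real d * (T - 2 * K)))"
          unfolding exp_minus divide_inverse[symmetric] by (simp only: pos_le_divide_eq exp_gt_zero)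
        then have "3 * K\<^sup>2 * a z \<le> \<Gamma>"
          unfolding \<Gamma>_def by (intro mult_left_mono) auto
        moreover have "- (3 * K\<^sup>2) * a z \<le> 3 * depth T z * (depth T z - 2 * K) * a z"
        proof (rule mult_right_mono)
          have "0 \<le> 3 * (depth T z - K)\<^sup>2" by simp
          then show "- (3 * K\<^sup>2) \<le> 3 * depth T z * (depth T z - 2 * K)"
            by (simp add: power2_eq_square algebra_simps)
        qed (use az in simp)
        ultimately show ?thesis using G1[OF z] by linarith
      qed
    qed
    have G3: "3 * (T - t0 - 2 * K) * \<epsilon> \<le> G z" if z: "z \<in> slab m 1" for z
    proof -
      have z': "z \<noteq> 0" using z sub[of 1] by auto
      have s: "T - t0 \<le> depth T z" using z1(2)[OF z] by (simp add: depth_def t0_def)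
      have "3 * (T - t0 - 2 * K) \<le> 3 * (depth T z * (depth T z - 2 * K))"
      proof -
        \<comment> \<open>The lower bound on \<open>T\<close> makes the depth at least 1 on the
          fixed box, so one factor may be replaced by 1.\<close>
        have "1 * (T - t0 - 2 * K) \<le> depth T z * (depth T z - 2 * K)"
          using s T K by (intro mult_mono) auto
        then show ?thesis by simp
      qed
      then have "3 * (T - t0 - 2 * K) * \<epsilon> \<le> 3 * (depth T z * (depth T z - 2 * K)) * a z"
        using z0(2)[OF z] \<epsilon> T K by (intro mult_mono) (auto simp: \<epsilon>_def)
      also have "\<dots> \<le> G z" using G1[OF z'] by (simp add: mult.assoc)
      finally show ?thesis .
    qed
    have cG: "continuous_on (- {0}) (\<lambda>z. G z + \<Gamma>)"
      unfolding G_def depth_def by (intro continuous_intros cont) auto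
    have iG: "(\<lambda>z. G z + \<Gamma>) integrable_on slab m N'" "G integrable_on slab m N'" for N'
    proof -
      show "(\<lambda>z. G z + \<Gamma>) integrable_on slab m N'"
        using integrable_continuous continuous_on_subset[OF cG sub[of N']] unfolding slab_def by blast
      then have "(\<lambda>z. (G z + \<Gamma>) - \<Gamma>) integrable_on slab m N'"
        by (rule integrable_diff) (simp add: slab_def integrable_on_const)
      then show "G integrable_on slab m N'" by simp
    qed
    have N: "N \<ge> 1" "N \<ge> 0" by (auto simp: N_def add_increasing)
    have Q: "slab m 1 \<subseteq> slab m N"
      using N by (auto simp: mem_slab in_cbox_complex_iff; smt (verit))
    have "4 ^ d * (3 * (T - t0 - 2 * K) * \<epsilon>) = integral (slab m 1) (\<lambda>z. 3 * (T - t0 - 2 * K) * \<epsilon>)"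
      using content_slab[of 1 m] by (simp add: slab_def d_def)
    \<comment> \<open>Adding \<open>\<Gamma>\<close> makes the integrand nonnegative, which allows
      enlarging the domain to the slab on which the integral of \<open>G\<close> is known to
      vanish.\<close>
    also have "\<dots> \<le> integral (slab m 1) (\<lambda>z. G z + \<Gamma>)"
      by (rule integral_le[OF _ iG(1)]) (use G3 \<Gamma> in \<open>auto simp: slab_def integrable_on_const intro: add_increasing2\<close>)
    also have "\<dots> \<le> integral (slab m N) (\<lambda>z. G z + \<Gamma>)"
    proof (rule integral_subset_le[OF Q iG(1) iG(1)], rule ballI)
      fix z assume "z \<in> slab m N"
      then have "z \<noteq> 0" using sub[of N] by blast
      then show "0 \<le> G z + \<Gamma>" using G2[of z] by simp
    qed
    also have "\<dots> = integral (slab m N) G + integral (slab m N) (\<lambda>z. \<Gamma>)"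
      by (rule integral_add[OF iG(2)]) (simp add: slab_def integrable_on_const)
    also have "integral (slab m N) G = 0"
      unfolding G_def by (rule int) (simp add: N_def)
    also have "integral (slab m N) (\<lambda>z. \<Gamma>) = ((2 * N)\<^sup>2) ^ d * \<Gamma>"
      using content_slab[OF N(2), of m] by (simp add: slab_def d_def)
    also have "((2 * N)\<^sup>2) ^ d * \<Gamma> \<le> (36 * exp T) ^ d * \<Gamma>"
    proof (intro mult_right_mono power_mono \<Gamma>)
      have "1 \<le> exp (T / 2)" using T by simp
      \<comment> \<open>For \<open>T \<ge> 0\<close> the summand 2 in \<open>N\<close> is at most
        \<open>2 * exp (T / 2)\<close>; squaring the 6 gives the constant 36.\<close>
      then have "2 * N \<le> 6 * exp (T / 2)" by (simp add: N_def)
      then have "(2 * N)\<^sup>2 \<le> (6 * exp (T / 2))\<^sup>2" using N by (intro power_mono) auto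
      also have "\<dots> = 36 * exp T" by (simp add: power_mult_distrib exp_double[symmetric])
      finally show "(2 * N)\<^sup>2 \<le> 36 * exp T" .
    qed simp
    also have "\<dots> = W"
    proof -
      have "exp T ^ d * exp (- (real d * (T - 2 * K))) = exp (2 * K * d)"
        by (simp add: exp_of_nat_mult[symmetric] exp_add[symmetric] algebra_simps)
      then show ?thesis by (simp add: W_def \<Gamma>_def power_mult_distrib algebra_simps)
    qed
    finally show ?thesis by simp
  qed
  \<comment> \<open>The bracket is the value of \<open>T - t0 - 2 * K\<close>. Its last summand
    reproduces \<open>\<bar>W\<bar>\<close> after multiplication by \<open>3 * \<epsilon>\<close>;
    the first two make \<open>T\<close> admissible and the final inequality strict.\<close>
  define T where "T = t0 + 2 * K + (\<bar>t0\<bar> + 1 + \<bar>W\<bar> / (3 * \<epsilon>))"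
  have "\<bar>W\<bar> / (3 * \<epsilon>) \<ge> 0" using \<epsilon> by simp
  then have "T \<ge> t0 + 2 * K + 1" "T \<ge> 0" using K by (auto simp: T_def)
  from bound[OF this] have 1: "4 ^ d * (3 * (\<bar>t0\<bar> + 1 + \<bar>W\<bar> / (3 * \<epsilon>)) * \<epsilon>) \<le> W"
    by (simp add: T_def add.assoc)
  define Y where "Y = 3 * (\<bar>t0\<bar> + 1) * \<epsilon>"
  have Y: "Y > 0" using \<epsilon> by (simp add: Y_def)
  have 2: "3 * (\<bar>t0\<bar> + 1 + \<bar>W\<bar> / (3 * \<epsilon>)) * \<epsilon> = Y + \<bar>W\<bar>"
    using \<epsilon> by (simp add: Y_def field_simps)
  have "1 * (Y + \<bar>W\<bar>) \<le> 4 ^ d * (Y + \<bar>W\<bar>)"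
    using Y by (intro mult_right_mono) auto
  also have "\<dots> \<le> W" using 1 unfolding 2 .
  finally show False using Y by simp
qed

lemma no_astheno_kaehler_comparable:
  fixes h :: "complex^'n::finite \<Rightarrow> complex^'n \<Rightarrow> complex^'n \<Rightarrow> complex"
  assumes n: "CARD('n) \<ge> 3" and k: "k = CARD('n) - 2"
    and h: "\<And>z. z \<noteq> 0 \<Longrightarrow> hermitian_inner (h z)"
    and smooth: "\<And>u w. Ck_on 2 (- {0}) (\<lambda>z. h z u w)"
    and c: "c > 0"
    and hc: "\<And>z v. z \<noteq> 0 \<Longrightarrow> c * (norm v)\<^sup>2 \<le> (norm z)\<^sup>2 * Re (h z v v)"
    and hC: "\<And>z v. z \<noteq> 0 \<Longrightarrow> (norm z)\<^sup>2 * Re (h z v v) \<le> C * (norm v)\<^sup>2"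
    and closed: "\<And>z v. z \<noteq> 0 \<Longrightarrow> dform (- \<i>) (Suc (2 * k)) (dform \<i> (2 * k) (\<lambda>z. pw (h z) k)) z v = 0"
  shows False
proof -
  obtain m :: 'n where True by blast
  have card: "card (UNIV - {m}) = Suc k" "CARD('n) - 1 = Suc k" using n k by (simp_all add: card_Diff_singleton)
  \<comment> \<open>\<open>s\<close> enumerates the coordinates other than the parameter
    \<open>m\<close>, so the frame \<open>e\<close> spans the tangent space of the
    hyperplanes.\<close>
  then obtain s where s: "bij_betw s {0..<Suc k} (UNIV - {m})"
    using ex_bij_betw_nat_finite[of "UNIV - {m}"] by auto
  then have s_inj: "inj_on s {..<Suc k}"
    unfolding lessThan_atLeast0 by (rule bij_betw_imp_inj_on)
  have sm: "s j \<noteq> m" if "j < Suc k" for j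
    using bij_betwE[OF s] that by auto
  define e :: "nat \<Rightarrow> complex^'n" where "e j = axis (s j) 1" for j
  define v where "v = realify e"
  have v: "v i $ m = 0 \<and> norm (v i) \<le> 1" if "i < Suc (Suc (2 * k))" for i
  proof -
    have "i div 2 < Suc k" using that by auto
    then have "e (i div 2) $ m = 0" using sm[of "i div 2"] by (simp add: e_def axis_def)
    moreover have "norm (e (i div 2)) = 1" by (simp add: e_def norm_axis_complex)
    ultimately show ?thesis by (simp add: v_def realify_def norm_complex_vector_mult)
  qed
  define A where "A z = pair2 (qA z) (pw (h z) k) (2 * k) v" for z
  define B where "B z = pair2 (qB z) (pw (h z) k) (2 * k) v" for z
  \<comment> \<open>The densities are defined by explicit formulas instead of being chosen pointwise
    from \<open>hessian_pairing\<close>, so that their continuity in \<open>z\<close> can be read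
    off.\<close>
  define a where "a z = Re (A z / (- 2 * \<i> * fact k))" for z
  define b where "b z = Re (B z / (- 2 * \<i> * fact k))" for z
  define K where "K = 2 * C * real (Suc k) / c"
  define M where "M = C ^ Suc k * real (Suc k) / c"
  have nz: "- 2 * \<i> * fact k \<noteq> (0 :: complex)" by simp
  have main: "A z = - 2 * \<i> * fact k * of_real (a z) \<and> B z = - 2 * \<i> * fact k * of_real (b z) \<and>
      0 < a z \<and> 0 \<le> b z \<and> b z \<le> K * a z \<and> a z * ((norm z)\<^sup>2) ^ Suc k \<le> M" if z: "z \<noteq> 0" for z
  proof -
    have k1: "1 \<le> k" using n k by simp
    obtain x y where xy: "A z = - 2 * \<i> * fact k * of_real x" "B z = - 2 * \<i> * fact k * of_real y"
      "0 < x" "0 \<le> y" "y \<le> K * x" "x * ((norm z)\<^sup>2) ^ Suc k \<le> M"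
      using hessian_pairing[OF h[OF z] z c hc[OF z] hC[OF z] s_inj e_def k1]
      unfolding A_def B_def v_def K_def M_def by metis
    have "a z = x" "b z = y" using nz by (simp_all add: a_def b_def xy)
    then show ?thesis using xy by simp
  qed
  have pwc: "continuous_on (- {0}) (\<lambda>z. pw (h z) k w)" for w
    using Ck_on_mono[OF Ck_on_pw[OF open_punctured smooth], of 0] by simp
  have ipc: "continuous_on X (\<lambda>z. ip x z)" for X and x :: "complex^'n"
    unfolding ip_def by (intro continuous_intros)
  have qBc: "continuous_on (- {0}) (\<lambda>z. qB z x y)" for x y :: "complex^'n"
    unfolding qB_def by (intro continuous_intros ipc) auto
  have qAc: "continuous_on (- {0}) (\<lambda>z. qA z x y)" for x y :: "complex^'n"
    unfolding qA_def by (intro continuous_intros qBc) auto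
  have cont: "continuous_on (- {0}) a" "continuous_on (- {0}) b"
    unfolding a_def b_def A_def B_def pair2_expand
    by (intro continuous_intros pwc qAc qBc; use nz in simp)+
  have K: "K > 0"
  proof -
    have "e 0 \<noteq> 0" by (simp add: e_def axis_eq_0_iff)
    then have "c * (norm (e 0))\<^sup>2 \<le> C * (norm (e 0))\<^sup>2"
      using hc[of "e 0" "e 0"] hC[of "e 0" "e 0"] by linarith
    then have "C > 0" using c \<open>e 0 \<noteq> 0\<close> by simp
    then show ?thesis using c by (simp add: K_def)
  qed
  show False
  proof (rule growth_contradiction[OF cont _ K])
    show "0 < a z \<and> 0 \<le> b z \<and> b z \<le> K * a z \<and> a z * ((norm z)\<^sup>2) ^ (CARD('n) - 1) \<le> M" if "z \<noteq> 0" for z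
      using main[OF that] card by simp
  next
    fix T N :: real assume N: "exp (T / 2) + 2 \<le> N"
    define G where "G z = 3 * (depth T z)\<^sup>2 * a z - 6 * depth T z * b z" for z
    have "integral (slab m N) (\<lambda>z. pair2 (\<lambda>x y. dsg \<i> (\<lambda>w. dsg (- \<i>)
        (\<lambda>z. complex_of_real (depth T z ^ 3)) w x) z y) (pw (h z) k) (2 * k) v) = 0"
      by (rule integral_pairing_zero[OF Ck_on_pw[OF open_punctured smooth] closed v Ck_on_test _ N])
        (auto simp: depth_eq_0)
    \<comment> \<open>The factor \<open>- 2 * \<i> * fact k\<close> of \<open>A\<close> and
      \<open>B\<close> reverses the signs of the Levi form, so the quadratic term of
      \<open>G\<close> is the positive one.\<close>
    moreover have "pair2 (\<lambda>x y. dsg \<i> (\<lambda>w. dsg (- \<i>)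
        (\<lambda>z. complex_of_real (depth T z ^ 3)) w x) z y) (pw (h z) k) (2 * k) v =
        (2 * \<i> * fact k) * of_real (G z)" if "z \<in> slab m N" for z
    proof -
      have z: "z \<noteq> 0" using that slab_subset[of m N] by blast
      show ?thesis
        unfolding Levi_form_test[OF z] pair2_combination A_def[symmetric] B_def[symmetric]
        using main[OF z] by (simp add: G_def algebra_simps)
    qed
    ultimately have "integral (slab m N) (\<lambda>z. (2 * \<i> * fact k) * complex_of_real (G z)) = 0"
      by (simp cong: integral_cong)
    then have 0: "integral (slab m N) (\<lambda>z. complex_of_real (G z)) = 0"
      using nz by (simp only: integral_mult_right mult_eq_0_iff) auto
    have "continuous_on (slab m N) (\<lambda>z. complex_of_real (G z))"
      unfolding G_def depth_def
      by (intro continuous_intros continuous_on_subset[OF cont(1) slab_subset]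
          continuous_on_subset[OF cont(2) slab_subset]) (use slab_subset[of m N] in auto)
    then have "(\<lambda>z. complex_of_real (G z)) integrable_on slab m N"
      unfolding slab_def by (rule integrable_continuous)
    from integral_linear[OF this bounded_linear_Re] 0
    show "integral (slab m N) G = 0" by (simp add: o_def)
  qed
qed

section \<open>Similarities and their orbits\<close>

lemma norm_unitary_image:
  fixes A :: "complex^'n::finite^'n"
  assumes "unitary_matrix A"
  shows "norm (z v* A) = norm z"
proof -
  have "(A ** (\<chi> i j. cnj (A $ j $ i))) $ i $ k = mat 1 $ i $ k" for i k
    using assms by (simp add: unitary_matrix_def)
  then have AA: "(\<Sum>j\<in>UNIV. A $ i $ j * cnj (A $ k $ j)) = (if i = k then 1 else 0)" for i k
    by (simp add: matrix_matrix_mult_def mat_def)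
  have "ip (z v* A) (z v* A) = (\<Sum>j\<in>UNIV. \<Sum>i\<in>UNIV. \<Sum>k\<in>UNIV. (z $ i * cnj (z $ k)) * (A $ i $ j * cnj (A $ k $ j)))"
    by (simp add: ip_def vector_matrix_mult_def sum_product ac_simps)
  also have "\<dots> = (\<Sum>i\<in>UNIV. \<Sum>k\<in>UNIV. \<Sum>j\<in>UNIV. (z $ i * cnj (z $ k)) * (A $ i $ j * cnj (A $ k $ j)))"
    by (subst sum.swap, rule sum.cong[OF refl], rule sum.swap)
  also have "\<dots> = (\<Sum>i\<in>UNIV. z $ i * cnj (z $ i))"
    unfolding sum_distrib_left[symmetric] AA by (simp add: if_distrib cong: if_cong)
  finally have "ip (z v* A) (z v* A) = ip z z" by (simp add: ip_def)
  then have "(norm (z v* A))\<^sup>2 = (norm z)\<^sup>2"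
    unfolding ip_self of_real_eq_iff .
  then show ?thesis by simp
qed

lemma norm_similarity:
  assumes "unitary_matrix A" "a > 1"
  shows "norm (similarity a A z) = a * norm z"
  using assms by (simp add: similarity_def norm_complex_vector_mult norm_unitary_image)

lemma similarity_add: "similarity a A (u + v) = similarity a A u + similarity a A v"
  by (simp add: similarity_def vec_eq_iff vector_matrix_mult_def algebra_simps sum.distrib)

lemma similarity_mult: "similarity a A (c *s v) = c *s similarity a A v"
  by (simp add: similarity_def vec_eq_iff vector_matrix_mult_def sum_distrib_left ac_simps)

lemma linear_similarity: "linear (similarity a A)"
  by (auto simp: linear_iff similarity_add similarity_mult scaleR_eq_vector_mult)

lemma bij_similarity:
  fixes A :: "complex^'n::finite^'n"
  assumes "unitary_matrix A" "a > 1"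
  shows "bij (similarity a A)"
proof -
  have "z = 0" if "similarity a A z = 0" for z
    using norm_similarity[OF assms, of z] assms that by simp
  then have "inj (similarity a A)"
    using linear_injective_0[OF linear_similarity] by blast
  then show ?thesis
    using linear_inj_imp_surj[OF linear_similarity] by (simp add: bij_def)
qed

text \<open>A backward iterate of one point is a point that reaches it by forward iteration, so
  \<open>inv f\<close> disappears from later arguments.\<close>

lemma cyclic_orbit_iff:
  assumes "bij f"
  shows "w \<in> cyclic_orbit f z \<longleftrightarrow> (\<exists>k. w = (f ^^ k) z \<or> z = (f ^^ k) w)"
proof -
  have "w = (inv f ^^ k) z \<longleftrightarrow> z = (f ^^ k) w" for k
    using inv_fn[OF assms, of k] bij_fn[OF assms, of k] by (metis bij_inv_eq_iff)
  then show ?thesis by (auto simp: cyclic_orbit_def)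
qed

lemma cyclic_orbit_step:
  assumes f: "bij f"
  shows "cyclic_orbit f (f z) = cyclic_orbit f z"
proof -
  have inj: "f x = f y \<longleftrightarrow> x = y" for x y using f by (meson bij_is_inj inj_eq)
  have "(\<exists>k. w = (f ^^ k) (f z) \<or> f z = (f ^^ k) w) \<longleftrightarrow> (\<exists>k. w = (f ^^ k) z \<or> z = (f ^^ k) w)" for w
  proof
    assume "\<exists>k. w = (f ^^ k) (f z) \<or> f z = (f ^^ k) w"
    then obtain k where "w = (f ^^ k) (f z) \<or> f z = (f ^^ k) w" by blast
    then show "\<exists>k. w = (f ^^ k) z \<or> z = (f ^^ k) w"
    proof
      assume "w = (f ^^ k) (f z)"
      then have "w = (f ^^ Suc k) z" by (simp add: funpow_swap1)
      then show ?thesis by blast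
    next
      assume k: "f z = (f ^^ k) w"
      show ?thesis
      proof (cases k)
        case 0
        then have "w = (f ^^ 1) z" using k by simp
        then show ?thesis by blast
      next
        case (Suc j)
        then have "z = (f ^^ j) w" using k inj by simp
        then show ?thesis by blast
      qed
    qed
  next
    assume "\<exists>k. w = (f ^^ k) z \<or> z = (f ^^ k) w"
    then obtain k where "w = (f ^^ k) z \<or> z = (f ^^ k) w" by blast
    then show "\<exists>k. w = (f ^^ k) (f z) \<or> f z = (f ^^ k) w"
    proof
      assume k: "w = (f ^^ k) z"
      show ?thesis
      proof (cases k)
        case 0
        then have "f z = (f ^^ 1) w" using k by simp
        then show ?thesis by blast
      next
        case (Suc j)
        then have "w = (f ^^ j) (f z)" using k by (simp add: funpow_swap1)
        then show ?thesis by blast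
      qed
    next
      assume "z = (f ^^ k) w"
      then have "f z = (f ^^ Suc k) w" by simp
      then show ?thesis by blast
    qed
  qed
  then show ?thesis by (auto simp: set_eq_iff cyclic_orbit_iff[OF f])
qed

definition annulus :: "real \<Rightarrow> complex^'n::finite \<Rightarrow> (complex^'n) set" where
  "annulus b z = {y. norm z < b * norm y \<and> norm y < b * norm z}"

lemma annulus_props:
  assumes "z \<noteq> 0" "b > 1"
  shows "open (annulus b z)" "0 \<notin> annulus b z" "z \<in> annulus b z"
proof -
  have "open {y. norm z < b * norm y}" "open {y. norm y < b * norm z}"
    by (intro open_Collect_less continuous_intros)+
  then show "open (annulus b z)" unfolding annulus_def by (rule open_Collect_conj)
  show "0 \<notin> annulus b z" using assms by (simp add: annulus_def)
  show "z \<in> annulus b z" using assms by (simp add: annulus_def)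
qed

text \<open>Two norms in this annulus differ by a factor less than
  \<open>sqrt a * sqrt a = a\<close>, whereas a nontrivial iterate of \<open>f\<close> scales the
  norm by at least \<open>a\<close>.\<close>

lemma inj_on_cyclic_orbit:
  assumes f: "bij f" and n: "\<And>y. norm (f y) = a * norm y" and a: "a > 1"
  shows "inj_on (cyclic_orbit f) (annulus (sqrt a) z)"
proof (rule inj_onI)
  have nk: "norm ((f ^^ k) y) = a ^ k * norm y" for k y
    by (induction k) (auto simp: n)
  have b: "sqrt a * sqrt a = a" "sqrt a > 0" using a by simp_all
  have sep: "k = 0" if y: "y \<in> annulus (sqrt a) z" "(f ^^ k) y \<in> annulus (sqrt a) z" for k y
  proof (rule ccontr)
    assume "k \<noteq> 0"
    then have "a ^ 1 \<le> a ^ k" using a by (intro power_increasing) auto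
    then have "a * norm y \<le> norm ((f ^^ k) y)" by (simp add: nk mult_right_mono)
    moreover have "norm ((f ^^ k) y) < sqrt a * norm z" using y by (simp add: annulus_def)
    moreover have "sqrt a * norm z < sqrt a * (sqrt a * norm y)"
      using y b by (intro mult_strict_left_mono) (auto simp: annulus_def)
    ultimately show False using b by (simp add: mult.assoc[symmetric])
  qed
  fix x y assume xy: "x \<in> annulus (sqrt a) z" "y \<in> annulus (sqrt a) z" "cyclic_orbit f x = cyclic_orbit f y"
  have "y = (f ^^ 0) y" by simp
  then have "y \<in> cyclic_orbit f y" unfolding cyclic_orbit_iff[OF f] by blast
  then have "y \<in> cyclic_orbit f x" using xy(3) by simp
  then obtain k where "y = (f ^^ k) x \<or> x = (f ^^ k) y" unfolding cyclic_orbit_iff[OF f] by blast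
  then show "x = y" using sep[of x k] sep[of y k] xy by auto
qed

section \<open>The pulled-back metric\<close>

lemma Ck_on_local:
  assumes "\<And>z. z \<in> S \<Longrightarrow> \<exists>T. z \<in> T \<and> open T \<and> Ck_on k T f"
  shows "Ck_on k S f"
  using assms
proof (induction k arbitrary: f)
  case 0
  show ?case
    unfolding Ck_on.simps
  proof (rule continuous_at_imp_continuous_on, rule ballI)
    fix z assume "z \<in> S"
    then obtain T where "z \<in> T" "open T" "continuous_on T f" using 0 by auto
    then show "isCont f z" using continuous_on_eq_continuous_at by blast
  qed
next
  case (Suc k)
  show ?case
    unfolding Ck_on.simps
  proof (intro conjI ballI allI)
    show "f differentiable at z" if "z \<in> S" for z using Suc.prems[OF that] by auto
    show "Ck_on k S (\<lambda>x. Dir f x u)" for u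
      by (rule Suc.IH) (use Suc.prems in fastforce)
  qed
qed

lemma dform_dform_cong:
  assumes S: "open S" "z \<in> S" "\<And>y w. y \<in> S \<Longrightarrow> \<alpha> y w = \<beta> y w"
  shows "dform s' K' (dform s K \<alpha>) z v = dform s' K' (dform s K \<beta>) z v"
  by (rule dform_cong_open[OF S(1,2)]) (rule dform_cong_open[OF S(1) _ S(3)])

lemma hermitian_inner_pullback:
  assumes h: "hermitian_inner h" and L: "linear L" "\<And>c v. L (c *s v) = c *s L v" "inj L"
  shows "hermitian_inner (\<lambda>u w. h (L u) (L w))"
  unfolding hermitian_inner_def
proof (intro conjI allI impI)
  show "h (L (u + v)) (L w) = h (L u) (L w) + h (L v) (L w)" for u v w
    by (simp add: linear_add[OF L(1)] herm_add_left[OF h])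
  show "h (L (c *s u)) (L w) = c * h (L u) (L w)" for c u w
    by (simp add: L(2) herm_scale_left[OF h])
  show "h (L w) (L u) = cnj (h (L u) (L w))" for u w
    by (rule herm_cnj[OF h])
  show "0 < Re (h (L u) (L u))" if "u \<noteq> 0" for u
    using that L(3) linear_0[OF L(1)] by (intro herm_pos[OF h]) (metis injD)
qed

text \<open>Continuity and smoothness of a metric are given for fixed vectors; this expansion
  extends them to vectors that vary with the point.\<close>

lemma hermitian_expand:
  assumes h: "hermitian_inner h"
  shows "h u w = (\<Sum>i\<in>UNIV. \<Sum>j\<in>UNIV. u $ i * (cnj (w $ j) * h (axis i 1) (axis j 1)))"
proof -
  have "h u w = h (\<Sum>i\<in>UNIV. u $ i *s axis i 1) (\<Sum>j\<in>UNIV. w $ j *s axis j 1)"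
    by (simp add: complex_vector_expansion)
  also have "\<dots> = (\<Sum>i\<in>UNIV. \<Sum>j\<in>UNIV. u $ i * (cnj (w $ j) * h (axis i 1) (axis j 1)))"
    unfolding herm_sum_left[OF h] herm_scale_left[OF h] herm_sum_right[OF h] herm_scale_right[OF h]
    by (subst sum.swap) (simp add: sum_distrib_left mult.left_commute)
  finally show ?thesis .
qed

text \<open>
  The quotient of \<open>|z|\<^sup>2 h\<^sub>z\<close> by the Euclidean metric is invariant under the similarity, so it suffices to bound it
  on a compact fundamental annulus.
\<close>

lemma invariant_metric_comparable:
  fixes h :: "complex^'n::finite \<Rightarrow> complex^'n \<Rightarrow> complex^'n \<Rightarrow> complex"
  assumes h: "\<And>z. z \<noteq> 0 \<Longrightarrow> hermitian_inner (h z)"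
    and cont: "\<And>u w. continuous_on (- {0}) (\<lambda>z. h z u w)"
    and f: "bij f" "\<And>y. norm (f y) = a * norm y" "a > 1"
    and inv: "\<And>z u w. z \<noteq> 0 \<Longrightarrow> h (f z) (f u) (f w) = h z u w"
  obtains c C where "c > 0"
    "\<And>z v. z \<noteq> 0 \<Longrightarrow> c * (norm v)\<^sup>2 \<le> (norm z)\<^sup>2 * Re (h z v v)"
    "\<And>z v. z \<noteq> 0 \<Longrightarrow> (norm z)\<^sup>2 * Re (h z v v) \<le> C * (norm v)\<^sup>2"
proof -
  define X where "X = (cball (0 :: complex^'n) a - ball 0 1) \<times> sphere (0 :: complex^'n) 1"
  define F where "F x = Re (h (fst x) (snd x) (snd x))" for x :: "(complex^'n) \<times> (complex^'n)"
  have X: "fst x \<noteq> 0" "norm (fst x) \<ge> 1" "norm (fst x) \<le> a" "norm (snd x) = 1" if "x \<in> X" for x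
    using that by (auto simp: X_def)
  have "compact X"
    unfolding X_def by (intro compact_Times compact_diff compact_cball compact_sphere open_ball)
  have cF: "continuous_on X F"
  proof -
    have "continuous_on X (\<lambda>x. Re (\<Sum>i\<in>UNIV. \<Sum>j\<in>UNIV. snd x $ i * (cnj (snd x $ j) * h (fst x) (axis i 1) (axis j 1))))"
      by (intro continuous_intros continuous_on_compose2[OF cont]) (use X(1) in auto)
    then show ?thesis
      by (rule continuous_on_eq) (simp add: F_def hermitian_expand[OF h[OF X(1)], symmetric])
  qed
  have "(axis undefined 1, axis undefined 1) \<in> X"
    using f(3) by (simp add: X_def norm_axis_complex)
  then have ne: "X \<noteq> {}" by blast
  obtain x0 where x0: "x0 \<in> X" "\<And>x. x \<in> X \<Longrightarrow> F x0 \<le> F x"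
    using continuous_attains_inf[OF \<open>compact X\<close> ne cF] by blast
  obtain x1 where x1: "x1 \<in> X" "\<And>x. x \<in> X \<Longrightarrow> F x \<le> F x1"
    using continuous_attains_sup[OF \<open>compact X\<close> ne cF] by blast
  define c where "c = F x0"
  \<comment> \<open>On the annulus \<open>(norm z)\<^sup>2\<close> lies between 1 and
    \<open>a\<^sup>2\<close>, so only the upper constant acquires a factor.\<close>
  define C where "C = a\<^sup>2 * F x1"
  have c: "c > 0"
  proof -
    have "snd x0 \<noteq> 0" using X(4)[OF x0(1)] by auto
    then show ?thesis unfolding c_def F_def by (intro herm_pos[OF h[OF X(1)[OF x0(1)]]])
  qed
  define P where "P z \<longleftrightarrow> (\<forall>v. c * (norm v)\<^sup>2 \<le> (norm z)\<^sup>2 * Re (h z v v) \<and>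
      (norm z)\<^sup>2 * Re (h z v v) \<le> C * (norm v)\<^sup>2)" for z
  have P0: "P z" if z: "1 \<le> norm z" "norm z \<le> a" for z
    unfolding P_def
  proof
    fix v :: "complex^'n"
    have z0: "z \<noteq> 0" using z by auto
    show "c * (norm v)\<^sup>2 \<le> (norm z)\<^sup>2 * Re (h z v v) \<and> (norm z)\<^sup>2 * Re (h z v v) \<le> C * (norm v)\<^sup>2"
    proof (cases "v = 0")
      case True
      then show ?thesis by (simp add: herm_zero_left[OF h[OF z0]])
    next
      case False
      define e where "e = of_real (1 / norm v) *s v"
      have "norm e = 1" using False by (simp add: e_def norm_complex_vector_mult norm_divide)
      then have "(z, e) \<in> X" using z by (simp add: X_def)
      then have e: "c \<le> Re (h z e e)" "Re (h z e e) \<le> F x1"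
        using x0(2)[of "(z, e)"] x1(2)[of "(z, e)"] by (simp_all add: c_def F_def)
      have "v = of_real (norm v) *s e" using False by (simp add: e_def)
      then have "h z v v = of_real (norm v) * (of_real (norm v) * h z e e)"
        using herm_scale_left[OF h[OF z0]] herm_scale_right[OF h[OF z0]] by (metis complex_cnj_complex_of_real)
      then have v: "Re (h z v v) = (norm v)\<^sup>2 * Re (h z e e)" by (simp add: power2_eq_square)
      have z2: "1 \<le> (norm z)\<^sup>2" "(norm z)\<^sup>2 \<le> a\<^sup>2" using z by (auto intro: power_mono)
      have "1 * c \<le> (norm z)\<^sup>2 * Re (h z e e)" using z2 e c by (intro mult_mono) auto
      moreover have "(norm z)\<^sup>2 * Re (h z e e) \<le> C"
        unfolding C_def using z2 e c by (intro mult_mono) auto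
      ultimately show ?thesis
        unfolding v using mult_right_mono[of c "(norm z)\<^sup>2 * Re (h z e e)" "(norm v)\<^sup>2"]
          mult_right_mono[of "(norm z)\<^sup>2 * Re (h z e e)" C "(norm v)\<^sup>2"]
        by (simp add: ac_simps)
    qed
  qed
  \<comment> \<open>Both sides of each inequality scale by \<open>a\<^sup>2\<close>, and
    \<open>v\<close> may be replaced by \<open>f v\<close> because \<open>f\<close> is onto.\<close>
  have Pf: "P (f z) \<longleftrightarrow> P z" if z: "z \<noteq> 0" for z
  proof -
    have a2: "a\<^sup>2 > 0" using f(3) by simp
    have eq: "c * (norm (f v))\<^sup>2 \<le> (norm (f z))\<^sup>2 * Re (h (f z) (f v) (f v)) \<longleftrightarrow>
        c * (norm v)\<^sup>2 \<le> (norm z)\<^sup>2 * Re (h z v v)"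
      "(norm (f z))\<^sup>2 * Re (h (f z) (f v) (f v)) \<le> C * (norm (f v))\<^sup>2 \<longleftrightarrow>
        (norm z)\<^sup>2 * Re (h z v v) \<le> C * (norm v)\<^sup>2" for v
      unfolding inv[OF z] f(2) power_mult_distrib
      using mult_le_cancel_left_pos[OF a2, of "c * (norm v)\<^sup>2" "(norm z)\<^sup>2 * Re (h z v v)"]
        mult_le_cancel_left_pos[OF a2, of "(norm z)\<^sup>2 * Re (h z v v)" "C * (norm v)\<^sup>2"]
      by (simp_all add: ac_simps)
    have onto: "(\<forall>v. Q v) \<longleftrightarrow> (\<forall>v. Q (f v))" for Q
      using f(1) by (metis bij_pointE)
    show ?thesis unfolding P_def eq[symmetric] by (rule onto)
  qed
  \<comment> \<open>Points beyond the annulus are moved inwards by preimages under \<open>f\<close>,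
    one factor \<open>a\<close> at a time; points of norm less than 1 are afterwards moved outwards
    by \<open>f\<close>.\<close>
  have up: "P z" if "1 \<le> norm z" "norm z \<le> a ^ Suc k" for z k
    using that
  proof (induction k arbitrary: z)
    case 0
    then show ?case using P0 by simp
  next
    case (Suc k)
    show ?case
    proof (cases "norm z \<le> a")
      case True
      then show ?thesis using P0 Suc.prems by simp
    next
      case False
      obtain y where y: "z = f y" using f(1) by (metis bij_pointE)
      have n: "norm z = a * norm y" using f(2) y by simp
      have "a * 1 \<le> a * norm y" using False n by simp
      then have "1 \<le> norm y" using f(3) by (simp only: mult_le_cancel_left_pos)
      moreover have "norm y \<le> a ^ Suc k"
      proof -
        have "a * norm y \<le> a * a ^ Suc k" using Suc.prems n by simp
        then show ?thesis using f(3) by (simp only: mult_le_cancel_left_pos)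
      qed
      ultimately have "P y" by (rule Suc.IH)
      moreover have "y \<noteq> 0" using \<open>1 \<le> norm y\<close> by auto
      ultimately show ?thesis using Pf y by simp
    qed
  qed
  have large: "P z" if "1 \<le> norm z" for z
  proof -
    obtain k where "norm z < a ^ k" using real_arch_pow[OF f(3)] by blast
    also have "a ^ k \<le> a ^ Suc k" using f(3) by (intro power_increasing) auto
    finally have "norm z \<le> a ^ Suc k" by (rule less_imp_le)
    then show ?thesis by (rule up[OF that])
  qed
  have "P z" if "1 \<le> a ^ k * norm z" "z \<noteq> 0" for z k
    using that
  proof (induction k arbitrary: z)
    case 0
    then show ?case using large by simp
  next
    case (Suc k)
    have fz: "f z \<noteq> 0" using f(2)[of z] f(3) Suc.prems(2) by (metis mult_eq_0_iff norm_eq_zero not_one_less_zero)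
    have "1 \<le> a ^ k * norm (f z)" using Suc.prems(1) by (simp add: f(2) ac_simps)
    then have "P (f z)" using fz by (rule Suc.IH)
    then show ?case using Pf Suc.prems(2) by simp
  qed
  moreover have "\<exists>k. 1 \<le> a ^ k * norm z" if "z \<noteq> 0" for z :: "complex^'n"
  proof -
    obtain k where "1 / norm z < a ^ k" using real_arch_pow[OF f(3)] by blast
    then show ?thesis using that by (intro exI[of _ k]) (simp add: field_simps)
  qed
  ultimately have all: "P z" if "z \<noteq> 0" for z using that by blast
  show thesis by (rule that[OF c]) (use all P_def in auto)
qed

section \<open>Lifting charts through the orbit map\<close>

lemma topspace_hopf_space: "topspace (hopf_space f) = cyclic_orbit f ` (- {0})"
proof -
  have "{z. z \<noteq> 0 \<and> cyclic_orbit f z \<in> cyclic_orbit f ` (- {0})} = - {0}" by auto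
  then have "openin (hopf_space f) (cyclic_orbit f ` (- {0}))"
    unfolding openin_hopf_space by (simp add: open_punctured)
  then show ?thesis
    using openin_hopf_space[of f] openin_topspace[of "hopf_space f"] openin_subset by blast
qed

text \<open>The charts of the quotient are local inverses of the orbit map, so on an annulus around
  \<open>z\<close> the map \<open>\<tau>\<close> is the coordinate expression of \<open>p\<close> in
  such a chart. The conclusions are then local properties of \<open>p\<close> in
  coordinates.\<close>

lemma hopf_lift_chart:
  fixes f :: "complex^'n::finite \<Rightarrow> complex^'n" and \<A> :: "('x, 'n) chart set"
  assumes f: "bij f" "\<And>y. norm (f y) = a * norm y" "a > 1"
    and hol: "holomorphic_map (hopf_space f) (hopf_atlas f) X \<A> p"
    and unr: "unramified (hopf_atlas f) \<A> p"
    and chart: "(U, \<phi>) \<in> \<A>" "openin X U"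
  defines "W \<equiv> {z. z \<noteq> 0 \<and> p (cyclic_orbit f z) \<in> U}"
    and "\<tau> \<equiv> \<lambda>z. \<phi> (p (cyclic_orbit f z))"
  shows "open W" "holo_on \<tau> W" "\<And>z. z \<in> W \<Longrightarrow> inj (Dir \<tau> z)"
proof -
  let ?\<pi> = "cyclic_orbit f"
  have "continuous_map (hopf_space f) X p" using hol by (simp add: holomorphic_map_def)
  then have "openin (hopf_space f) {x \<in> topspace (hopf_space f). p x \<in> U}"
    using chart(2) by (rule openin_continuous_map_preimage)
  moreover have "{z. z \<noteq> 0 \<and> ?\<pi> z \<in> {x \<in> topspace (hopf_space f). p x \<in> U}} = W"
    by (auto simp: W_def topspace_hopf_space)
  ultimately show W: "open W" unfolding openin_hopf_space by simp
  have loc: "\<exists>g S. open S \<and> z \<in> S \<and> holo_on g S \<and> (\<forall>y\<in>S. g y = \<tau> y) \<and> bij (Dir g z)" if z: "z \<in> W" for z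
  proof -
    have z0: "z \<noteq> 0" using z by (simp add: W_def)
    define V where "V = annulus (sqrt a) z"
    have V: "open V" "0 \<notin> V" "z \<in> V" using annulus_props[OF z0, of "sqrt a"] f(3) by (auto simp: V_def)
    have inj: "inj_on ?\<pi> V" unfolding V_def by (rule inj_on_cyclic_orbit[OF f])
    define c where "c = inv_into V ?\<pi>"
    have at: "(?\<pi> ` V, c) \<in> hopf_atlas f" unfolding hopf_atlas_def c_def using V inj by blast
    have c\<pi>: "c (?\<pi> y) = y" if "y \<in> V" for y using inj that by (simp add: c_def)
    have cinj: "inj_on c (?\<pi> ` V)" by (auto simp: inj_on_def c\<pi>)
    have ic: "inv_into (?\<pi> ` V) c y = ?\<pi> y" if "y \<in> V" for y
      using inv_into_f_f[OF cinj, of "?\<pi> y"] c\<pi>[OF that] that by simp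
    have S: "c ` (?\<pi> ` V \<inter> p -` U) = V \<inter> W"
      using V(2) by (force simp: W_def c\<pi> image_iff)
    let ?g = "\<phi> \<circ> p \<circ> inv_into (?\<pi> ` V) c"
    have "holo_on ?g (V \<inter> W)"
      using hol at chart(1) unfolding holomorphic_map_def S[symmetric] by fastforce
    moreover have "\<forall>z\<in>c ` (?\<pi> ` V \<inter> p -` U). bij (Dir ?g z)"
      using bspec[OF bspec[OF unr[unfolded unramified_def] at, unfolded prod.case] chart(1)] by simp
    then have "bij (Dir ?g z)" using z V(3) unfolding S by blast
    moreover have "?g y = \<tau> y" if "y \<in> V \<inter> W" for y
      using that by (simp add: ic \<tau>_def)
    ultimately show ?thesis using V W z by (intro exI[of _ ?g] exI[of _ "V \<inter> W"]) auto
  qed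
  show "holo_on \<tau> W"
    unfolding holo_on_def
  proof
    fix z assume "z \<in> W"
    then obtain g S where g: "open S" "z \<in> S" "holo_on g S" "\<forall>y\<in>S. g y = \<tau> y" using loc by blast
    have "(\<tau> has_derivative Dir g z) (at z)"
      by (rule has_derivative_transform_within_open[OF holo_onD(1)[OF g(3,2)] g(1,2)]) (use g(4) in blast)
    then show "\<exists>D. (\<tau> has_derivative D) (at z) \<and> (\<forall>c v. D (c *s v) = c *s D v)"
      using holo_onD(2)[OF g(3,2)] by blast
  qed
  show "inj (Dir \<tau> z)" if z: "z \<in> W" for z
  proof -
    obtain g S where g: "open S" "z \<in> S" "\<forall>y\<in>S. g y = \<tau> y" "bij (Dir g z)" using loc[OF z] by blast
    have "Dir g z = Dir \<tau> z" by (rule frechet_derivative_cong_open[OF g(1,2)]) (use g(3) in blast)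
    then show ?thesis using g(4) bij_is_inj by metis
  qed
qed

theorem corollary7:
  fixes X :: "'x topology" and \<A> :: "('x, 'n::finite) chart set"
  assumes "similarity_hopf_manifold X \<A>"
    and "CARD('n) \<ge> 3"
  shows "\<not> (\<exists>H. hermitian_metric \<A> H \<and> astheno_kaehler \<A> H)"
proof
  assume "\<exists>H. hermitian_metric \<A> H \<and> astheno_kaehler \<A> H"
  then obtain H where H: "hermitian_metric \<A> H" and ak: "astheno_kaehler \<A> H" by blast
  obtain a and A :: "complex^'n^'n" and p where a: "a > 1" and A: "unitary_matrix A"
    and hol: "holomorphic_map (hopf_space (similarity a A)) (hopf_atlas (similarity a A)) X \<A> p"
    and unr: "unramified (hopf_atlas (similarity a A)) \<A> p"
    and X: "complex_atlas X \<A>"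
    using assms(1) unfolding similarity_hopf_manifold_def complex_manifold_def Let_def by blast
  define f where "f = similarity a A"
  have f: "bij f" "\<And>y. norm (f y) = a * norm y" "a > 1"
    using bij_similarity[OF A a] norm_similarity[OF A a] a by (simp_all add: f_def)
  have f_lin: "linear f" and f0: "f z \<noteq> 0" if "z \<noteq> 0" for z
    using f that by (simp_all add: f_def linear_similarity) (metis mult_eq_0_iff norm_eq_zero not_one_less_zero)
  note hol = hol[folded f_def] and unr = unr[folded f_def]
  define P where "P z = p (cyclic_orbit f z)" for z
  define W where "W c = {z. z \<noteq> 0 \<and> P z \<in> fst c}" for c :: "('x, 'n) chart"
  define \<tau> where "\<tau> c z = snd c (P z)" for c :: "('x, 'n) chart" and z
  have chart: "openin X (fst c)" "open (snd c ` fst c)" "inj_on (snd c) (fst c)" if "c \<in> \<A>" for c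
  proof -
    have c: "(fst c, snd c) \<in> \<A>" using that by simp
    have "openin X (fst c) \<and> open (snd c ` fst c) \<and>
        homeomorphic_map (subtopology X (fst c)) (top_of_set (snd c ` fst c)) (snd c)"
      using X c unfolding complex_atlas_def by fastforce
    moreover from this have "inj_on (snd c) (topspace (subtopology X (fst c)))"
      using homeomorphic_imp_injective_map by blast
    ultimately show "openin X (fst c)" "open (snd c ` fst c)" "inj_on (snd c) (fst c)"
      using openin_subset[of X "fst c"] by (auto simp: topspace_subtopology Int_absorb1)
  qed
  have W: "open (W c)" "holo_on (\<tau> c) (W c)" "\<And>z. z \<in> W c \<Longrightarrow> inj (Dir (\<tau> c) z)" if "c \<in> \<A>" for c
    using hopf_lift_chart[OF f hol unr, of "fst c" "snd c"] that chart(1)[OF that]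
    unfolding W_def \<tau>_def P_def by auto
  have \<tau>_im: "\<tau> c z \<in> snd c ` fst c" if "z \<in> W c" for c z using that by (auto simp: W_def \<tau>_def)
  have ex: "\<exists>c\<in>\<A>. z \<in> W c" if z: "z \<noteq> 0" for z
  proof -
    have "P z \<in> topspace X"
      using hol z topspace_hopf_space[of f] unfolding holomorphic_map_def continuous_map_def P_def by blast
    moreover have "(\<Union>(U, \<phi>)\<in>\<A>. U) = topspace X" using X unfolding complex_atlas_def by blast
    ultimately have "P z \<in> (\<Union>(U, \<phi>)\<in>\<A>. U)" by simp
    then obtain U \<phi> where "(U, \<phi>) \<in> \<A>" "P z \<in> U" by auto
    then show ?thesis using z by (intro bexI[of _ "(U, \<phi>)"]) (simp_all add: W_def)
  qed
  \<comment> \<open>An arbitrary chart is picked at each point to define \<open>h\<close>;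
    \<open>h_chart\<close> shows that all charts give the same value, which permits computing near a
    point in one fixed chart.\<close>
  define ch where "ch z = (SOME c. c \<in> \<A> \<and> z \<in> W c)" for z
  have ch: "ch z \<in> \<A>" "z \<in> W (ch z)" if "z \<noteq> 0" for z
    using someI_ex[of "\<lambda>c. c \<in> \<A> \<and> z \<in> W c"] ex[OF that] unfolding ch_def by blast+
  define h where "h z u w = H (ch z) (\<tau> (ch z) z) (Dir (\<tau> (ch z)) z u) (Dir (\<tau> (ch z)) z w)" for z u w
  have h_chart: "h z u w = H c (\<tau> c z) (Dir (\<tau> c) z u) (Dir (\<tau> c) z w)" if c: "c \<in> \<A>" "z \<in> W c" for c z u w
  proof -
    have z: "z \<noteq> 0" using c by (simp add: W_def)
    define c' where "c' = ch z"
    have c': "c' \<in> \<A>" "z \<in> W c'" using ch[OF z] by (simp_all add: c'_def)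
    \<comment> \<open>\<open>T\<close> is the transition map; near \<open>z\<close> it carries
      \<open>\<tau> c'\<close> to \<open>\<tau> c\<close>, so the transformation law of the metric
      matches the chain rule.\<close>
    define T where "T = snd c \<circ> inv_into (fst c') (snd c')"
    have inv: "inv_into (fst c') (snd c') (\<tau> c' y) = P y" if "y \<in> W c'" for y
      using that chart(3)[OF c'(1)] by (simp add: W_def \<tau>_def)
    have T\<tau>: "T (\<tau> c' y) = \<tau> c y" if "y \<in> W c'" for y
      using inv[OF that] by (simp add: T_def \<tau>_def)
    have z': "\<tau> c' z \<in> snd c' ` (fst c' \<inter> fst c)"
      using c c' by (auto simp: W_def \<tau>_def)
    have "holo_on T (snd c' ` (fst c' \<inter> fst c))"
      using X c(1) c'(1) unfolding complex_atlas_def T_def by fastforce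
    then have DT: "(T has_derivative Dir T (\<tau> c' z)) (at (\<tau> c' z))" by (rule holo_onD(1)[OF _ z'])
    have "((\<lambda>y. T (\<tau> c' y)) has_derivative (\<lambda>u. Dir T (\<tau> c' z) (Dir (\<tau> c') z u))) (at z)"
      by (rule has_derivative_compose[OF holo_onD(1)[OF W(2)[OF c'(1)] c'(2)] DT])
    then have "(\<tau> c has_derivative (\<lambda>u. Dir T (\<tau> c' z) (Dir (\<tau> c') z u))) (at z)"
      by (rule has_derivative_transform_within_open[OF _ W(1)[OF c'(1)] c'(2)]) (rule T\<tau>)
    then have D: "Dir (\<tau> c) z = (\<lambda>u. Dir T (\<tau> c' z) (Dir (\<tau> c') z u))"
      by (rule frechet_derivative_eq)
    have law: "\<forall>(U, \<phi>)\<in>\<A>. \<forall>(V, \<psi>)\<in>\<A>. \<forall>z\<in>\<phi> ` (U \<inter> V). \<forall>u w.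
        H (U, \<phi>) z u w = H (V, \<psi>) ((\<psi> \<circ> inv_into U \<phi>) z)
          (Dir (\<psi> \<circ> inv_into U \<phi>) z u) (Dir (\<psi> \<circ> inv_into U \<phi>) z w)"
      using H unfolding hermitian_metric_def Let_def by (rule conjunct2)
    have "\<forall>z\<in>snd c' ` (fst c' \<inter> fst c). \<forall>u w. H c' z u w = H c (T z) (Dir T z u) (Dir T z w)"
      using bspec[OF bspec[OF law c'(1), unfolded split_beta] c(1)] by (simp add: T_def split_beta)
    then have "H c' (\<tau> c' z) x y = H c (T (\<tau> c' z)) (Dir T (\<tau> c' z) x) (Dir T (\<tau> c' z) y)" for x y
      using z' by blast
    then show ?thesis
      by (simp add: h_def c'_def[symmetric] D T\<tau>[OF c'(2)])
  qed
  have Hh: "hermitian_inner (H c x)" "smooth_on (snd c ` fst c) (\<lambda>x. H c x u w)"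
    if "c \<in> \<A>" "x \<in> snd c ` fst c" for c x u w
    using H that unfolding hermitian_metric_def by fastforce+
  have herm: "hermitian_inner (h z)" if z: "z \<noteq> 0" for z
  proof -
    let ?c = "ch z"
    have c: "?c \<in> \<A>" "z \<in> W ?c" by (rule ch[OF z])+
    let ?L = "Dir (\<tau> ?c) z"
    have L: "linear ?L" "\<And>c v. ?L (c *s v) = c *s ?L v" "inj ?L"
      using holo_onD[OF W(2)[OF c(1)] c(2)] has_derivative_linear W(3)[OF c] by blast+
    have "hermitian_inner (\<lambda>u w. H ?c (\<tau> ?c z) (?L u) (?L w))"
      by (rule hermitian_inner_pullback[OF Hh(1)[OF c(1) \<tau>_im[OF c(2)]] L])
    then show ?thesis by (simp only: h_def[abs_def])
  qed
  have smooth: "Ck_on j (- {0}) (\<lambda>z. h z u w)" for j u w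
  proof (rule Ck_on_local)
    fix z :: "complex^'n" assume "z \<in> - {0}"
    then obtain c where c: "c \<in> \<A>" "z \<in> W c" using ex by blast
    let ?e = "\<lambda>i. axis i 1 :: complex^'n"
    have D: "Ck_on j (W c) (\<lambda>y. Dir (\<tau> c) y u $ i)" for u i
      by (rule cholo_on_Ck_on[OF W(1)[OF c(1)] holo_on_nth(1)[OF holo_on_Dir[OF W(1,2)[OF c(1)]]]])
    have "Ck_on j (snd c ` fst c) (\<lambda>x. H c x u w)" for u w
      using Hh(2)[OF c(1) \<tau>_im[OF c(2)]] unfolding smooth_on_def by blast
    then have E: "Ck_on j (W c) (\<lambda>y. H c (\<tau> c y) u w)" for u w
      by (rule Ck_on_compose[OF W(1)[OF c(1)] _ holo_on_Ck_on[OF W(1,2)[OF c(1)]] \<tau>_im])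
    have sum: "Ck_on j (W c) (\<lambda>y. \<Sum>i\<in>UNIV. \<Sum>l\<in>UNIV. Dir (\<tau> c) y u $ i *
        (cnj (Dir (\<tau> c) y w $ l) * H c (\<tau> c y) (?e i) (?e l)))"
      by (intro Ck_on_sum Ck_on_mult Ck_on_linear[OF _ bounded_linear_cnj] W(1)[OF c(1)] D E)
    have eq: "h y u w = (\<Sum>i\<in>UNIV. \<Sum>l\<in>UNIV. Dir (\<tau> c) y u $ i *
        (cnj (Dir (\<tau> c) y w $ l) * H c (\<tau> c y) (?e i) (?e l)))" if "y \<in> W c" for y
      unfolding h_chart[OF c(1) that]
      by (rule hermitian_expand[OF Hh(1)[OF c(1) \<tau>_im[OF that]]])
    have "Ck_on j (W c) (\<lambda>y. h y u w)"
      by (rule iffD2[OF Ck_on_cong[OF W(1)[OF c(1)] eq] sum])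
    then show "\<exists>T. z \<in> T \<and> open T \<and> Ck_on j T (\<lambda>z. h z u w)"
      using c W(1) by blast
  qed
  \<comment> \<open>The orbit map absorbs \<open>f\<close>, so composing \<open>\<tau> c\<close>
    with \<open>f\<close> does not change it, and the chain rule relates its derivatives at
    \<open>z\<close> and \<open>f z\<close>.\<close>
  have inv: "h (f z) (f u) (f w) = h z u w" if z: "z \<noteq> 0" for z u w
  proof -
    obtain c where c: "c \<in> \<A>" "z \<in> W c" using ex[OF z] by blast
    have Pf: "P (f y) = P y" for y by (simp add: P_def cyclic_orbit_step[OF f(1)])
    have fz: "f z \<in> W c" using c(2) f0[OF z] by (simp add: W_def Pf)
    have "(f has_derivative f) (at z)"
      using f_lin[OF z] by (simp add: linear_conv_bounded_linear bounded_linear_imp_has_derivative)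
    then have "((\<lambda>y. \<tau> c (f y)) has_derivative (\<lambda>u. Dir (\<tau> c) (f z) (f u))) (at z)"
      by (rule has_derivative_compose) (rule holo_onD(1)[OF W(2)[OF c(1)] fz])
    then have D: "Dir (\<tau> c) z = (\<lambda>u. Dir (\<tau> c) (f z) (f u))"
      by (intro frechet_derivative_eq) (simp add: \<tau>_def[abs_def] Pf)
    show ?thesis
      unfolding h_chart[OF c(1) fz] h_chart[OF c] D by (simp add: \<tau>_def Pf)
  qed
  define k where "k = CARD('n) - 2"
  \<comment> \<open>Near \<open>z\<close> the metric \<open>h\<close> is the pullback of
    \<open>H c\<close> by the holomorphic map \<open>\<tau> c\<close>, and both Dolbeault operators
    commute with this pullback.\<close>
  have closed: "dform (- \<i>) (Suc (2 * k)) (dform \<i> (2 * k) (\<lambda>z. pw (h z) k)) z v = 0" if z: "z \<noteq> 0" for z v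
  proof -
    obtain c where c: "c \<in> \<A>" "z \<in> W c" using ex[OF z] by blast
    let ?\<alpha> = "\<lambda>x. pw (H c x) k"
    let ?T = "snd c ` fst c"
    have T: "open ?T" by (rule chart(2)[OF c(1)])
    have "Ck_on 2 ?T (\<lambda>x. H c x u w)" for u w
      using Hh(2)[OF c(1) \<tau>_im[OF c(2)]] unfolding smooth_on_def by blast
    then have s: "Ck_on 2 ?T (\<lambda>x. ?\<alpha> x w)" for w by (rule Ck_on_pw[OF T])
    have "pw (h y) k w = pullback (\<tau> c) ?\<alpha> y w" if "y \<in> W c" for y w
      unfolding pullback_def pw_pullback[symmetric] h_chart[OF c(1) that, abs_def] ..
    then have "dform (- \<i>) (Suc (2 * k)) (dform \<i> (2 * k) (\<lambda>z. pw (h z) k)) z v =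
        dform (- \<i>) (Suc (2 * k)) (dform \<i> (2 * k) (pullback (\<tau> c) ?\<alpha>)) z v"
      by (rule dform_dform_cong[OF W(1)[OF c(1)] c(2)])
    also have "\<dots> = pullback (\<tau> c) (dform (- \<i>) (Suc (2 * k)) (dform \<i> (2 * k) ?\<alpha>)) z v"
      by (rule dform_dform_pullback[OF W(1)[OF c(1)] c(2) T W(2)[OF c(1)] \<tau>_im alt_form_pw[OF Hh(1)[OF c(1)]] s])
    also have "\<dots> = dform (- \<i>) (Suc (2 * k)) (dform \<i> (2 * k) ?\<alpha>) (\<tau> c z) (\<lambda>i. Dir (\<tau> c) z (v i))"
      by (simp add: pullback_def)
    also have "\<dots> = dform (- \<i>) (Suc (2 * k)) (dform \<i> (2 * k)
        (wedge_power2 (fundamental_form (H c)) k)) (\<tau> c z) (\<lambda>i. Dir (\<tau> c) z (v i))"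
      by (rule dform_dform_cong[OF T \<tau>_im[OF c(2)]]) (simp add: wedge_power2_pw Hh(1)[OF c(1)])
    also have "\<dots> = 0"
      using ak c(1) \<tau>_im[OF c(2)] unfolding astheno_kaehler_def Let_def k_def[symmetric] del_dform delbar_dform
      by fastforce
    finally show ?thesis .
  qed
  show False
  proof (rule invariant_metric_comparable[where h = h and f = f and a = a])
    show "continuous_on (- {0}) (\<lambda>z. h z u w)" for u w using smooth[of 0] by simp
  next
    fix b C
    assume bC: "b > 0" "\<And>z v. z \<noteq> 0 \<Longrightarrow> b * (norm v)\<^sup>2 \<le> (norm z)\<^sup>2 * Re (h z v v)"
      "\<And>z v. z \<noteq> 0 \<Longrightarrow> (norm z)\<^sup>2 * Re (h z v v) \<le> C * (norm v)\<^sup>2"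
    show False
      by (rule no_astheno_kaehler_comparable[where h = h and c = b and C = C, OF assms(2) k_def])
        (fact herm smooth bC closed)+
  qed (fact herm f inv)+
qed

end
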